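(* Let $(G,L)$ be a $(G,L)$-pair and let $\Gamma_\infty=L^\Xi\setminus G/L^\Xi$ be its mantle. Any unitary representation $\rho$ of the pair $(G,L)$ extends canonically to a representation of the semigroup $\Gamma_\infty$. That is, regarding $G$ as embedded in $\Gamma_\infty$ by the injective homomorphism $g\mapsto L^\Xi\, i_\tau(g)\,L^\Xi$, there is a representation $R$ of $\Gamma_\infty$ in the space $H$ of $\rho$, unitarily equivalent to the representation $\overline\rho_{\Xi,\Xi}$ of $\Gamma_\infty$ in $H^{[\Xi]}$, such that $R(L^\Xi\, i_\tau(g)\,L^\Xi)=\rho(g)$ for all $g\in G$.
   Context: Classical groups. A matrix $g$ over $\mathbb R,\mathbb C$ or $\mathbb H$ with rows and columns indexed by a countable basis is finite if $g-1$ has only finitely many nonzero entries. All groups below consist of finite invertible matrices satisfying the usual identities. The irreducible classical groups and their maximal heavy subgroups are: $\mathrm{GL}(\infty,\mathbb R)\supset \mathrm O(\infty)$; $\mathrm{GL}(\infty,\mathbb C)\supset \mathrm U(\infty)$; $\mathrm{GL}(\infty,\mathbb H)\supset\mathrm{Sp}(\infty)$; $\mathrm U(\infty,\infty)\supset \mathrm U(\infty)\times \mathrm U(\infty)$; $\mathrm{Sp}(2\infty,\mathbb R)\supset \mathrm U(\infty)$; $\mathrm{Sp}(2\infty,\mathbb C)\supset\mathrm{Sp}(\infty)$; $\mathrm{Sp}(\infty,\infty)\supset\mathrm{Sp}(\infty)\times\mathrm{Sp}(\infty)$; $\mathrm O(\infty,\infty)\supset\mathrm O(\infty)\times\mathrm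 O(\infty)$; $\mathrm O(\infty,\mathbb C)\supset\mathrm O(\infty)$; $\mathrm{SO}^*(2\infty)\supset\mathrm U(\infty)$; $\mathrm U(p,\infty)\supset\mathrm U(\infty)$; $\mathrm O(p,\infty)\supset\mathrm O(\infty)$; $\mathrm{Sp}(p,\infty)\supset\mathrm{Sp}(\infty)$ with $0\le p<\infty$ (for $p=0$: the groups $\mathrm U(\infty),\mathrm O(\infty),\mathrm{Sp}(\infty)$ themselves). Here $\mathrm{Sp}(\infty)$ is the quaternionic unitary group. A classical group is a finite product of irreducible ones; its maximal heavy subgroup $K$ is the product of the maximal heavy subgroups of the factors. A heavy group is a finite product of groups $\mathrm O(\infty),\mathrm U(\infty),\mathrm{Sp}(\infty)$ (called irreducible heavy groups). Straight homomorphisms. Trivial homomorphisms between irreducible heavy groups are: the identity maps, elementwise complex conjugation of $\mathrm U(\infty)$, and the obvious maps $\mathrm O(\infty)\to\mathrm U(\infty)$, $\mathrm O(\infty)\to\mathrm{Sp}(\infty)$, $\mathrm U(\infty)\to\mathrm{Sp}(\infty)$, $\mathrm U(\infty)\to\mathrm O(2\infty)$, $\mathrm{Sp}(\infty)\to\mathrm O(4\infty)$, $\mathrm{Sp}(\infty)\to\mathrm U(2\infty)$. For $L=L_1\times\dots\times L_p$ heavy and $K$ irreducible heavy, a homomorphism $L\to K$ is straight if it has the block diagonal form $(g_1,\dots,g_p)\mapsto\mathrm{diag}(1_a,\tau_1(g_{m_1}),\dots,\tau_N(g_{m_N}))$ with $\tau_j$ trivial, $0<N<\infty$, $a\in\{0,1,2,\dots,\infty\}$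 (not required to be faithful). For $K=K_1\times\dots\times K_q$, a straight homomorphism $L\to K$ is a product of straight homomorphisms $L\to K_i$. A $(G,L)$-pair consists of a classical group $G$ with maximal heavy subgroup $K$ and a heavy group $L$ straightly embedded in $K$. A unitary representation of the pair $(G,L)$ is a unitary representation $\rho$ of $G$ in a Hilbert space $H$ whose restriction to $L$ is continuous (with respect to the weak operator topology on $L$). Mantle. Let $L=L_1\times\dots\times L_p$, where $L_j$ acts in a space $\ell_2=\ell_2(\mathbb N)$. For each $j$ split $\mathbb N=\Xi_j\sqcup\Omega_j$ into two infinite (countable) subsets and fix a bijection $\tau_j:\mathbb N\to\Xi_j$. Let $L^\Xi\subset L$ be the product of the stabilizers in $L_j$ of all basis vectors with indices in $\Xi_j$. The group $G$ acts in a direct sum of $\ell_2$'s whose basis consists of basis vectors of copies of the $\ell_2$'s of the $L_j$ and of basis vectors fixed by $L$. Let $G(\Xi)\subset G$ be the subgroup of elements that fix all basis vectors with indices in the $\Omega_j$ and preserve the span of the remaining basis vectors. Relabelling basis vectors by the $\tau_j$ (and leaving the $L$-fixed ones unchanged) gives an isomorphism $i_\tau:G\to G(\Xi)$. Enumerate $\Omega_j=\{\omega_{j,1},\omega_{j,2},\dots\}$ and, for a multi-index $m$, let $\Theta^{[\Xi]}_m\in L^\Xi$ be the element whose $j$-th component is the permutation matrix swapping the basis vectors $\omega_{j,i}$ and $\omega_{j,m_j+i}$, $1\le i\le m_j$, and fixing all others. The mantle is the set $\Gamma_\infty=L^\Xi\setminus G/L^\Xi$ with the product $\mathfrak g\circ\mathfrak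 h:=$ the value of $L^\Xi g\Theta_m^{[\Xi]}hL^\Xi$ for all sufficiently large $m$, $g\in\mathfrak g,h\in\mathfrak h$ (it stabilizes and does not depend on the choice of representatives). For a representation $\rho$ of the pair, $H^{[\Xi]}$ is the space of $L^\Xi$-fixed vectors, $P^{[\Xi]}$ is the orthogonal projection onto it, and $\overline\rho_{\Xi,\Xi}(g)=P^{[\Xi]}\rho(g):H^{[\Xi]}\to H^{[\Xi]}$, which depends only on $L^\Xi gL^\Xi$. *)

theory Defs
  imports "HOL-Analysis.Analysis" "HOL-Library.Extended_Nat" "HOL-Algebra.Group"
begin

section \<open>Quaternions\<close>

text \<open>\<open>Quat z w\<close> is the quaternion \<open>z + w j\<close>; the complex numbers are the \<open>Quat z 0\<close>.\<close>

datatype quat = Quat (qfst: complex) (qsnd: complex)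

instantiation quat :: ring_1
begin
definition "0 = Quat 0 0"
definition "1 = Quat 1 0"
definition "x + y = Quat (qfst x + qfst y) (qsnd x + qsnd y)"
definition "x - y = Quat (qfst x - qfst y) (qsnd x - qsnd y)"
definition "- x = Quat (- qfst x) (- qsnd x)"
definition "x * y = Quat (qfst x * qfst y - qsnd x * cnj (qsnd y))
                         (qfst x * qsnd y + qsnd x * cnj (qfst y))"
instance
  by standard
    (simp_all add: zero_quat_def one_quat_def plus_quat_def minus_quat_def uminus_quat_def
       times_quat_def algebra_simps)
end

instantiation quat :: real_algebra_1
begin
definition "r *\<^sub>R x = Quat (r *\<^sub>R qfst x) (r *\<^sub>R qsnd x)"
instance
  by standard
    (simp_all add: plus_quat_def times_quat_def scaleR_quat_def scaleR_add_right scaleR_add_left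
       scaleR_diff_right quat.expand)
end

instantiation quat :: real_inner
begin
definition "inner x y = inner (qfst x) (qfst y) + inner (qsnd x) (qsnd y)"
definition "norm (x::quat) = sqrt (inner x x)"
definition "sgn (x::quat) = inverse (norm x) *\<^sub>R x"
definition "dist (x::quat) y = norm (x - y)"
definition "uniformity = (INF e\<in>{0<..}. principal {(x::quat, y). dist x y < e})"
definition "open U \<longleftrightarrow> (\<forall>x\<in>U. eventually (\<lambda>(x', y). (x'::quat) = x \<longrightarrow> y \<in> U) uniformity)"
instance
proof
  fix x y z :: quat and r :: real
  show "inner x y = inner y x"
    by (simp add: inner_quat_def inner_commute)
  show "inner (x + y) z = inner x z + inner y z"
    by (simp add: inner_quat_def plus_quat_def inner_add_left)
  show "inner (r *\<^sub>R x) y = r * inner x y"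
    by (simp add: inner_quat_def scaleR_quat_def algebra_simps)
  show "0 \<le> inner x x"
    by (simp add: inner_quat_def)
  show "inner x x = 0 \<longleftrightarrow> x = 0"
    by (cases x) (simp add: inner_quat_def zero_quat_def add_nonneg_eq_0_iff)
qed (simp_all add: norm_quat_def sgn_quat_def dist_quat_def uniformity_quat_def open_quat_def)
end

definition qcnj :: "quat \<Rightarrow> quat" where
  "qcnj q = Quat (cnj (qfst q)) (- qsnd q)"

definition quat_of_complex :: "complex \<Rightarrow> quat" where
  "quat_of_complex z = Quat z 0"

text \<open>The real basis \<open>1, i, j, k\<close> and the corresponding coordinates.\<close>

definition qunit :: "nat \<Rightarrow> quat" where
  "qunit r = [Quat 1 0, Quat \<i> 0, Quat 0 1, Quat 0 \<i>] ! r"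

definition qcoord :: "quat \<Rightarrow> nat \<Rightarrow> real" where
  "qcoord q r = [Re (qfst q), Im (qfst q), Re (qsnd q), Im (qsnd q)] ! r"


section \<open>Matrices\<close>

text \<open>Matrices over the reals and the complex numbers are treated as quaternionic matrices whose
  entries are real, respectively complex.\<close>

type_synonym 'i hmat = "'i \<Rightarrow> 'i \<Rightarrow> quat"

datatype scalars = Reals_sc | Complexes_sc | Quaternions_sc

fun scalar_set :: "scalars \<Rightarrow> quat set" where
  "scalar_set Reals_sc = \<real>"
| "scalar_set Complexes_sc = range quat_of_complex"
| "scalar_set Quaternions_sc = UNIV"

definition mat_one :: "'i hmat" where
  "mat_one i j = (if i = j then 1 else 0)"

text \<open>Meaningful if the rows of \<open>g\<close> have finite support, as for all matrices below.\<close>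

definition mat_mult :: "'i hmat \<Rightarrow> 'i hmat \<Rightarrow> 'i hmat" where
  "mat_mult g h i k = (\<Sum>j | g i j \<noteq> 0. g i j * h j k)"

definition mat_transpose :: "'i hmat \<Rightarrow> 'i hmat" where
  "mat_transpose g i j = g j i"

definition mat_adjoint :: "'i hmat \<Rightarrow> 'i hmat" where
  "mat_adjoint g i j = qcnj (g j i)"

text \<open>Finite matrices over \<open>F\<close> with rows and columns indexed by \<open>B\<close>; by convention they are
  continued by the identity outside \<open>B\<close>.\<close>

definition finite_mat :: "scalars \<Rightarrow> 'i set \<Rightarrow> 'i hmat \<Rightarrow> bool" where
  "finite_mat F B g \<longleftrightarrow> finite {(i, j). g i j \<noteq> mat_one i j} \<and>
     (\<forall>i\<in>B. \<forall>j\<in>B. g i j \<in> scalar_set F) \<and>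
     (\<forall>i j. i \<notin> B \<or> j \<notin> B \<longrightarrow> g i j = mat_one i j)"

definition invertible_mats :: "scalars \<Rightarrow> 'i set \<Rightarrow> 'i hmat set" where
  "invertible_mats F B = {g. finite_mat F B g \<and>
     (\<exists>h. finite_mat F B h \<and> mat_mult g h = mat_one \<and> mat_mult h g = mat_one)}"


section \<open>Heavy groups\<close>

text \<open>The irreducible heavy groups \<open>O(\<infinity>)\<close>, \<open>U(\<infinity>)\<close>, \<open>Sp(\<infinity>)\<close> are the unitary groups over the three
  kinds of scalars, and are named by their scalars. A heavy group is named by a list \<open>Ls\<close>; its
  elements are families of matrices, continued by identity matrices.\<close>

definition irreducible_heavy :: "scalars \<Rightarrow> nat hmat set" where
  "irreducible_heavy F = {g \<in> invertible_mats F UNIV. mat_mult (mat_adjoint g) g = mat_one}"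

definition heavy_group :: "scalars list \<Rightarrow> (nat \<Rightarrow> nat hmat) monoid" where
  "heavy_group Ls =
     \<lparr> carrier = {l. (\<forall>j<length Ls. l j \<in> irreducible_heavy (Ls ! j)) \<and>
                     (\<forall>j\<ge>length Ls. l j = mat_one)},
       mult = (\<lambda>l l' j. mat_mult (l j) (l' j)),
       one = (\<lambda>_. mat_one) \<rparr>"

definition ell2 :: "scalars \<Rightarrow> (nat \<Rightarrow> quat) set" where
  "ell2 F = {v. (\<forall>x. v x \<in> scalar_set F) \<and> summable (\<lambda>x. (norm (v x))\<^sup>2)}"

definition mat_apply :: "nat hmat \<Rightarrow> (nat \<Rightarrow> quat) \<Rightarrow> nat \<Rightarrow> quat" where
  "mat_apply g v x = (\<Sum>y | g x y \<noteq> 0. g x y * v y)"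

definition ell2_inner :: "(nat \<Rightarrow> quat) \<Rightarrow> (nat \<Rightarrow> quat) \<Rightarrow> quat" where
  "ell2_inner w v = (\<Sum>x. qcnj (w x) * v x)"

text \<open>The product of the weak operator topologies: the coarsest topology for which all matrix
  coefficients of all factors are continuous.\<close>

definition weak_operator_topology :: "scalars list \<Rightarrow> (nat \<Rightarrow> nat hmat) topology" where
  "weak_operator_topology Ls = topology_generated_by
     (insert (carrier (heavy_group Ls))
       {{l \<in> carrier (heavy_group Ls). ell2_inner w (mat_apply (l j) v) \<in> V} | j v w V.
          j < length Ls \<and> v \<in> ell2 (Ls ! j) \<and> w \<in> ell2 (Ls ! j) \<and> open V})"


section \<open>Change of scalars and trivial homomorphisms\<close>

text \<open>The obvious map from the irreducible heavy group over \<open>A\<close> to the one over \<open>B\<close> replaces each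
  entry by a square block of size \<open>block_size A B\<close>. It is the inclusion if \<open>A\<close> is contained
  in \<open>B\<close>; otherwise the block is the matrix of the left multiplication by the entry.\<close>

fun block_size :: "scalars \<Rightarrow> scalars \<Rightarrow> nat" where
  "block_size Complexes_sc Reals_sc = 2"
| "block_size Quaternions_sc Reals_sc = 4"
| "block_size Quaternions_sc Complexes_sc = 2"
| "block_size _ _ = 1"

fun block_entry :: "scalars \<Rightarrow> scalars \<Rightarrow> quat \<Rightarrow> nat \<Rightarrow> nat \<Rightarrow> quat" where
  "block_entry Complexes_sc Reals_sc q r s = of_real (qcoord (q * qunit s) r)"
| "block_entry Quaternions_sc Reals_sc q r s = of_real (qcoord (q * qunit s) r)"
| "block_entry Quaternions_sc Complexes_sc q r s =
     quat_of_complex ([[qfst q, qsnd q], [- cnj (qsnd q), cnj (qfst q)]] ! r ! s)"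
| "block_entry _ _ q r s = q"


section \<open>Classical groups\<close>

datatype classical =
    GL_R | GL_C | GL_H
  | U_inf_inf | Sp_2inf_R | Sp_2inf_C | Sp_inf_inf | O_inf_inf | O_C | SO_star
  | U_p_inf nat | O_p_inf nat | Sp_p_inf nat

fun scalars_of :: "classical \<Rightarrow> scalars" where
  "scalars_of GL_R = Reals_sc"
| "scalars_of GL_C = Complexes_sc"
| "scalars_of GL_H = Quaternions_sc"
| "scalars_of U_inf_inf = Complexes_sc"
| "scalars_of Sp_2inf_R = Reals_sc"
| "scalars_of Sp_2inf_C = Complexes_sc"
| "scalars_of Sp_inf_inf = Quaternions_sc"
| "scalars_of O_inf_inf = Reals_sc"
| "scalars_of O_C = Complexes_sc"
| "scalars_of SO_star = Quaternions_sc"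
| "scalars_of (U_p_inf p) = Complexes_sc"
| "scalars_of (O_p_inf p) = Reals_sc"
| "scalars_of (Sp_p_inf p) = Quaternions_sc"

text \<open>The irreducible factors of the maximal heavy subgroup.\<close>

fun heavy_factors :: "classical \<Rightarrow> scalars list" where
  "heavy_factors GL_R = [Reals_sc]"
| "heavy_factors GL_C = [Complexes_sc]"
| "heavy_factors GL_H = [Quaternions_sc]"
| "heavy_factors U_inf_inf = [Complexes_sc, Complexes_sc]"
| "heavy_factors Sp_2inf_R = [Complexes_sc]"
| "heavy_factors Sp_2inf_C = [Quaternions_sc]"
| "heavy_factors Sp_inf_inf = [Quaternions_sc, Quaternions_sc]"
| "heavy_factors O_inf_inf = [Reals_sc, Reals_sc]"
| "heavy_factors O_C = [Reals_sc]"
| "heavy_factors SO_star = [Complexes_sc]"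
| "heavy_factors (U_p_inf p) = [Complexes_sc]"
| "heavy_factors (O_p_inf p) = [Reals_sc]"
| "heavy_factors (Sp_p_inf p) = [Quaternions_sc]"

fun extra_dim :: "classical \<Rightarrow> nat" where
  "extra_dim (U_p_inf p) = p"
| "extra_dim (O_p_inf p) = p"
| "extra_dim (Sp_p_inf p) = p"
| "extra_dim _ = 0"

text \<open>Basis vectors of the space of an irreducible classical group \<open>X\<close>. The \<open>n\<close>-th basis vector of the
  space of the \<open>c\<close>-th factor of the maximal heavy subgroup becomes the basis vectors \<open>Main c n r\<close>,
  with \<open>r\<close> below the block size of the change of scalars. (So \<open>r\<close> takes two values for
  \<open>Sp(2\<infinity>,\<real>)\<close> and \<open>Sp(2\<infinity>,\<complex>)\<close>, and one value for the other groups.) The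
  \<open>Extra i\<close> are the \<open>p\<close> remaining ones for the groups of signature \<open>(p,\<infinity>)\<close>.\<close>

datatype basis_vec = Main nat nat nat | Extra nat

definition basis_of :: "classical \<Rightarrow> basis_vec set" where
  "basis_of X =
     {Main c n r | c n r. c < length (heavy_factors X) \<and>
                          r < block_size (heavy_factors X ! c) (scalars_of X)} \<union>
     {Extra i | i. i < extra_dim X}"

fun hermitian_sign :: "basis_vec \<Rightarrow> quat" where
  "hermitian_sign (Main c n r) = (if c = 0 then 1 else - 1)"
| "hermitian_sign (Extra i) = - 1"

definition hermitian_form :: "basis_vec hmat" where
  "hermitian_form b b' = (if b = b' then hermitian_sign b else 0)"

fun symplectic_form :: "basis_vec hmat" where
  "symplectic_form (Main c n r) (Main c' n' r') =
     (if c = c' \<and> n = n' \<and> r = 0 \<and> r' = 1 then 1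
      else if c = c' \<and> n = n' \<and> r = 1 \<and> r' = 0 then - 1 else 0)"
| "symplectic_form _ _ = 0"

definition skew_hermitian_form :: "basis_vec hmat" where
  "skew_hermitian_form b b' = (if b = b' then quat_of_complex \<i> else 0)"

definition preserves_sesquilinear :: "'i hmat \<Rightarrow> 'i hmat \<Rightarrow> bool" where
  "preserves_sesquilinear \<Phi> g \<longleftrightarrow> mat_mult (mat_adjoint g) (mat_mult \<Phi> g) = \<Phi>"

definition preserves_bilinear :: "'i hmat \<Rightarrow> 'i hmat \<Rightarrow> bool" where
  "preserves_bilinear \<Phi> g \<longleftrightarrow> mat_mult (mat_transpose g) (mat_mult \<Phi> g) = \<Phi>"

fun classical_identity :: "classical \<Rightarrow> basis_vec hmat \<Rightarrow> bool" where
  "classical_identity GL_R g = True"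
| "classical_identity GL_C g = True"
| "classical_identity GL_H g = True"
| "classical_identity U_inf_inf g = preserves_sesquilinear hermitian_form g"
| "classical_identity Sp_2inf_R g = preserves_bilinear symplectic_form g"
| "classical_identity Sp_2inf_C g = preserves_bilinear symplectic_form g"
| "classical_identity Sp_inf_inf g = preserves_sesquilinear hermitian_form g"
| "classical_identity O_inf_inf g = preserves_sesquilinear hermitian_form g"
| "classical_identity O_C g = preserves_bilinear mat_one g"
| "classical_identity SO_star g = preserves_sesquilinear skew_hermitian_form g"
| "classical_identity (U_p_inf p) g = preserves_sesquilinear hermitian_form g"
| "classical_identity (O_p_inf p) g = preserves_sesquilinear hermitian_form g"
| "classical_identity (Sp_p_inf p) g = preserves_sesquilinear hermitian_form g"

definition irreducible_classical :: "classical \<Rightarrow> basis_vec hmat set" where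
  "irreducible_classical X =
     {g \<in> invertible_mats (scalars_of X) (basis_of X). classical_identity X g}"

definition classical_group :: "classical list \<Rightarrow> (nat \<Rightarrow> basis_vec hmat) monoid" where
  "classical_group Gs =
     \<lparr> carrier = {g. (\<forall>k<length Gs. g k \<in> irreducible_classical (Gs ! k)) \<and>
                     (\<forall>k\<ge>length Gs. g k = mat_one)},
       mult = (\<lambda>g g' k. mat_mult (g k) (g' k)),
       one = (\<lambda>_. mat_one) \<rparr>"

text \<open>The embedding of the maximal heavy subgroup of \<open>X\<close>, with \<open>h c\<close> in its \<open>c\<close>-th factor.\<close>

definition heavy_embedding :: "classical \<Rightarrow> (nat \<Rightarrow> nat hmat) \<Rightarrow> basis_vec hmat" where
  "heavy_embedding X h b b' =
     (if b \<in> basis_of X \<and> b' \<in> basis_of X then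
        (case (b, b') of
           (Main c n r, Main c' n' r') \<Rightarrow>
             if c = c' then block_entry (heavy_factors X ! c) (scalars_of X) (h c n n') r r' else 0
         | _ \<Rightarrow> mat_one b b')
      else mat_one b b')"


section \<open>Straight homomorphisms and \<open>(G,L)\<close>-pairs\<close>

text \<open>A straight homomorphism into an irreducible heavy group is given by the number \<open>a\<close> of
  fixed basis vectors, the nonempty list of blocks \<open>(m, cj)\<close> (where \<open>m\<close> is the number of the
  factor of \<open>L\<close>, and \<open>cj\<close> tells whether \<open>\<tau>\<close> is the complex conjugation rather than the obvious map),
  and a labelling, which exhibits the basis of the target as the disjoint union of the fixed vectors
  and of the bases of the blocks. \<open>Copy s x r\<close> belongs to the block \<open>s\<close> and comes from the basis
  vector \<open>x\<close> of the space \<open>\<ell>\<^sub>2\<close> of a factor of \<open>L\<close>.\<close>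

datatype label = Fixed nat | Copy nat nat nat

record straight_data =
  fixed_dim :: enat
  blocks :: "(nat \<times> bool) list"
  labelling :: "nat \<Rightarrow> label"

definition label_set :: "scalars list \<Rightarrow> scalars \<Rightarrow> straight_data \<Rightarrow> label set" where
  "label_set Ls A S =
     {Fixed n | n. enat n < fixed_dim S} \<union>
     {Copy s x r | s x r. s < length (blocks S) \<and> r < block_size (Ls ! fst (blocks S ! s)) A}"

definition is_straight :: "scalars list \<Rightarrow> scalars \<Rightarrow> straight_data \<Rightarrow> bool" where
  "is_straight Ls A S \<longleftrightarrow> blocks S \<noteq> [] \<and>
     (\<forall>(m, cj) \<in> set (blocks S). m < length Ls \<and>
        (cj \<longrightarrow> Ls ! m = Complexes_sc \<and> A = Complexes_sc)) \<and>
     bij_betw (labelling S) UNIV (label_set Ls A S)"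

definition straight_hom ::
    "scalars list \<Rightarrow> scalars \<Rightarrow> straight_data \<Rightarrow> (nat \<Rightarrow> nat hmat) \<Rightarrow> nat hmat" where
  "straight_hom Ls A S l n n' =
     (case (labelling S n, labelling S n') of
        (Copy s x r, Copy s' x' r') \<Rightarrow>
          (if s = s' then
             (case blocks S ! s of (m, cj) \<Rightarrow>
                block_entry (Ls ! m) A (if cj then qcnj (l m x x') else l m x x') r r')
           else 0)
      | (Fixed i, Fixed i') \<Rightarrow> (if i = i' then 1 else 0)
      | _ \<Rightarrow> 0)"

text \<open>The composition \<open>L \<rightarrow> K \<rightarrow> G\<close>; \<open>S k c\<close> describes the component with values in the
  \<open>c\<close>-th heavy factor of the \<open>k\<close>-th factor of \<open>G\<close>.\<close>

definition straight_embedding ::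
    "classical list \<Rightarrow> scalars list \<Rightarrow> (nat \<Rightarrow> nat \<Rightarrow> straight_data) \<Rightarrow>
     (nat \<Rightarrow> nat hmat) \<Rightarrow> nat \<Rightarrow> basis_vec hmat" where
  "straight_embedding Gs Ls S l k =
     (if k < length Gs
      then heavy_embedding (Gs ! k) (\<lambda>c. straight_hom Ls (heavy_factors (Gs ! k) ! c) (S k c) l)
      else mat_one)"

definition GL_pair ::
    "classical list \<Rightarrow> scalars list \<Rightarrow> (nat \<Rightarrow> nat \<Rightarrow> straight_data) \<Rightarrow> bool" where
  "GL_pair Gs Ls S \<longleftrightarrow>
     (\<forall>k<length Gs. \<forall>c<length (heavy_factors (Gs ! k)).
        is_straight Ls (heavy_factors (Gs ! k) ! c) (S k c)) \<and>
     inj_on (straight_embedding Gs Ls S) (carrier (heavy_group Ls))"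


section \<open>The mantle\<close>

definition is_splitting ::
    "nat \<Rightarrow> (nat \<Rightarrow> nat set) \<Rightarrow> (nat \<Rightarrow> nat \<Rightarrow> nat) \<Rightarrow> (nat \<Rightarrow> nat \<Rightarrow> nat) \<Rightarrow> bool" where
  "is_splitting p \<Xi> \<tau> \<omega> \<longleftrightarrow>
     (\<forall>j<p. infinite (\<Xi> j) \<and> infinite (- \<Xi> j) \<and>
        bij_betw (\<tau> j) UNIV (\<Xi> j) \<and> bij_betw (\<omega> j) UNIV (- \<Xi> j))"

definition stabilizer :: "scalars list \<Rightarrow> (nat \<Rightarrow> nat set) \<Rightarrow> (nat \<Rightarrow> nat hmat) set" where
  "stabilizer Ls \<Xi> =
     {l \<in> carrier (heavy_group Ls). \<forall>j<length Ls. \<forall>x\<in>\<Xi> j. \<forall>y. l j y x = mat_one y x}"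

definition block_swap :: "(nat \<Rightarrow> nat) \<Rightarrow> nat \<Rightarrow> nat \<Rightarrow> nat" where
  "block_swap w m x =
     (if x \<in> w ` {..<m} then w (inv_into UNIV w x + m)
      else if x \<in> w ` {m..<2 * m} then w (inv_into UNIV w x - m) else x)"

definition theta :: "scalars list \<Rightarrow> (nat \<Rightarrow> nat \<Rightarrow> nat) \<Rightarrow> (nat \<Rightarrow> nat) \<Rightarrow> nat \<Rightarrow> nat hmat" where
  "theta Ls \<omega> m j =
     (if j < length Ls then \<lambda>x y. if x = block_swap (\<omega> j) (m j) y then 1 else 0 else mat_one)"

definition double_coset :: "('a, 'b) monoid_scheme \<Rightarrow> 'a set \<Rightarrow> 'a \<Rightarrow> 'a set" where
  "double_coset G A g = {a \<otimes>\<^bsub>G\<^esub> g \<otimes>\<^bsub>G\<^esub> b | a b. a \<in> A \<and> b \<in> A}"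

definition stabilizer_coset ::
    "classical list \<Rightarrow> scalars list \<Rightarrow> (nat \<Rightarrow> nat \<Rightarrow> straight_data) \<Rightarrow> (nat \<Rightarrow> nat set) \<Rightarrow>
     (nat \<Rightarrow> basis_vec hmat) \<Rightarrow> (nat \<Rightarrow> basis_vec hmat) set" where
  "stabilizer_coset Gs Ls S \<Xi> =
     double_coset (classical_group Gs) (straight_embedding Gs Ls S ` stabilizer Ls \<Xi>)"

definition mantle ::
    "classical list \<Rightarrow> scalars list \<Rightarrow> (nat \<Rightarrow> nat \<Rightarrow> straight_data) \<Rightarrow> (nat \<Rightarrow> nat set) \<Rightarrow>
     (nat \<Rightarrow> nat \<Rightarrow> nat) \<Rightarrow> (nat \<Rightarrow> basis_vec hmat) set monoid" where
  "mantle Gs Ls S \<Xi> \<omega> =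
     \<lparr> carrier = stabilizer_coset Gs Ls S \<Xi> ` carrier (classical_group Gs),
       mult = (\<lambda>\<gg> \<hh>. THE \<cc>. \<forall>g\<in>\<gg>. \<forall>h\<in>\<hh>. \<exists>M. \<forall>m. (\<forall>j<length Ls. M \<le> m j) \<longrightarrow>
          stabilizer_coset Gs Ls S \<Xi>
            (g \<otimes>\<^bsub>classical_group Gs\<^esub> straight_embedding Gs Ls S (theta Ls \<omega> m)
               \<otimes>\<^bsub>classical_group Gs\<^esub> h) = \<cc>),
       one = stabilizer_coset Gs Ls S \<Xi> (\<one>\<^bsub>classical_group Gs\<^esub>) \<rparr>"

text \<open>The action of the \<open>\<tau>\<^sub>j\<close> on the basis vectors of the \<open>k\<close>-th factor of \<open>G\<close>; those fixed by \<open>L\<close>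
  do not move.\<close>

definition relabel ::
    "(nat \<Rightarrow> nat \<Rightarrow> straight_data) \<Rightarrow> (nat \<Rightarrow> nat \<Rightarrow> nat) \<Rightarrow> nat \<Rightarrow> basis_vec \<Rightarrow> basis_vec" where
  "relabel S \<tau> k b =
     (case b of
        Main c n r \<Rightarrow>
          (case labelling (S k c) n of
             Copy s x d \<Rightarrow>
               Main c (inv_into UNIV (labelling (S k c)) (Copy s (\<tau> (fst (blocks (S k c) ! s)) x) d)) r
           | Fixed i \<Rightarrow> b)
      | Extra i \<Rightarrow> b)"

definition i_tau ::
    "classical list \<Rightarrow> (nat \<Rightarrow> nat \<Rightarrow> straight_data) \<Rightarrow> (nat \<Rightarrow> nat \<Rightarrow> nat) \<Rightarrow>
     (nat \<Rightarrow> basis_vec hmat) \<Rightarrow> nat \<Rightarrow> basis_vec hmat" where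
  "i_tau Gs S \<tau> g k b b' =
     (if k < length Gs \<and>
         b \<in> relabel S \<tau> k ` basis_of (Gs ! k) \<and> b' \<in> relabel S \<tau> k ` basis_of (Gs ! k)
      then g k (inv_into (basis_of (Gs ! k)) (relabel S \<tau> k) b)
               (inv_into (basis_of (Gs ! k)) (relabel S \<tau> k) b')
      else mat_one b b')"

definition mantle_embedding ::
    "classical list \<Rightarrow> scalars list \<Rightarrow> (nat \<Rightarrow> nat \<Rightarrow> straight_data) \<Rightarrow> (nat \<Rightarrow> nat set) \<Rightarrow>
     (nat \<Rightarrow> nat \<Rightarrow> nat) \<Rightarrow> (nat \<Rightarrow> basis_vec hmat) \<Rightarrow> (nat \<Rightarrow> basis_vec hmat) set" where
  "mantle_embedding Gs Ls S \<Xi> \<tau> g = stabilizer_coset Gs Ls S \<Xi> (i_tau Gs S \<tau> g)"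


section \<open>Representations\<close>

text \<open>Complex Hilbert spaces. The norm and the topology are those of the underlying real Hilbert
  space, whose inner product is the real part of the complex one.\<close>

class chilbert_space = real_inner + complete_space +
  fixes scaleC :: "complex \<Rightarrow> 'a \<Rightarrow> 'a"
    and cinner :: "'a \<Rightarrow> 'a \<Rightarrow> complex"
  assumes scaleC_add_right: "scaleC a (x + y) = scaleC a x + scaleC a y"
    and scaleC_add_left: "scaleC (a + b) x = scaleC a x + scaleC b x"
    and scaleC_scaleC: "scaleC a (scaleC b x) = scaleC (a * b) x"
    and scaleC_of_real: "scaleC (complex_of_real r) x = r *\<^sub>R x"
    and cinner_commute: "cinner x y = cnj (cinner y x)"
    and cinner_add_left: "cinner (x + y) z = cinner x z + cinner y z"
    and cinner_scaleC_left: "cinner (scaleC a x) y = a * cinner x y"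
    and inner_eq_Re_cinner: "inner x y = Re (cinner x y)"

instantiation complex :: chilbert_space
begin
definition "scaleC (a::complex) (x::complex) = a * x"
definition "cinner (x::complex) (y::complex) = x * cnj y"
instance
  by standard
    (simp_all add: scaleC_complex_def cinner_complex_def algebra_simps inner_complex_def
       scaleR_conv_of_real)
end

definition complex_linear :: "('h::chilbert_space \<Rightarrow> 'h) \<Rightarrow> bool" where
  "complex_linear T \<longleftrightarrow>
     (\<forall>x y. T (x + y) = T x + T y) \<and> (\<forall>a x. T (scaleC a x) = scaleC a (T x))"

definition isometry_onto :: "'h::chilbert_space set \<Rightarrow> ('h \<Rightarrow> 'h) \<Rightarrow> bool" where
  "isometry_onto W T \<longleftrightarrow>
     complex_linear T \<and> range T = W \<and> (\<forall>x y. cinner (T x) (T y) = cinner x y)"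

definition unitary_operators :: "('h::chilbert_space \<Rightarrow> 'h) monoid" where
  "unitary_operators = \<lparr> carrier = {T. isometry_onto UNIV T}, mult = (\<circ>), one = id \<rparr>"

definition bounded_operators :: "('h::chilbert_space \<Rightarrow> 'h) monoid" where
  "bounded_operators =
     \<lparr> carrier = {T. complex_linear T \<and> bounded_linear T}, mult = (\<circ>), one = id \<rparr>"

definition pair_representation ::
    "classical list \<Rightarrow> scalars list \<Rightarrow> (nat \<Rightarrow> nat \<Rightarrow> straight_data) \<Rightarrow>
     ((nat \<Rightarrow> basis_vec hmat) \<Rightarrow> 'h::chilbert_space \<Rightarrow> 'h) \<Rightarrow> bool" where
  "pair_representation Gs Ls S \<rho> \<longleftrightarrow>
     \<rho> \<in> hom (classical_group Gs) unitary_operators \<and>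
     (\<forall>v. continuous_map (weak_operator_topology Ls) euclidean
            (\<lambda>l. \<rho> (straight_embedding Gs Ls S l) v))"

definition fixed_space ::
    "classical list \<Rightarrow> scalars list \<Rightarrow> (nat \<Rightarrow> nat \<Rightarrow> straight_data) \<Rightarrow> (nat \<Rightarrow> nat set) \<Rightarrow>
     ((nat \<Rightarrow> basis_vec hmat) \<Rightarrow> 'h::chilbert_space \<Rightarrow> 'h) \<Rightarrow> 'h set" where
  "fixed_space Gs Ls S \<Xi> \<rho> =
     {v. \<forall>l\<in>stabilizer Ls \<Xi>. \<rho> (straight_embedding Gs Ls S l) v = v}"

definition orthogonal_projection :: "'h::chilbert_space set \<Rightarrow> 'h \<Rightarrow> 'h" where
  "orthogonal_projection W v = (THE w. w \<in> W \<and> (\<forall>u\<in>W. cinner u (v - w) = 0))"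

text \<open>The operator \<open>P \<rho>(g)\<close>, as a function of the double coset of \<open>g\<close>; it is only of interest on the
  space of fixed vectors.\<close>

definition rho_bar ::
    "classical list \<Rightarrow> scalars list \<Rightarrow> (nat \<Rightarrow> nat \<Rightarrow> straight_data) \<Rightarrow> (nat \<Rightarrow> nat set) \<Rightarrow>
     ((nat \<Rightarrow> basis_vec hmat) \<Rightarrow> 'h::chilbert_space \<Rightarrow> 'h) \<Rightarrow>
     (nat \<Rightarrow> basis_vec hmat) set \<Rightarrow> 'h \<Rightarrow> 'h" where
  "rho_bar Gs Ls S \<Xi> \<rho> \<gg> v =
     (THE w. \<forall>g\<in>\<gg>. w = orthogonal_projection (fixed_space Gs Ls S \<Xi> \<rho>) (\<rho> g v))"

text \<open>Unitary equivalence of a representation \<open>R\<close> in the whole space with a representation \<open>R'\<close> in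
  the closed subspace \<open>W\<close>.\<close>

definition unitarily_equivalent ::
    "('s, 't) monoid_scheme \<Rightarrow> ('s \<Rightarrow> 'h::chilbert_space \<Rightarrow> 'h) \<Rightarrow> 'h set \<Rightarrow> ('s \<Rightarrow> 'h \<Rightarrow> 'h) \<Rightarrow> bool"
  where
  "unitarily_equivalent \<Gamma> R W R' \<longleftrightarrow>
     (\<exists>U. isometry_onto W U \<and> (\<forall>\<gamma>\<in>carrier \<Gamma>. \<forall>v. U (R \<gamma> v) = R' \<gamma> (U v)))"

end

theory Submission
  imports Defs
begin

text \<open>
  The idea is to approximate the relabelling \<open>\<tau>\<close> by finite permutations. Let \<open>s n \<in> L\<close> be a finite
  permutation that agrees with \<open>\<tau>\<close> on the first \<open>n\<close> basis vectors of each \<open>\<ell>\<^sub>2\<close>. An element \<open>g\<close> of \<open>G\<close>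
  involves finitely many basis vectors only, hence \<open>i\<^sub>\<tau> g = (s n) g (s n)\<^sup>-\<^sup>1\<close> for all large \<open>n\<close>
  (\<open>i_tau_conj\<close>). So \<open>i\<^sub>\<tau>\<close> takes values in \<open>G\<close> and is an injective homomorphism.

  In the representation, continuity on \<open>L\<close> says that an element of \<open>L\<close> that fixes the first \<open>N\<close>
  basis vectors moves a given vector \<open>v\<close> very little if \<open>N\<close> is large (\<open>near_identity\<close>). Since
  \<open>(s n)\<^sup>-\<^sup>1 (s m)\<close> is such an element, the vectors \<open>\<rho> (s n) v\<close> converge. Their limit \<open>U v\<close> defines an
  isometry \<open>U\<close>, and passing to the limit in \<open>(s n) g = (i\<^sub>\<tau> g) (s n)\<close> gives \<open>U \<rho>(g) = \<rho>(i\<^sub>\<tau> g) U\<close>.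
  The range of \<open>U\<close> is the space of vectors fixed by \<open>L\<^sup>\<Xi>\<close>: the values of \<open>U\<close> are fixed because, for large \<open>n\<close>,
  \<open>(s n)\<^sup>-\<^sup>1\<close> conjugates \<open>L\<^sup>\<Xi>\<close> into a given neighbourhood of the identity (\<open>U_fixed\<close>), and a fixed vector \<open>v\<close> is
  the image of \<open>lim \<rho> (s n)\<^sup>-\<^sup>1 v\<close>. That this limit exists is the less obvious point: it
  requires that \<open>v\<close> is hardly moved by elements that fix many vectors in \<open>\<Xi>\<close> but act on \<open>\<Omega>\<close> without
  restriction (\<open>fixed_vector_near_identity\<close>). Such an element is conjugated into a given neighbourhood
  of the identity by some \<open>\<Theta>\<close>, and \<open>\<Theta>\<close> fixes \<open>v\<close>. The required representation is
  \<open>R \<gamma> = U\<^sup>-\<^sup>1 \<rho>'(\<gamma>) U\<close>, where \<open>\<rho>'\<close> is the representation of \<open>\<Gamma>\<close> in the fixed vectors; it extends \<open>\<rho>\<close>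
  because \<open>i\<^sub>\<tau> g\<close> commutes with \<open>L\<^sup>\<Xi>\<close>.

  It remains to see that the product of \<open>\<Gamma>\<close> is well defined and that \<open>\<rho>'\<close> is multiplicative. The first
  is combinatorial (\<open>mantle_mult\<close>). Passing an element \<open>b\<close> of \<open>L\<^sup>\<Xi>\<close> across \<open>\<Theta>\<^sub>m\<close> with large \<open>m\<close> yields
  an element that fixes many vectors in \<open>\<Omega>\<close> and thus commutes with any given \<open>h \<in> G\<close>; and
  for large \<open>m\<close> and \<open>m'\<close> the elements \<open>\<Theta>\<^sub>m\<close> and \<open>\<Theta>\<^sub>m\<^sub>'\<close> differ by factors that commute with \<open>g\<close> and \<open>h\<close>.
  The second holds because \<open>\<rho>(\<Theta>\<^sub>m)\<close> tends weakly to the projection onto the fixed vectors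
  (\<open>theta_weakly_projection\<close>): on a fixed vector it is the identity, and the orthogonal complement is
  spanned by the vectors \<open>\<rho>(l) u - u\<close> with \<open>l \<in> L\<^sup>\<Xi>\<close>, on which \<open>\<rho>(\<Theta>\<^sub>m)\<close> tends to zero.

  All of this presupposes that \<open>L\<close> is embedded in \<open>G\<close>. Straight homomorphisms and the embeddings of
  the maximal heavy subgroups are treated as instances of one construction of block matrices, which
  is compatible with products and adjoints (\<open>block_construction\<close>). Invariance of the forms then
  amounts to a relation with the adjoint of the matrix (\<open>heavy_embedding_classical\<close>).
\<close>


section \<open>Quaternions\<close>

lemma qcnj_0 [simp]: "qcnj 0 = 0" and qcnj_1 [simp]: "qcnj 1 = 1" and qcnj_qcnj [simp]: "qcnj (qcnj a) = a"
  by (simp_all add: qcnj_def zero_quat_def one_quat_def)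

lemma qcnj_add: "qcnj (a + b) = qcnj a + qcnj b"
  by (simp add: qcnj_def plus_quat_def)

lemma qcnj_mult: "qcnj (a * b) = qcnj b * qcnj a"
  by (simp add: qcnj_def times_quat_def algebra_simps)

lemma qcnj_eq_0_iff [simp]: "qcnj a = 0 \<longleftrightarrow> a = 0"
  by (metis qcnj_0 qcnj_qcnj)

lemma inner_mult_left_quat: "inner (a * b) (c::quat) = inner b (qcnj a * c)"
  by (simp add: inner_quat_def times_quat_def qcnj_def inner_complex_def algebra_simps)

lemma norm_qcnj [simp]: "norm (qcnj a) = norm a"
  by (simp add: norm_quat_def inner_quat_def qcnj_def inner_complex_def)

lemma qcnj_mult_self: "qcnj a * a = of_real ((norm a)\<^sup>2)"
proof -
  have "(norm a)\<^sup>2 = (Re (qfst a))\<^sup>2 + (Im (qfst a))\<^sup>2 + ((Re (qsnd a))\<^sup>2 + (Im (qsnd a))\<^sup>2)"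
    by (simp only: power2_norm_eq_inner) (simp add: inner_quat_def inner_complex_def power2_eq_square)
  then show ?thesis
    by (simp add: times_quat_def qcnj_def of_real_def scaleR_quat_def one_quat_def complex_eq_iff
        power2_eq_square)
qed

lemma norm_mult_quat: "norm (a * b) = norm a * norm (b::quat)"
proof -
  have "(norm (a * b))\<^sup>2 = inner b ((qcnj a * a) * b)"
    by (simp add: power2_norm_eq_inner inner_mult_left_quat mult.assoc)
  also have "\<dots> = inner b ((norm a)\<^sup>2 *\<^sub>R b)"
    by (simp only: qcnj_mult_self) (simp add: of_real_def)
  also have "\<dots> = (norm a * norm b)\<^sup>2"
    by (simp add: power2_norm_eq_inner power_mult_distrib)
  finally show ?thesis
    by (rule power2_eq_imp_eq) simp_all
qed

lemma of_real_quat: "of_real r = Quat (of_real r) 0"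
  by (simp add: of_real_def scaleR_quat_def one_quat_def)

lemma real_scalarE:
  assumes "q \<in> (\<real>::quat set)"
  obtains r where "q = Quat (complex_of_real r) 0"
  using assms by (auto simp: Reals_def of_real_quat)

lemma quat_of_complex_hom:
  "quat_of_complex 0 = 0" "quat_of_complex 1 = 1"
  "quat_of_complex z + quat_of_complex w = quat_of_complex (z + w)"
  "quat_of_complex z * quat_of_complex w = quat_of_complex (z * w)"
  "qcnj (quat_of_complex z) = quat_of_complex (cnj z)"
  by (simp_all add: quat_of_complex_def zero_quat_def one_quat_def plus_quat_def times_quat_def
      qcnj_def)

lemma qcnj_real_scalar: "a \<in> scalar_set Reals_sc \<Longrightarrow> qcnj a = a"
  by (auto simp: qcnj_def elim!: real_scalarE)

lemma scalar_set_0 [simp]: "0 \<in> scalar_set F"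
  by (cases F) (use rangeI[of quat_of_complex 0] in \<open>auto simp: quat_of_complex_hom\<close>)

lemma scalar_set_1 [simp]: "1 \<in> scalar_set F"
  by (cases F) (use rangeI[of quat_of_complex 1] in \<open>auto simp: quat_of_complex_hom\<close>)

lemma scalar_set_add: "a \<in> scalar_set F \<Longrightarrow> b \<in> scalar_set F \<Longrightarrow> a + b \<in> scalar_set F"
  by (cases F) (auto simp: quat_of_complex_hom)

lemma scalar_set_mult: "a \<in> scalar_set F \<Longrightarrow> b \<in> scalar_set F \<Longrightarrow> a * b \<in> scalar_set F"
  by (cases F) (auto simp: quat_of_complex_hom)

lemma scalar_set_qcnj: "a \<in> scalar_set F \<Longrightarrow> qcnj a \<in> scalar_set F"
  using qcnj_real_scalar[of a] by (cases F) (auto simp: quat_of_complex_hom)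

lemma complex_scalars_commute:
  "a \<in> scalar_set Complexes_sc \<Longrightarrow> b \<in> scalar_set Complexes_sc \<Longrightarrow> a * b = b * a"
  by (auto simp: quat_of_complex_hom mult.commute)

lemma real_scalars_complex: "a \<in> scalar_set Reals_sc \<Longrightarrow> a \<in> scalar_set Complexes_sc"
  using rangeI[of quat_of_complex] by (auto simp: quat_of_complex_def elim!: real_scalarE)

lemma scalar_set_sum: "(\<And>x. x \<in> A \<Longrightarrow> f x \<in> scalar_set F) \<Longrightarrow> sum f A \<in> scalar_set F"
  by (induction A rule: infinite_finite_induct) (auto intro: scalar_set_add)


section \<open>Matrices that differ from the identity in finitely many places\<close>

definition row_finite :: "'i hmat \<Rightarrow> bool" where
  "row_finite g \<longleftrightarrow> (\<forall>i. finite {j. g i j \<noteq> 0})"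

definition supported_on :: "'i set \<Rightarrow> 'i hmat \<Rightarrow> bool" where
  "supported_on B g \<longleftrightarrow> (\<forall>i j. i \<notin> B \<or> j \<notin> B \<longrightarrow> g i j = mat_one i j)"

definition fin_supported :: "'i hmat \<Rightarrow> bool" where
  "fin_supported g \<longleftrightarrow> (\<exists>T. finite T \<and> supported_on T g)"

lemma mat_mult_superset:
  assumes "finite T" "{j. g i j \<noteq> 0} \<subseteq> T"
  shows "mat_mult g h i k = (\<Sum>j\<in>T. g i j * h j k)"
  unfolding mat_mult_def using assms by (intro sum.mono_neutral_left) auto

lemma mat_mult_single:
  assumes "\<And>j. j \<noteq> z \<Longrightarrow> g i j = 0"
  shows "mat_mult g h i k = g i z * h z k"
  using mat_mult_superset[of "{z}" g i h k] assms by auto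

lemma mat_mult_single_right:
  assumes "finite {j. g i j \<noteq> 0}" "\<And>j. j \<noteq> z \<Longrightarrow> h j k = 0"
  shows "mat_mult g h i k = g i z * h z k"
proof -
  have "mat_mult g h i k = (\<Sum>j\<in>insert z {j. g i j \<noteq> 0}. g i j * h j k)"
    using assms by (intro mat_mult_superset) auto
  also have "\<dots> = (\<Sum>j\<in>{z}. g i j * h j k)"
    using assms by (intro sum.mono_neutral_right) auto
  finally show ?thesis by simp
qed

lemma mat_one_same [simp]: "mat_one i i = 1" and mat_one_neq: "i \<noteq> j \<Longrightarrow> mat_one i j = 0"
  by (auto simp: mat_one_def)

lemma mat_mult_trivial_row:
  assumes "\<And>j. g i j = mat_one i j"
  shows "mat_mult g h i k = h i k"
  using mat_mult_single[of i g i h k] assms by (auto simp: mat_one_neq)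

lemma mat_mult_trivial_column:
  assumes "finite {j. g i j \<noteq> 0}" "\<And>j. h j k = mat_one j k"
  shows "mat_mult g h i k = g i k"
  using mat_mult_single_right[where g = g and i = i and h = h and k = k and z = k] assms by (auto simp: mat_one_neq)

lemma mat_mult_one_left [simp]: "mat_mult mat_one g = g"
  by (intro ext mat_mult_trivial_row) simp

lemma mat_mult_one_right: "row_finite g \<Longrightarrow> mat_mult g mat_one = g"
  by (intro ext mat_mult_trivial_column) (auto simp: row_finite_def)

lemma row_finite_mat_one [simp]: "row_finite mat_one"
  by (simp add: row_finite_def mat_one_def)

lemma row_finite_mult:
  assumes "row_finite g" "row_finite h"
  shows "row_finite (mat_mult g h)"
  unfolding row_finite_def
proof
  fix i
  have "{k. mat_mult g h i k \<noteq> 0} \<subseteq> (\<Union>j\<in>{j. g i j \<noteq> 0}. {k. h j k \<noteq> 0})"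
    unfolding mat_mult_def by (auto intro!: sum.neutral)
  then show "finite {k. mat_mult g h i k \<noteq> 0}"
    by (rule finite_subset) (use assms in \<open>auto simp: row_finite_def\<close>)
qed

lemma mat_mult_assoc:
  assumes "row_finite g" "row_finite h"
  shows "mat_mult (mat_mult g h) k = mat_mult g (mat_mult h k)"
proof (intro ext)
  fix i l
  define T where "T = {j. g i j \<noteq> 0}"
  define M where "M = (\<Union>j\<in>T. {m. h j m \<noteq> 0})"
  have fin: "finite T" "finite M"
    using assms by (auto simp: T_def M_def row_finite_def)
  have "{m. mat_mult g h i m \<noteq> 0} \<subseteq> M"
    unfolding mat_mult_def M_def T_def by (auto intro!: sum.neutral)
  then have "mat_mult (mat_mult g h) k i l = (\<Sum>m\<in>M. mat_mult g h i m * k m l)"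
    by (intro mat_mult_superset fin)
  also have "\<dots> = (\<Sum>m\<in>M. \<Sum>j\<in>T. g i j * (h j m * k m l))"
    by (simp add: mat_mult_def T_def sum_distrib_right mult.assoc)
  also have "\<dots> = (\<Sum>j\<in>T. \<Sum>m\<in>M. g i j * (h j m * k m l))"
    by (rule sum.swap)
  also have "\<dots> = (\<Sum>j\<in>T. g i j * mat_mult h k j l)"
  proof (intro sum.cong refl)
    fix j assume "j \<in> T"
    then have "mat_mult h k j l = (\<Sum>m\<in>M. h j m * k m l)"
      by (intro mat_mult_superset fin) (auto simp: M_def)
    then show "(\<Sum>m\<in>M. g i j * (h j m * k m l)) = g i j * mat_mult h k j l"
      by (simp add: sum_distrib_left)
  qed
  also have "\<dots> = mat_mult g (mat_mult h k) i l"
    by (simp add: mat_mult_def T_def)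
  finally show "mat_mult (mat_mult g h) k i l = mat_mult g (mat_mult h k) i l" .
qed

lemma supported_on_mono: "supported_on B g \<Longrightarrow> B \<subseteq> C \<Longrightarrow> supported_on C g"
  by (auto simp: supported_on_def)

lemma supported_on_mat_one [simp]: "supported_on B mat_one"
  by (simp add: supported_on_def)

lemma fin_supported_mat_one [simp]: "fin_supported mat_one"
  by (auto simp: fin_supported_def)

text \<open>Products are only meaningful for matrices with finite rows, and only such products are
  associative. The forms on the space of \<open>G\<close> have finite rows, but they are not finite
  perturbations of the identity; hence the two conditions are kept apart.\<close>

lemma fin_supported_row_finite: 
  assumes "fin_supported g"
  shows "row_finite g"
  unfolding row_finite_def
proof
  fix i
  from assms obtain T where T: "finite T" "supported_on T g"
    by (auto simp: fin_supported_def)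
  have "g i j = 0" if "j \<notin> insert i T" for j
    using that T(2) by (auto simp: supported_on_def mat_one_def)
  then have "{j. g i j \<noteq> 0} \<subseteq> insert i T"
    by blast
  then show "finite {j. g i j \<noteq> 0}"
    by (rule finite_subset) (use T in simp)
qed

lemma supported_on_mult:
  assumes "row_finite g" "supported_on B g" "supported_on B h"
  shows "supported_on B (mat_mult g h)"
  unfolding supported_on_def
proof (intro allI impI)
  fix i k assume "i \<notin> B \<or> k \<notin> B"
  then show "mat_mult g h i k = mat_one i k"
  proof
    assume i: "i \<notin> B"
    then have "mat_mult g h i k = h i k"
      using assms by (intro mat_mult_trivial_row) (auto simp: supported_on_def)
    then show ?thesis using assms i by (auto simp: supported_on_def)
  next
    assume k: "k \<notin> B"
    then have "mat_mult g h i k = g i k"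
      using assms by (intro mat_mult_trivial_column) (auto simp: supported_on_def row_finite_def)
    then show ?thesis using assms k by (auto simp: supported_on_def)
  qed
qed

lemma fin_supported_mult:
  assumes "fin_supported g" "fin_supported h"
  shows "fin_supported (mat_mult g h)"
proof -
  from assms obtain T U where "finite T" "supported_on T g" "finite U" "supported_on U h"
    by (auto simp: fin_supported_def)
  then have "supported_on (T \<union> U) (mat_mult g h)"
    using assms by (intro supported_on_mult fin_supported_row_finite)
      (auto intro: supported_on_mono)
  then show ?thesis using \<open>finite T\<close> \<open>finite U\<close> by (auto simp: fin_supported_def)
qed

lemma finite_mat_iff:
  "finite_mat F B g \<longleftrightarrow> fin_supported g \<and> supported_on B g \<and> (\<forall>i j. g i j \<in> scalar_set F)"
proof -
  have "finite {(i, j). g i j \<noteq> mat_one i j} \<longleftrightarrow> fin_supported g"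
  proof
    let ?D = "{(i, j). g i j \<noteq> mat_one i j}"
    assume "finite ?D"
    then have "finite (fst ` ?D \<union> snd ` ?D)" by simp
    moreover have "supported_on (fst ` ?D \<union> snd ` ?D) g"
      by (force simp: supported_on_def image_iff)
    ultimately show "fin_supported g" by (auto simp: fin_supported_def)
  next
    assume "fin_supported g"
    then obtain T where "finite T" "supported_on T g" by (auto simp: fin_supported_def)
    moreover from this have "{(i, j). g i j \<noteq> mat_one i j} \<subseteq> T \<times> T"
      unfolding supported_on_def by blast
    ultimately show "finite {(i, j). g i j \<noteq> mat_one i j}"
      by (blast intro: finite_subset)
  qed
  moreover have "g i j \<in> scalar_set F"
    if "supported_on B g" "\<forall>i\<in>B. \<forall>j\<in>B. g i j \<in> scalar_set F" for i j
  proof (cases "i \<in> B \<and> j \<in> B")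
    case False
    then have "g i j = mat_one i j" using that(1) by (simp add: supported_on_def)
    then show ?thesis by (simp add: mat_one_def)
  qed (use that in blast)
  ultimately show ?thesis
    unfolding finite_mat_def supported_on_def[symmetric] by blast
qed

lemma finite_mat_mat_one [simp]: "finite_mat F B mat_one"
  by (auto simp: finite_mat_iff) (auto simp: mat_one_def)

lemma finite_mat_row_finite: "finite_mat F B g \<Longrightarrow> row_finite g"
  by (simp add: finite_mat_iff fin_supported_row_finite)

lemma finite_mat_mult:
  assumes "finite_mat F B g" "finite_mat F B h"
  shows "finite_mat F B (mat_mult g h)"
  using assms unfolding finite_mat_iff
  by (auto intro!: fin_supported_mult supported_on_mult fin_supported_row_finite scalar_set_sum
      scalar_set_mult simp: mat_mult_def)

lemma invertible_mats_mult:
  assumes "g \<in> invertible_mats F B" "h \<in> invertible_mats F B"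
  shows "mat_mult g h \<in> invertible_mats F B"
proof -
  from assms obtain g' h' where *: "finite_mat F B g" "finite_mat F B h" "finite_mat F B g'"
    "finite_mat F B h'" "mat_mult g g' = mat_one" "mat_mult g' g = mat_one"
    "mat_mult h h' = mat_one" "mat_mult h' h = mat_one"
    by (auto simp: invertible_mats_def)
  note rf = *(1-4)[THEN finite_mat_row_finite]
  have "mat_mult (mat_mult g h) (mat_mult h' g') = mat_mult g (mat_mult (mat_mult h h') g')"
    by (simp add: mat_mult_assoc rf row_finite_mult)
  moreover have "mat_mult (mat_mult h' g') (mat_mult g h) = mat_mult h' (mat_mult (mat_mult g' g) h)"
    by (simp add: mat_mult_assoc rf row_finite_mult)
  ultimately show ?thesis
    using * by (auto simp: invertible_mats_def intro!: finite_mat_mult exI[of _ "mat_mult h' g'"])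
qed

lemma mat_one_invertible [simp]: "mat_one \<in> invertible_mats F B"
  by (auto simp: invertible_mats_def intro!: exI[of _ mat_one])

text \<open>This is the source of all commutation relations between elements of \<open>G\<close> and of \<open>L\<^sup>\<Xi>\<close>.\<close>

lemma mat_mult_commute_disjoint:
  assumes "row_finite g" "row_finite h"
    and "\<And>b. (\<forall>b'. g b b' = mat_one b b' \<and> g b' b = mat_one b' b) \<or>
              (\<forall>b'. h b b' = mat_one b b' \<and> h b' b = mat_one b' b)"
  shows "mat_mult g h = mat_mult h g"
proof (intro ext)
  fix i k
  have triv: "mat_mult g h i k = h i k" "mat_mult h g i k = h i k"
    if "row_finite g" "row_finite h" "\<forall>b'. g i b' = mat_one i b' \<and> g b' i = mat_one b' i"
      "\<forall>b'. g k b' = mat_one k b' \<and> g b' k = mat_one b' k" for g h :: "'a hmat"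
    using that by (auto simp: row_finite_def intro!: mat_mult_trivial_row mat_mult_trivial_column)
  have mix: "mat_mult g h i k = mat_one i k" "mat_mult h g i k = mat_one i k"
    if "row_finite g" "row_finite h" "\<forall>b'. g i b' = mat_one i b' \<and> g b' i = mat_one b' i"
      "\<forall>b'. h k b' = mat_one k b' \<and> h b' k = mat_one b' k"
      and disj: "\<forall>b. (\<forall>b'. g b b' = mat_one b b' \<and> g b' b = mat_one b' b) \<or>
              (\<forall>b'. h b b' = mat_one b b' \<and> h b' b = mat_one b' b)" for g h :: "'a hmat"
  proof -
    have "mat_mult g h i k = h i k"
      using that by (intro mat_mult_trivial_row) auto
    then show "mat_mult g h i k = mat_one i k" using that by simp
    have "mat_mult h g i k = (\<Sum>j\<in>insert k {j. h i j \<noteq> 0}. h i j * g j k)"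
      using that by (intro mat_mult_superset) (auto simp: row_finite_def)
    also have "\<dots> = (\<Sum>j\<in>insert k {j. h i j \<noteq> 0}. if j = k then mat_one i k else 0)"
    proof (intro sum.cong refl)
      fix j
      show "h i j * g j k = (if j = k then mat_one i k else 0)"
      proof (cases "j = k")
        case True
        have "h i k = mat_one i k" "g i k = mat_one i k" "g k k = 1" if "i = k"
          using that \<open>\<forall>b'. g i b' = _ \<and> _\<close> \<open>\<forall>b'. h k b' = _ \<and> _\<close> by simp_all
        moreover have "h i k = mat_one i k"
          using \<open>\<forall>b'. h k b' = _ \<and> _\<close> by simp
        ultimately show ?thesis
          using True by (cases "i = k") (auto simp: mat_one_neq)
      next
        case False
        have "g i k = 0" if "j = i"
          using that False \<open>\<forall>b'. g i b' = _ \<and> _\<close> by (auto simp: mat_one_def)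
        moreover have "g j k = 0 \<or> h i j = 0" if "j \<noteq> i"
          using disj[rule_format, of j] that False by (auto simp: mat_one_neq)
        ultimately show ?thesis
          using False by (cases "j = i") auto
      qed
    qed
    also have "\<dots> = mat_one i k"
      using that(2) by (simp add: row_finite_def)
    finally show "mat_mult h g i k = mat_one i k" .
  qed
  consider "\<forall>b'. g i b' = mat_one i b' \<and> g b' i = mat_one b' i"
      "\<forall>b'. g k b' = mat_one k b' \<and> g b' k = mat_one b' k"
    | "\<forall>b'. h i b' = mat_one i b' \<and> h b' i = mat_one b' i"
      "\<forall>b'. h k b' = mat_one k b' \<and> h b' k = mat_one b' k"
    | "\<forall>b'. g i b' = mat_one i b' \<and> g b' i = mat_one b' i"
      "\<forall>b'. h k b' = mat_one k b' \<and> h b' k = mat_one b' k"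
    | "\<forall>b'. h i b' = mat_one i b' \<and> h b' i = mat_one b' i"
      "\<forall>b'. g k b' = mat_one k b' \<and> g b' k = mat_one b' k"
    using assms(3)[of i] assms(3)[of k] by blast
  then show "mat_mult g h i k = mat_mult h g i k"
  proof cases
    case 1
    then show ?thesis using triv[OF assms(1,2)] by simp
  next
    case 2
    then show ?thesis using triv[OF assms(2,1)] by simp
  next
    case 3
    then show ?thesis using mix[OF assms(1,2)] assms(3) by simp
  next
    case 4
    then show ?thesis using mix[OF assms(2,1)] assms(3) by (simp add: disj_commute)
  qed
qed


section \<open>Adjoints, transposes and invariant forms\<close>

lemma supported_on_adjoint: "supported_on B g \<Longrightarrow> supported_on B (mat_adjoint g)"
  by (auto simp: supported_on_def mat_adjoint_def mat_one_def)

lemma fin_supported_adjoint: "fin_supported g \<Longrightarrow> fin_supported (mat_adjoint g)"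
  using supported_on_adjoint by (auto simp: fin_supported_def)

lemma finite_mat_adjoint: "finite_mat F B g \<Longrightarrow> finite_mat F B (mat_adjoint g)"
  by (auto simp: finite_mat_iff supported_on_adjoint fin_supported_adjoint)
    (auto simp: mat_adjoint_def scalar_set_qcnj)

lemma mat_adjoint_mat_adjoint [simp]: "mat_adjoint (mat_adjoint g) = g"
  by (simp add: mat_adjoint_def[abs_def])

lemma fin_supported_finite_column:
  assumes "fin_supported g"
  shows "finite {j. g j i \<noteq> 0}"
proof -
  have "finite {j. mat_adjoint g i j \<noteq> 0}"
    using fin_supported_row_finite[OF fin_supported_adjoint[OF assms]]
    by (auto simp: row_finite_def)
  then show ?thesis by (simp add: mat_adjoint_def)
qed

text \<open>This covers the adjoint, with \<open>c\<close> the conjugation, and for matrices with commuting entries the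
  transpose, with \<open>c\<close> the identity.\<close>

lemma star_mult:
  assumes "fin_supported g" "fin_supported h"
    and "\<And>i j. g i j \<in> A" "\<And>i j. h i j \<in> A"
    and "\<And>a b. a \<in> A \<Longrightarrow> b \<in> A \<Longrightarrow> c (a * b) = c b * c a"
    and "\<And>a b. c (a + b) = c a + (c b :: quat)" "\<And>a. c a = 0 \<longleftrightarrow> a = 0"
  shows "(\<lambda>i k. c (mat_mult g h k i)) = mat_mult (\<lambda>i j. c (h j i)) (\<lambda>i j. c (g j i))"
proof (intro ext)
  fix i k
  let ?T = "{j. g k j \<noteq> 0} \<union> {j. h j i \<noteq> 0}"
  have fin: "finite ?T"
    using fin_supported_finite_column[OF assms(2)] fin_supported_row_finite[OF assms(1)]
    by (auto simp: row_finite_def)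
  have c_sum: "c (sum f T) = (\<Sum>x\<in>T. c (f x))" if "finite T" for f and T :: "'a set"
    using that by (induction T) (use assms in auto)
  have "mat_mult g h k i = (\<Sum>j\<in>?T. g k j * h j i)"
    by (intro mat_mult_superset fin) auto
  then have "c (mat_mult g h k i) = (\<Sum>j\<in>?T. c (h j i) * c (g k j))"
    using assms by (simp add: c_sum[OF fin])
  also have "\<dots> = mat_mult (\<lambda>i j. c (h j i)) (\<lambda>i j. c (g j i)) i k"
    by (rule mat_mult_superset[symmetric, OF fin]) (use assms in auto)
  finally show "c (mat_mult g h k i) = mat_mult (\<lambda>i j. c (h j i)) (\<lambda>i j. c (g j i)) i k" .
qed

lemma mat_adjoint_mult:
  assumes "fin_supported g" "fin_supported h"
  shows "mat_adjoint (mat_mult g h) = mat_mult (mat_adjoint h) (mat_adjoint g)"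
  using star_mult[OF assms, of UNIV qcnj] by (simp add: mat_adjoint_def[abs_def] qcnj_mult qcnj_add)

lemma mat_transpose_mult:
  assumes "fin_supported g" "fin_supported h"
    and "\<And>i j. g i j \<in> scalar_set Complexes_sc" "\<And>i j. h i j \<in> scalar_set Complexes_sc"
  shows "mat_transpose (mat_mult g h) = mat_mult (mat_transpose h) (mat_transpose g)"
  using star_mult[OF assms, of id] complex_scalars_commute by (simp add: mat_transpose_def[abs_def])

lemma fin_supported_transpose:
  assumes "fin_supported g"
  shows "fin_supported (mat_transpose g)"
proof -
  from assms obtain T where "finite T" "supported_on T g" by (auto simp: fin_supported_def)
  moreover from this have "supported_on T (mat_transpose g)"
    by (auto simp: supported_on_def mat_transpose_def mat_one_def)
  ultimately show ?thesis by (auto simp: fin_supported_def)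
qed

lemma invariance_mult:
  assumes "row_finite g" "row_finite h" "row_finite \<Phi>" "row_finite g'" "row_finite h'"
    and "mat_mult g' (mat_mult \<Phi> g) = \<Phi>" "mat_mult h' (mat_mult \<Phi> h) = \<Phi>"
  shows "mat_mult (mat_mult h' g') (mat_mult \<Phi> (mat_mult g h)) = \<Phi>"
proof -
  have "mat_mult (mat_mult h' g') (mat_mult \<Phi> (mat_mult g h))
    = mat_mult h' (mat_mult (mat_mult g' (mat_mult \<Phi> g)) h)"
    using assms(1-5) by (simp add: mat_mult_assoc row_finite_mult)
  then show ?thesis by (simp add: assms)
qed

lemma preserves_sesquilinear_mult:
  assumes "fin_supported g" "fin_supported h" "row_finite \<Phi>"
    and "preserves_sesquilinear \<Phi> g" "preserves_sesquilinear \<Phi> h"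
  shows "preserves_sesquilinear \<Phi> (mat_mult g h)"
  using assms unfolding preserves_sesquilinear_def
  by (simp add: mat_adjoint_mult invariance_mult fin_supported_row_finite fin_supported_adjoint)

lemma preserves_bilinear_mult:
  assumes "fin_supported g" "fin_supported h" "row_finite \<Phi>"
    and "\<And>i j. g i j \<in> scalar_set Complexes_sc" "\<And>i j. h i j \<in> scalar_set Complexes_sc"
    and "preserves_bilinear \<Phi> g" "preserves_bilinear \<Phi> h"
  shows "preserves_bilinear \<Phi> (mat_mult g h)"
  using assms unfolding preserves_bilinear_def
  by (simp add: mat_transpose_mult invariance_mult fin_supported_row_finite fin_supported_transpose)

lemma row_finite_hermitian_form: "row_finite hermitian_form"
  and row_finite_skew_hermitian_form: "row_finite skew_hermitian_form"
  by (simp_all add: row_finite_def hermitian_form_def skew_hermitian_form_def)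

lemma row_finite_symplectic_form: "row_finite symplectic_form"
  unfolding row_finite_def
proof
  fix b
  show "finite {b'. symplectic_form b b' \<noteq> 0}"
  proof (cases b)
    case (Main c n r)
    have "{b'. symplectic_form b b' \<noteq> 0} \<subseteq> {Main c n 0, Main c n 1}"
    proof
      fix b' assume "b' \<in> {b'. symplectic_form b b' \<noteq> 0}"
      then show "b' \<in> {Main c n 0, Main c n 1}"
        by (cases b') (auto simp: Main split: if_splits)
    qed
    then show ?thesis by (rule finite_subset) simp
  qed simp
qed

lemma classical_identity_mult:
  assumes "finite_mat (scalars_of X) B g" "finite_mat (scalars_of X) B h"
    and "classical_identity X g" "classical_identity X h"
  shows "classical_identity X (mat_mult g h)"
proof -
  have fin: "fin_supported g" "fin_supported h"
    and sc: "g i j \<in> scalar_set (scalars_of X)" "h i j \<in> scalar_set (scalars_of X)" for i j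
    using assms by (auto simp: finite_mat_iff)
  have complex: "g i j \<in> scalar_set Complexes_sc \<and> h i j \<in> scalar_set Complexes_sc"
    if "scalars_of X \<noteq> Quaternions_sc" for i j
    using that sc[of i j] real_scalars_complex by (cases "scalars_of X") auto
  note rules = preserves_sesquilinear_mult[OF fin] preserves_bilinear_mult[OF fin]
    row_finite_hermitian_form row_finite_skew_hermitian_form row_finite_symplectic_form
    row_finite_mat_one
  show ?thesis
    using assms(3,4) complex by (cases X) (simp_all add: rules del: scalar_set.simps)
qed

lemma classical_identity_mat_one: "classical_identity X mat_one"
proof -
  have [simp]: "mat_adjoint mat_one = mat_one" "mat_transpose mat_one = mat_one"
    by (auto simp: mat_adjoint_def mat_transpose_def mat_one_def fun_eq_iff)
  show ?thesis
    by (cases X) (simp_all add: preserves_sesquilinear_def preserves_bilinear_def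
        mat_mult_one_right row_finite_hermitian_form row_finite_skew_hermitian_form
        row_finite_symplectic_form)
qed


section \<open>The groups as monoids\<close>

lemma classical_group_mult [simp]:
  "g \<otimes>\<^bsub>classical_group Gs\<^esub> h = (\<lambda>k. mat_mult (g k) (h k))"
  and classical_group_one [simp]: "\<one>\<^bsub>classical_group Gs\<^esub> = (\<lambda>_. mat_one)"
  by (simp_all add: classical_group_def)

lemma heavy_group_mult [simp]: "l \<otimes>\<^bsub>heavy_group Ls\<^esub> l' = (\<lambda>j. mat_mult (l j) (l' j))"
  and heavy_group_one [simp]: "\<one>\<^bsub>heavy_group Ls\<^esub> = (\<lambda>_. mat_one)"
  by (simp_all add: heavy_group_def)

lemma irreducible_classical_mult:
  assumes "g \<in> irreducible_classical X" "h \<in> irreducible_classical X"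
  shows "mat_mult g h \<in> irreducible_classical X"
proof -
  have "finite_mat (scalars_of X) (basis_of X) g" "finite_mat (scalars_of X) (basis_of X) h"
    using assms by (auto simp: irreducible_classical_def invertible_mats_def)
  then show ?thesis
    using assms by (auto simp: irreducible_classical_def invertible_mats_mult classical_identity_mult)
qed

lemma classical_group_fin_supported:
  assumes "g \<in> carrier (classical_group Gs)"
  shows "fin_supported (g k)"
proof (cases "k < length Gs")
  case True
  then show ?thesis using assms
    by (auto simp: classical_group_def irreducible_classical_def invertible_mats_def finite_mat_iff)
qed (use assms in \<open>auto simp: classical_group_def\<close>)

lemma classical_group_supported_on:
  assumes "g \<in> carrier (classical_group Gs)" "k < length Gs"
  shows "supported_on (basis_of (Gs ! k)) (g k)"
  using assms
  by (auto simp: classical_group_def irreducible_classical_def invertible_mats_def finite_mat_iff)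

lemma monoid_classical_group: "monoid (classical_group Gs)"
proof
  fix g h assume "g \<in> carrier (classical_group Gs)" "h \<in> carrier (classical_group Gs)"
  then show "g \<otimes>\<^bsub>classical_group Gs\<^esub> h \<in> carrier (classical_group Gs)"
    by (auto simp: classical_group_def irreducible_classical_mult)
next
  show "\<one>\<^bsub>classical_group Gs\<^esub> \<in> carrier (classical_group Gs)"
    by (auto simp: classical_group_def irreducible_classical_def classical_identity_mat_one)
qed (simp_all add: mat_mult_assoc mat_mult_one_right fin_supported_row_finite
    classical_group_fin_supported)

text \<open>A left inverse of an invertible matrix is also a right inverse, so the definition by
  \<open>g\<^sup>* g = 1\<close> gives the other identity.\<close>

lemma irreducible_heavy_iff:
  "g \<in> irreducible_heavy F \<longleftrightarrow> finite_mat F UNIV g \<and>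
     mat_mult (mat_adjoint g) g = mat_one \<and> mat_mult g (mat_adjoint g) = mat_one"
proof (intro iffI)
  assume g: "g \<in> irreducible_heavy F"
  then obtain h where *: "finite_mat F UNIV g" "finite_mat F UNIV h" "mat_mult g h = mat_one"
    "mat_mult (mat_adjoint g) g = mat_one"
    by (auto simp: irreducible_heavy_def invertible_mats_def)
  have rf: "row_finite (mat_adjoint g)" "row_finite g"
    using * by (auto intro: finite_mat_row_finite finite_mat_adjoint)
  have "mat_adjoint g = mat_mult (mat_adjoint g) (mat_mult g h)"
    using * rf by (simp add: mat_mult_one_right)
  also have "\<dots> = h"
    using mat_mult_assoc[OF rf, of h] * by simp
  finally show "finite_mat F UNIV g \<and> mat_mult (mat_adjoint g) g = mat_one \<and>
     mat_mult g (mat_adjoint g) = mat_one"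
    using * by simp
next
  assume "finite_mat F UNIV g \<and>
     mat_mult (mat_adjoint g) g = mat_one \<and> mat_mult g (mat_adjoint g) = mat_one"
  then show "g \<in> irreducible_heavy F"
    by (auto simp: irreducible_heavy_def invertible_mats_def intro: finite_mat_adjoint)
qed

lemma irreducible_heavy_adjoint: "g \<in> irreducible_heavy F \<Longrightarrow> mat_adjoint g \<in> irreducible_heavy F"
  by (auto simp: irreducible_heavy_iff finite_mat_adjoint)

lemma irreducible_heavy_mult:
  assumes "g \<in> irreducible_heavy F" "h \<in> irreducible_heavy F"
  shows "mat_mult g h \<in> irreducible_heavy F"
proof -
  have fin: "fin_supported g" "fin_supported h"
    using assms by (auto simp: irreducible_heavy_iff finite_mat_iff)
  have "mat_mult (mat_adjoint (mat_mult g h)) (mat_mult mat_one (mat_mult g h)) = mat_one"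
    unfolding mat_adjoint_mult[OF fin]
    by (rule invariance_mult)
      (use assms fin in \<open>auto simp: irreducible_heavy_iff fin_supported_adjoint
        intro: fin_supported_row_finite\<close>)
  then show ?thesis
    using assms by (auto simp: irreducible_heavy_def invertible_mats_mult)
qed

lemma mat_one_irreducible_heavy [simp]: "mat_one \<in> irreducible_heavy F"
proof -
  have "mat_adjoint mat_one = (mat_one :: nat hmat)"
    by (auto simp: mat_adjoint_def mat_one_def fun_eq_iff)
  then show ?thesis by (simp add: irreducible_heavy_iff)
qed

lemma heavy_group_fin_supported:
  assumes "l \<in> carrier (heavy_group Ls)"
  shows "fin_supported (l j)"
proof (cases "j < length Ls")
  case True
  then show ?thesis using assms
    by (auto simp: heavy_group_def irreducible_heavy_iff finite_mat_iff)
qed (use assms in \<open>auto simp: heavy_group_def\<close>)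

lemma group_heavy_group: "group (heavy_group Ls)"
proof (rule groupI)
  fix l assume l: "l \<in> carrier (heavy_group Ls)"
  have "(\<lambda>j. if j < length Ls then mat_adjoint (l j) else mat_one) \<in> carrier (heavy_group Ls)"
    using l by (auto simp: heavy_group_def irreducible_heavy_adjoint)
  moreover have "mat_mult (if j < length Ls then mat_adjoint (l j) else mat_one) (l j) = mat_one" for j
    using l by (auto simp: heavy_group_def irreducible_heavy_iff)
  ultimately show "\<exists>l'\<in>carrier (heavy_group Ls). l' \<otimes>\<^bsub>heavy_group Ls\<^esub> l = \<one>\<^bsub>heavy_group Ls\<^esub>"
    by (intro bexI) auto
next
  fix x y assume "x \<in> carrier (heavy_group Ls)" "y \<in> carrier (heavy_group Ls)"
  then show "x \<otimes>\<^bsub>heavy_group Ls\<^esub> y \<in> carrier (heavy_group Ls)"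
    by (auto simp: heavy_group_def irreducible_heavy_mult)
next
  show "\<one>\<^bsub>heavy_group Ls\<^esub> \<in> carrier (heavy_group Ls)"
    by (auto simp: heavy_group_def)
qed (simp_all add: mat_mult_assoc fin_supported_row_finite heavy_group_fin_supported)


section \<open>Block matrices\<close>

text \<open>A unital \<open>*\<close>-homomorphism \<open>q \<mapsto> (\<phi> q r s)\<close> from the scalars \<open>F\<close> to matrices of size \<open>d\<close> over \<open>A\<close>.
  Nothing is said about indices outside the block.\<close>

definition block_hom :: "scalars \<Rightarrow> scalars \<Rightarrow> nat \<Rightarrow> (quat \<Rightarrow> nat \<Rightarrow> nat \<Rightarrow> quat) \<Rightarrow> bool" where
  "block_hom F A d \<phi> \<longleftrightarrow> (\<forall>r<d. \<forall>r'<d.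
     \<phi> 1 r r' = (if r = r' then 1 else 0) \<and>
     (\<forall>p\<in>scalar_set F. \<phi> p r r' \<in> scalar_set A \<and> \<phi> (qcnj p) r r' = qcnj (\<phi> p r' r) \<and>
       (\<forall>q\<in>scalar_set F. \<phi> (p + q) r r' = \<phi> p r r' + \<phi> q r r' \<and>
          \<phi> (p * q) r r' = (\<Sum>t<d. \<phi> p r t * \<phi> q t r'))))"

lemma less_4_cases: "(r::nat) < 4 \<Longrightarrow> r = 0 \<or> r = 1 \<or> r = 2 \<or> r = 3"
  by auto

lemma qcoord_eq_inner: "r < 4 \<Longrightarrow> qcoord q r = inner (qunit r) q"
  by (drule less_4_cases)
    (auto simp: qcoord_def qunit_def inner_quat_def inner_complex_def numeral_2_eq_2 numeral_3_eq_3)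

lemma lessThan_4: "{..<4::nat} = {0, 1, 2, 3}" and lessThan_2: "{..<2::nat} = {0, 1}"
  by auto

lemma qcoord_expansion: "(\<Sum>t<4. qcoord q t *\<^sub>R qunit t) = q"
proof -
  have "(\<Sum>t<4. qcoord q t *\<^sub>R qunit t) = qcoord q 0 *\<^sub>R qunit 0 + (qcoord q 1 *\<^sub>R qunit 1 +
    (qcoord q 2 *\<^sub>R qunit 2 + qcoord q 3 *\<^sub>R qunit 3))"
    by (simp add: lessThan_4)
  also have "\<dots> = q"
    by (cases q) (simp add: qcoord_def qunit_def scaleR_quat_def plus_quat_def complex_eq_iff)
  finally show ?thesis .
qed

lemma qcoord_expansion_complex:
  "q \<in> scalar_set Complexes_sc \<Longrightarrow> (\<Sum>t<2. qcoord q t *\<^sub>R qunit t) = q"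
proof -
  assume "q \<in> scalar_set Complexes_sc"
  then obtain z where z: "q = Quat z 0" by (auto simp: quat_of_complex_def)
  have "(\<Sum>t<2. qcoord q t *\<^sub>R qunit t) = qcoord q 0 *\<^sub>R qunit 0 + qcoord q 1 *\<^sub>R qunit 1"
    by (simp add: lessThan_2)
  also have "\<dots> = q"
    by (simp add: z qcoord_def qunit_def scaleR_quat_def plus_quat_def complex_eq_iff)
  finally show ?thesis .
qed

text \<open>The coordinates are inner products with the units. Hence the expansion in coordinates makes left
  multiplications multiplicative, and the adjoint of the multiplication by \<open>p\<close> is the one by the
  conjugate of \<open>p\<close>.\<close>

lemma block_hom_left_multiplication:
  assumes "d \<le> 4" and exp: "\<And>q s. q \<in> scalar_set F \<Longrightarrow> s < d \<Longrightarrow>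
     (\<Sum>t<d. qcoord (q * qunit s) t *\<^sub>R qunit t) = q * qunit s"
  shows "block_hom F Reals_sc d (\<lambda>q r s. of_real (qcoord (q * qunit s) r))"
proof -
  have unit: "qcoord (1 * qunit s) r = (if r = s then 1 else 0)" if "r < d" "s < d" for r s
    using that assms(1) less_4_cases[of r] less_4_cases[of s]
    by (auto simp: qcoord_def qunit_def)
  have adj: "qcoord (qcnj p * qunit s) r = qcoord (p * qunit r) s" if "r < d" "s < d" for p r s
    using that assms(1) by (simp add: qcoord_eq_inner inner_commute flip: inner_mult_left_quat)
  have mult: "qcoord (p * q * qunit s) r = (\<Sum>t<d. qcoord (p * qunit t) r * qcoord (q * qunit s) t)"
    if "r < d" "s < d" "q \<in> scalar_set F" for p q r s
  proof -
    have "p * q * qunit s = p * (\<Sum>t<d. qcoord (q * qunit s) t *\<^sub>R qunit t)"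
      using that by (simp add: exp mult.assoc)
    also have "\<dots> = (\<Sum>t<d. qcoord (q * qunit s) t *\<^sub>R (p * qunit t))"
      by (simp add: sum_distrib_left)
    finally show ?thesis
      using that assms(1) by (simp add: qcoord_eq_inner inner_sum_right mult.commute)
  qed
  have add: "qcoord ((p + q) * qunit s) r = qcoord (p * qunit s) r + qcoord (q * qunit s) r"
    if "r < d" for p q r s
    using that assms(1) by (simp add: qcoord_eq_inner inner_add_right distrib_right)
  have real: "qcnj (of_real x) = of_real x" for x
    using qcnj_real_scalar[of "of_real x"] by simp
  show ?thesis
    unfolding block_hom_def
    using assms(1)
    by (auto simp: unit[simplified] adj mult real add
        simp flip: of_real_add of_real_mult of_real_sum)
qed

lemma block_entry_hom: "block_hom F A (block_size F A) (block_entry F A)"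
proof -
  have incl: "block_hom F A 1 (\<lambda>q r s. q)" if "scalar_set F \<subseteq> scalar_set A" for F A
    using that by (auto simp: block_hom_def)
  have RC: "scalar_set Reals_sc \<subseteq> scalar_set Complexes_sc"
    using real_scalars_complex by blast
  have H: "scalar_set F \<subseteq> scalar_set Quaternions_sc"
    by simp
  have CR: "block_hom Complexes_sc Reals_sc 2 (\<lambda>q r s. of_real (qcoord (q * qunit s) r))"
  proof (rule block_hom_left_multiplication)
    fix q s assume "q \<in> scalar_set Complexes_sc" "s < (2::nat)"
    moreover from this have "qunit s \<in> scalar_set Complexes_sc"
      using lessThan_2 by (auto simp: qunit_def quat_of_complex_def less_2_cases_iff)
    ultimately show "(\<Sum>t<2. qcoord (q * qunit s) t *\<^sub>R qunit t) = q * qunit s"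
      by (intro qcoord_expansion_complex scalar_set_mult)
  qed simp
  have HR: "block_hom Quaternions_sc Reals_sc 4 (\<lambda>q r s. of_real (qcoord (q * qunit s) r))"
    by (rule block_hom_left_multiplication) (simp_all add: qcoord_expansion)
  have HC: "block_hom Quaternions_sc Complexes_sc 2
     (\<lambda>q r s. quat_of_complex ([[qfst q, qsnd q], [- cnj (qsnd q), cnj (qfst q)]] ! r ! s))"
    unfolding block_hom_def
    by (auto simp: less_2_cases_iff lessThan_2 quat_of_complex_hom one_quat_def times_quat_def
        plus_quat_def qcnj_def quat_of_complex_def zero_quat_def algebra_simps)
  show ?thesis
    using incl[OF RC] incl[of A A, OF order_refl] incl[of F Quaternions_sc, OF H] CR HR HC
    by (cases F; cases A) (simp_all add: block_hom_def del: scalar_set.simps)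
qed

lemma block_entry_qcnj_hom: "block_hom Complexes_sc Complexes_sc 1 (\<lambda>q r s. qcnj q)"
  using scalar_set_qcnj[of _ Complexes_sc]
  by (auto simp: block_hom_def qcnj_add qcnj_mult complex_scalars_commute simp del: scalar_set.simps)

text \<open>Replaces the entries of the matrices \<open>h s\<close> by blocks. The row \<open>x\<close> of \<open>h s\<close> becomes the rows labelled
  \<open>(s, x, r)\<close>; the unlabelled basis vectors are fixed. Different \<open>s\<close> may use the same matrix, as
  for a straight homomorphism in which a factor occurs several times.\<close>

definition block_map ::
    "('b \<Rightarrow> (nat \<times> nat \<times> nat) option) \<Rightarrow> (nat \<Rightarrow> quat \<Rightarrow> nat \<Rightarrow> nat \<Rightarrow> quat) \<Rightarrow>
     (nat \<Rightarrow> nat hmat) \<Rightarrow> 'b hmat" where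
  "block_map lab \<phi> h b b' =
     (case (lab b, lab b') of
        (Some (s, x, r), Some (s', x', r')) \<Rightarrow> if s = s' then \<phi> s (h s x x') r r' else 0
      | _ \<Rightarrow> mat_one b b')"

text \<open>The labels exhaust the triples \<open>(s, x, r)\<close> with \<open>s \<in> T\<close> and \<open>r < d s\<close>, each once; otherwise
  block maps would not be multiplicative.\<close>

locale block_construction =
  fixes lab :: "'b \<Rightarrow> (nat \<times> nat \<times> nat) option" and T :: "nat set" and d :: "nat \<Rightarrow> nat"
    and F :: "nat \<Rightarrow> scalars" and A :: scalars and \<phi> :: "nat \<Rightarrow> quat \<Rightarrow> nat \<Rightarrow> nat \<Rightarrow> quat"
  assumes finite_T: "finite T"
    and lab_inj: "lab b = Some z \<Longrightarrow> lab b' = Some z \<Longrightarrow> b = b'"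
    and lab_range: "lab b = Some (s, x, r) \<Longrightarrow> s \<in> T \<and> r < d s"
    and lab_surj: "s \<in> T \<Longrightarrow> r < d s \<Longrightarrow> \<exists>b. lab b = Some (s, x, r)"
    and hom: "s \<in> T \<Longrightarrow> block_hom (F s) A (d s) (\<phi> s)"
begin

lemma hom_rules:
  assumes "s \<in> T" "r < d s" "r' < d s" "p \<in> scalar_set (F s)" "q \<in> scalar_set (F s)"
  shows "\<phi> s 1 r r' = (if r = r' then 1 else 0)" "\<phi> s p r r' \<in> scalar_set A"
    "\<phi> s (qcnj p) r r' = qcnj (\<phi> s p r' r)" "\<phi> s (p + q) r r' = \<phi> s p r r' + \<phi> s q r r'"
    "\<phi> s (p * q) r r' = (\<Sum>t<d s. \<phi> s p r t * \<phi> s q t r')"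
  using hom[OF assms(1)] assms unfolding block_hom_def by blast+

lemma hom_0:
  assumes "s \<in> T" "r < d s" "r' < d s"
  shows "\<phi> s 0 r r' = 0"
  using hom_rules(4)[OF assms, of 0 0] by simp

lemma hom_sum:
  assumes "s \<in> T" "r < d s" "r' < d s" "\<And>y. y \<in> Y \<Longrightarrow> f y \<in> scalar_set (F s)" "finite Y"
  shows "\<phi> s (\<Sum>y\<in>Y. f y) r r' = (\<Sum>y\<in>Y. \<phi> s (f y) r r')"
  using assms(5,4)
proof (induction Y)
  case (insert y Y)
  then show ?case
    using assms(1-3) by (simp add: hom_rules(4) scalar_set_sum)
qed (use assms hom_0 in simp)

definition unlab :: "nat \<times> nat \<times> nat \<Rightarrow> 'b" where
  "unlab z = (SOME b. lab b = Some z)"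

lemma lab_unlab: "s \<in> T \<Longrightarrow> r < d s \<Longrightarrow> lab (unlab (s, x, r)) = Some (s, x, r)"
  unfolding unlab_def by (rule someI_ex) (rule lab_surj)

lemma unlab_lab: "lab b = Some z \<Longrightarrow> unlab z = b"
  unfolding unlab_def by (rule some_equality) (auto intro: lab_inj)

lemma block_map_neq_None: "lab b = None \<or> lab b' = None \<Longrightarrow> block_map lab \<phi> h b b' = mat_one b b'"
  by (auto simp: block_map_def split: option.splits)

text \<open>Whether a basis vector is fixed can be decided entry by entry, which gives triviality
  of rows and of columns at the same time.\<close>

lemma block_map_mat_one_entry:
  assumes "lab b = Some (s, x, r)" "lab b' = Some (s', y, r')" "s = s' \<Longrightarrow> h s x y = mat_one x y"
  shows "block_map lab \<phi> h b b' = mat_one b b'"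
proof (cases "s = s' \<and> x = y")
  case True
  have "b = b' \<longleftrightarrow> r = r'"
    using assms(1,2) True by (auto dest: lab_inj)
  then show ?thesis
    using True assms lab_range[OF assms(1)] lab_range[OF assms(2)] hom_rules(1)[of s r r' 0 0]
    by (auto simp: block_map_def mat_one_def)
next
  case False
  then have "b \<noteq> b'" using assms(1,2) by auto
  then show ?thesis
    using False assms lab_range[OF assms(1)] lab_range[OF assms(2)] hom_0[of s r r']
    by (auto simp: block_map_def mat_one_def)
qed

lemma block_map_trivial_row:
  assumes "\<And>s x r y. lab b = Some (s, x, r) \<Longrightarrow> h s x y = mat_one x y"
  shows "block_map lab \<phi> h b b' = mat_one b b'"
proof (cases "lab b = None \<or> lab b' = None")
  case False
  then obtain s x r s' y r' where "lab b = Some (s, x, r)" "lab b' = Some (s', y, r')"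
    by (metis option.exhaust prod_cases3)
  then show ?thesis using assms block_map_mat_one_entry by blast
qed (rule block_map_neq_None)

lemma block_map_trivial_column:
  assumes "\<And>s x r y. lab b' = Some (s, x, r) \<Longrightarrow> h s y x = mat_one y x"
  shows "block_map lab \<phi> h b b' = mat_one b b'"
proof (cases "lab b = None \<or> lab b' = None")
  case False
  then obtain s x r s' y r' where "lab b = Some (s, x, r)" "lab b' = Some (s', y, r')"
    by (metis option.exhaust prod_cases3)
  then show ?thesis using assms block_map_mat_one_entry by blast
qed (rule block_map_neq_None)

lemma fin_supported_block_map:
  assumes "\<And>s. s \<in> T \<Longrightarrow> fin_supported (h s)"
  shows "fin_supported (block_map lab \<phi> h)"
proof -
  from assms have "\<forall>s\<in>T. \<exists>X. finite X \<and> supported_on X (h s)"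
    by (auto simp: fin_supported_def)
  then obtain X where X: "\<And>s. s \<in> T \<Longrightarrow> finite (X s) \<and> supported_on (X s) (h s)"
    by metis
  let ?U = "unlab ` (SIGMA s:T. X s \<times> {..<d s})"
  have out: "h s x y = mat_one x y \<and> h s y x = mat_one y x"
    if "b \<notin> ?U" "lab b = Some (s, x, r)" for b s x r y
  proof -
    have "s \<in> T" "r < d s" using lab_range[OF that(2)] by auto
    moreover have "x \<notin> X s"
      using that calculation unlab_lab[OF that(2)] by force
    ultimately show ?thesis using X[of s] by (auto simp: supported_on_def)
  qed
  have "supported_on ?U (block_map lab \<phi> h)"
    unfolding supported_on_def
  proof (intro allI impI)
    fix b b' assume "b \<notin> ?U \<or> b' \<notin> ?U"
    then show "block_map lab \<phi> h b b' = mat_one b b'"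
    proof
      assume "b \<notin> ?U"
      then show ?thesis using out by (intro block_map_trivial_row) blast
    next
      assume "b' \<notin> ?U"
      then show ?thesis using out by (intro block_map_trivial_column) blast
    qed
  qed
  moreover have "finite ?U"
    using X finite_T by (intro finite_imageI finite_SigmaI) auto
  ultimately show ?thesis by (auto simp: fin_supported_def)
qed

lemma block_map_scalars:
  assumes "\<And>s x y. s \<in> T \<Longrightarrow> h s x y \<in> scalar_set (F s)"
  shows "block_map lab \<phi> h b b' \<in> scalar_set A"
proof (cases "lab b = None \<or> lab b' = None")
  case True
  then show ?thesis by (auto simp: block_map_neq_None mat_one_def)
next
  case False
  then obtain s x r s' y r' where lab: "lab b = Some (s, x, r)" "lab b' = Some (s', y, r')"
    by (metis option.exhaust prod_cases3)
  then show ?thesis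
    using lab_range[OF lab(1)] lab_range[OF lab(2)] assms hom_rules(2)[of s r r' "h s x y" 0]
    by (auto simp: block_map_def)
qed

lemma block_map_adjoint:
  assumes "\<And>s x y. s \<in> T \<Longrightarrow> h s x y \<in> scalar_set (F s)"
  shows "block_map lab \<phi> (\<lambda>s. mat_adjoint (h s)) = mat_adjoint (block_map lab \<phi> h)"
proof (intro ext)
  fix b b'
  show "block_map lab \<phi> (\<lambda>s. mat_adjoint (h s)) b b' = mat_adjoint (block_map lab \<phi> h) b b'"
  proof (cases "lab b = None \<or> lab b' = None")
    case True
    then show ?thesis by (auto simp: mat_adjoint_def block_map_neq_None mat_one_def)
  next
    case False
    then obtain s x r s' y r' where lab: "lab b = Some (s, x, r)" "lab b' = Some (s', y, r')"
      by (metis option.exhaust prod_cases3)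
    then show ?thesis
      using lab_range[OF lab(1)] lab_range[OF lab(2)] assms hom_rules(3)[of s r r' "h s y x" 0]
      by (auto simp: block_map_def mat_adjoint_def)
  qed
qed

lemma block_map_mult:
  assumes fin: "\<And>s. s \<in> T \<Longrightarrow> fin_supported (h s)"
    and sc: "\<And>s x y. s \<in> T \<Longrightarrow> h s x y \<in> scalar_set (F s)"
      "\<And>s x y. s \<in> T \<Longrightarrow> h' s x y \<in> scalar_set (F s)"
  shows "block_map lab \<phi> (\<lambda>s. mat_mult (h s) (h' s)) =
    mat_mult (block_map lab \<phi> h) (block_map lab \<phi> h')"
proof (intro ext)
  fix b b''
  let ?m = "block_map lab \<phi>"
  have rf: "finite {b'. ?m h b b' \<noteq> 0}"
    using fin_supported_row_finite[OF fin_supported_block_map[OF fin]] by (simp add: row_finite_def)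
  show "?m (\<lambda>s. mat_mult (h s) (h' s)) b b'' = mat_mult (?m h) (?m h') b b''"
  proof (cases "lab b = None \<or> lab b'' = None")
    case True
    then show ?thesis
    proof
      assume "lab b = None"
      then show ?thesis
        by (subst mat_mult_trivial_row) (auto simp: block_map_neq_None)
    next
      assume "lab b'' = None"
      then show ?thesis
        using mat_mult_trivial_column[where g = "?m h" and i = b and h = "?m h'" and k = b''] rf
        by (auto simp: block_map_neq_None)
    qed
  next
    case False
    then obtain s x r s' z r' where lab: "lab b = Some (s, x, r)" "lab b'' = Some (s', z, r')"
      by (metis option.exhaust prod_cases3)
    have s: "s \<in> T" "r < d s" and s': "s' \<in> T" "r' < d s'"
      using lab_range lab by blast+
    define Y where "Y = {y. h s x y \<noteq> 0}"
    have finY: "finite Y"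
      using fin_supported_row_finite[OF fin[OF s(1)]] by (simp add: Y_def row_finite_def)
    have entry: "?m h b (unlab (s, y, t)) = \<phi> s (h s x y) r t"
      "?m h' (unlab (s, y, t)) b'' = (if s = s' then \<phi> s (h' s y z) t r' else 0)"
      if "t < d s" for y t
      using lab lab_unlab[OF s(1) that] by (auto simp: block_map_def)
    have "{b'. ?m h b b' \<noteq> 0} \<subseteq> (\<lambda>(y, t). unlab (s, y, t)) ` (Y \<times> {..<d s})"
    proof
      fix b' assume b': "b' \<in> {b'. ?m h b b' \<noteq> 0}"
      have "lab b' \<noteq> None"
      proof
        assume "lab b' = None"
        moreover from this have "b \<noteq> b'" using lab by auto
        ultimately show False
          using b' block_map_neq_None[of b b' h] by (simp add: mat_one_neq)
      qed
      then obtain s1 y t where lab': "lab b' = Some (s1, y, t)"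
        by (metis option.exhaust prod_cases3)
      then have "s1 = s" "t < d s" "\<phi> s (h s x y) r t \<noteq> 0"
        using b' lab lab_range[OF lab'] by (auto simp: block_map_def split: if_splits)
      moreover from this have "y \<in> Y"
        using hom_0[OF s] by (auto simp: Y_def)
      ultimately show "b' \<in> (\<lambda>(y, t). unlab (s, y, t)) ` (Y \<times> {..<d s})"
        using unlab_lab[OF lab'] by force
    qed
    moreover have inj: "inj_on (\<lambda>(y, t). unlab (s, y, t)) (Y \<times> {..<d s})"
    proof (rule inj_onI)
      fix z z' assume z: "z \<in> Y \<times> {..<d s}" "z' \<in> Y \<times> {..<d s}"
        "(\<lambda>(y, t). unlab (s, y, t)) z = (\<lambda>(y, t). unlab (s, y, t)) z'"
      then have "lab (unlab (s, fst z, snd z)) = lab (unlab (s, fst z', snd z'))"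
        by (simp add: case_prod_unfold)
      then show "z = z'"
        using z lab_unlab[OF s(1), of "snd z" "fst z"] lab_unlab[OF s(1), of "snd z'" "fst z'"]
        by (simp add: mem_Times_iff prod_eq_iff)
    qed
    ultimately have "mat_mult (?m h) (?m h') b b'' =
      (\<Sum>b'\<in>(\<lambda>(y, t). unlab (s, y, t)) ` (Y \<times> {..<d s}). ?m h b b' * ?m h' b' b'')"
      using finY by (intro mat_mult_superset) auto
    also have "\<dots> = (\<Sum>(y, t)\<in>Y \<times> {..<d s}. ?m h b (unlab (s, y, t)) * ?m h' (unlab (s, y, t)) b'')"
      using inj by (subst sum.reindex) (auto simp: case_prod_unfold)
    also have "\<dots> = (\<Sum>y\<in>Y. \<Sum>t<d s. \<phi> s (h s x y) r t * (if s = s' then \<phi> s (h' s y z) t r' else 0))"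
      unfolding sum.cartesian_product by (intro sum.cong refl) (auto simp: entry)
    also have "\<dots> = ?m (\<lambda>s. mat_mult (h s) (h' s)) b b''"
    proof (cases "s = s'")
      case True
      have "(\<Sum>y\<in>Y. \<Sum>t<d s. \<phi> s (h s x y) r t * \<phi> s (h' s y z) t r') =
        (\<Sum>y\<in>Y. \<phi> s (h s x y * h' s y z) r r')"
        using s s' sc True by (simp add: hom_rules(5))
      also have "\<dots> = \<phi> s (\<Sum>y\<in>Y. h s x y * h' s y z) r r'"
        using s s' sc True finY by (intro hom_sum[symmetric]) (auto intro: scalar_set_mult)
      finally show ?thesis
        using True lab by (simp add: block_map_def mat_mult_def Y_def)
    qed (use lab in \<open>simp add: block_map_def\<close>)
    finally show ?thesis by simp
  qed
qed

lemma block_map_unitary: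
  assumes "\<And>s. s \<in> T \<Longrightarrow> h s \<in> irreducible_heavy (F s)"
  shows "fin_supported (block_map lab \<phi> h)" "block_map lab \<phi> h b b' \<in> scalar_set A"
    "mat_mult (mat_adjoint (block_map lab \<phi> h)) (block_map lab \<phi> h) = mat_one"
    "mat_mult (block_map lab \<phi> h) (mat_adjoint (block_map lab \<phi> h)) = mat_one"
proof -
  have h: "fin_supported (h s)" "h s x y \<in> scalar_set (F s)" "mat_adjoint (h s) x y \<in> scalar_set (F s)"
    "fin_supported (mat_adjoint (h s))"
    "mat_mult (mat_adjoint (h s)) (h s) = mat_one" "mat_mult (h s) (mat_adjoint (h s)) = mat_one"
    if "s \<in> T" for s x y
    using assms[OF that] finite_mat_adjoint[of "F s" UNIV "h s"]
    by (auto simp: irreducible_heavy_iff finite_mat_iff)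
  show "fin_supported (block_map lab \<phi> h)" "block_map lab \<phi> h b b' \<in> scalar_set A"
    using h by (auto intro: fin_supported_block_map block_map_scalars)
  have one: "block_map lab \<phi> f = mat_one" if "\<And>s. s \<in> T \<Longrightarrow> f s = mat_one" for f
    using that by (intro ext block_map_trivial_row) (auto dest: lab_range)
  show "mat_mult (mat_adjoint (block_map lab \<phi> h)) (block_map lab \<phi> h) = mat_one"
    using h by (simp add: one flip: block_map_adjoint block_map_mult)
  show "mat_mult (block_map lab \<phi> h) (mat_adjoint (block_map lab \<phi> h)) = mat_one"
    using h by (simp add: one flip: block_map_adjoint block_map_mult)
qed

text \<open>A permutation matrix has the entries \<open>0\<close> and \<open>1\<close>, which become zero and identity blocks. So the
  result permutes the labels, without changing the position \<open>r\<close> inside the blocks.\<close>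

lemma block_map_permutation:
  assumes h: "\<And>s x y. s \<in> T \<Longrightarrow> h s x y = (if x = p s y then 1 else 0)"
    and \<psi>: "\<And>b s x r. lab b = Some (s, x, r) \<Longrightarrow> lab (\<psi> b) = Some (s, p s x, r)"
      "\<And>b. lab b = None \<Longrightarrow> \<psi> b = b"
  shows "block_map lab \<phi> h b b' = (if b = \<psi> b' then 1 else 0)"
proof (cases "lab b' = None")
  case True
  then show ?thesis using \<psi> by (auto simp: block_map_neq_None mat_one_def)
next
  case False
  then obtain s' y r' where lab': "lab b' = Some (s', y, r')"
    by (metis option.exhaust prod_cases3)
  show ?thesis
  proof (cases "lab b = None")
    case True
    then show ?thesis using False \<psi>(1)[OF lab'] by (auto simp: block_map_neq_None mat_one_def)
  next
    case False
    then obtain s x r where lab: "lab b = Some (s, x, r)"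
      by (metis option.exhaust prod_cases3)
    have "b = \<psi> b' \<longleftrightarrow> s = s' \<and> x = p s' y \<and> r = r'"
      using \<psi>(1)[OF lab'] lab by (auto dest: lab_inj)
    then show ?thesis
      using lab lab' lab_range[OF lab] lab_range[OF lab'] h[of s x y] hom_0[of s r r']
        hom_rules(1)[of s r r' 0 0]
      by (auto simp: block_map_def split: if_splits)
  qed
qed

end


section \<open>Straight homomorphisms and heavy embeddings as block maps\<close>

definition straight_lab :: "straight_data \<Rightarrow> nat \<Rightarrow> (nat \<times> nat \<times> nat) option" where
  "straight_lab S n = (case labelling S n of Copy s x r \<Rightarrow> Some (s, x, r) | Fixed i \<Rightarrow> None)"

definition straight_block ::
    "scalars list \<Rightarrow> scalars \<Rightarrow> straight_data \<Rightarrow> nat \<Rightarrow> quat \<Rightarrow> nat \<Rightarrow> nat \<Rightarrow> quat" where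
  "straight_block Ls A S s q =
     block_entry (Ls ! fst (blocks S ! s)) A (if snd (blocks S ! s) then qcnj q else q)"

lemma straight_lab_eq_Some [simp]: "straight_lab S n = Some (s, x, r) \<longleftrightarrow> labelling S n = Copy s x r"
  by (auto simp: straight_lab_def split: label.splits)

lemma straight_blockD:
  assumes "is_straight Ls A S" "s < length (blocks S)"
  shows "fst (blocks S ! s) < length Ls"
    "snd (blocks S ! s) \<Longrightarrow> Ls ! fst (blocks S ! s) = Complexes_sc \<and> A = Complexes_sc"
proof -
  obtain m cj where m: "blocks S ! s = (m, cj)" by fastforce
  then have "(m, cj) \<in> set (blocks S)" using nth_mem[OF assms(2)] by simp
  then show "fst (blocks S ! s) < length Ls"
    "snd (blocks S ! s) \<Longrightarrow> Ls ! fst (blocks S ! s) = Complexes_sc \<and> A = Complexes_sc"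
    using assms(1) m unfolding is_straight_def by auto
qed

lemma straight_hom_eq_block_map:
  assumes "is_straight Ls A S"
  shows "straight_hom Ls A S l =
    block_map (straight_lab S) (straight_block Ls A S) (\<lambda>s. l (fst (blocks S ! s)))"
proof (intro ext)
  fix n n'
  have "inj (labelling S)" using assms by (auto simp: is_straight_def bij_betw_def)
  then have "labelling S n = labelling S n' \<longleftrightarrow> n = n'" by (auto dest: injD)
  then show "straight_hom Ls A S l n n' =
    block_map (straight_lab S) (straight_block Ls A S) (\<lambda>s. l (fst (blocks S ! s))) n n'"
    by (auto simp: straight_hom_def block_map_def straight_lab_def straight_block_def mat_one_def
        split: label.splits prod.splits)
qed

lemma straight_block_construction:
  assumes "is_straight Ls A S"
  shows "block_construction (straight_lab S) {..<length (blocks S)}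
    (\<lambda>s. block_size (Ls ! fst (blocks S ! s)) A) (\<lambda>s. Ls ! fst (blocks S ! s)) A
    (straight_block Ls A S)"
proof
  have inj: "inj (labelling S)" and range: "range (labelling S) = label_set Ls A S"
    using assms by (auto simp: is_straight_def bij_betw_def)
  show "b = b'" if "straight_lab S b = Some z" "straight_lab S b' = Some z" for b b' z
    using that injD[OF inj, of b b'] by (cases z) simp
  show "s \<in> {..<length (blocks S)} \<and> r < block_size (Ls ! fst (blocks S ! s)) A"
    if "straight_lab S b = Some (s, x, r)" for b s x r
    using that rangeI[of "labelling S" b] unfolding range by (auto simp: label_set_def)
  show "\<exists>b. straight_lab S b = Some (s, x, r)"
    if "s \<in> {..<length (blocks S)}" "r < block_size (Ls ! fst (blocks S ! s)) A" for s x r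
  proof -
    have "Copy s x r \<in> range (labelling S)"
      unfolding range using that by (auto simp: label_set_def)
    then show ?thesis by (metis imageE straight_lab_eq_Some)
  qed
  show "block_hom (Ls ! fst (blocks S ! s)) A (block_size (Ls ! fst (blocks S ! s)) A)
     (straight_block Ls A S s)" if "s \<in> {..<length (blocks S)}" for s
    using that straight_blockD(2)[OF assms] block_entry_hom block_entry_qcnj_hom
    by (cases "snd (blocks S ! s)") (simp_all add: straight_block_def[abs_def] block_hom_def)
qed simp

definition heavy_lab :: "classical \<Rightarrow> basis_vec \<Rightarrow> (nat \<times> nat \<times> nat) option" where
  "heavy_lab X b =
     (if b \<in> basis_of X then (case b of Main c n r \<Rightarrow> Some (c, n, r) | Extra i \<Rightarrow> None) else None)"

lemma heavy_lab_eq_Some [simp]: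
  "heavy_lab X b = Some (c, n, r) \<longleftrightarrow> b = Main c n r \<and> b \<in> basis_of X"
  by (auto simp: heavy_lab_def split: basis_vec.splits)

lemma Main_basis_of [simp]: "Main c n r \<in> basis_of X \<longleftrightarrow>
    c < length (heavy_factors X) \<and> r < block_size (heavy_factors X ! c) (scalars_of X)"
  by (auto simp: basis_of_def)

lemma heavy_embedding_eq_block_map:
  "heavy_embedding X h =
    block_map (heavy_lab X) (\<lambda>c. block_entry (heavy_factors X ! c) (scalars_of X)) h"
  by (auto simp: fun_eq_iff heavy_embedding_def block_map_def heavy_lab_def split: basis_vec.splits)

lemma heavy_block_construction:
  "block_construction (heavy_lab X) {..<length (heavy_factors X)}
    (\<lambda>c. block_size (heavy_factors X ! c) (scalars_of X)) (\<lambda>c. heavy_factors X ! c) (scalars_of X)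
    (\<lambda>c. block_entry (heavy_factors X ! c) (scalars_of X))"
  by standard (auto simp: block_entry_hom)


section \<open>Maximal heavy subgroups preserve the forms\<close>

text \<open>For a unitary \<open>g\<close> the condition \<open>g\<^sup>* \<Phi> g = \<Phi>\<close> says that \<open>g\<close> commutes with \<open>\<Phi>\<close>.\<close>

lemma preserves_sesquilinear_commuting:
  assumes "row_finite g" "row_finite (mat_adjoint g)" "mat_mult (mat_adjoint g) g = mat_one"
    and "mat_mult \<Phi> g = mat_mult g \<Phi>"
  shows "preserves_sesquilinear \<Phi> g"
  using mat_mult_assoc[OF assms(2,1), of \<Phi>] assms by (simp add: preserves_sesquilinear_def)

lemma diagonal_commute:
  assumes "row_finite g" "\<And>b b'. b \<noteq> b' \<Longrightarrow> \<Phi> b b' = 0"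
    and "\<And>b b'. \<Phi> b b * g b b' = g b b' * \<Phi> b' b'"
  shows "mat_mult \<Phi> g = mat_mult g \<Phi>"
proof (intro ext)
  fix b b'
  have "mat_mult \<Phi> g b b' = \<Phi> b b * g b b'"
    by (rule mat_mult_single) (use assms in auto)
  moreover have "mat_mult g \<Phi> b b' = g b b' * \<Phi> b' b'"
    by (rule mat_mult_single_right) (use assms in \<open>auto simp: row_finite_def\<close>)
  ultimately show "mat_mult \<Phi> g b b' = mat_mult g \<Phi> b b'"
    using assms(3) by simp
qed

lemma mat_mult_symplectic_left:
  "mat_mult symplectic_form k (Main c n r) b =
     (if r = 0 then k (Main c n 1) b else if r = 1 then - k (Main c n 0) b else 0)"
  "mat_mult symplectic_form k (Extra i) b = 0"
proof -
  have z: "symplectic_form (Main c n r) b' = (if r = 0 \<and> b' = Main c n 1 then 1 else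
      if r = 1 \<and> b' = Main c n 0 then - 1 else 0)" for b'
    by (cases b') auto
  have "mat_mult symplectic_form k (Main c n r) b =
    symplectic_form (Main c n r) (Main c n (1 - r)) * k (Main c n (1 - r)) b"
    by (rule mat_mult_single) (auto simp: z)
  then show "mat_mult symplectic_form k (Main c n r) b =
     (if r = 0 then k (Main c n 1) b else if r = 1 then - k (Main c n 0) b else 0)"
    by (auto simp: z)
  show "mat_mult symplectic_form k (Extra i) b = 0"
    by (simp add: mat_mult_def)
qed

lemma mat_mult_symplectic_right:
  assumes "row_finite k"
  shows "mat_mult k symplectic_form b (Main c n r) =
     (if r = 0 then - k b (Main c n 1) else if r = 1 then k b (Main c n 0) else 0)"
  "mat_mult k symplectic_form b (Extra i) = 0"
proof -
  have z: "symplectic_form b' (Main c n r) = (if r = 1 \<and> b' = Main c n 0 then 1 else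
      if r = 0 \<and> b' = Main c n 1 then - 1 else 0)" for b'
    by (cases b') auto
  have "mat_mult k symplectic_form b (Main c n r) =
    k b (Main c n (1 - r)) * symplectic_form (Main c n (1 - r)) (Main c n r)"
    by (rule mat_mult_single_right) (use assms in \<open>auto simp: z row_finite_def\<close>)
  then show "mat_mult k symplectic_form b (Main c n r) =
     (if r = 0 then - k b (Main c n 1) else if r = 1 then k b (Main c n 0) else 0)"
    by (auto simp: z)
  have "symplectic_form b' (Extra i) = 0" for b'
    by (cases b') auto
  then show "mat_mult k symplectic_form b (Extra i) = 0"
    by (simp add: mat_mult_def)
qed

text \<open>With \<open>B\<close> for the block and \<open>J\<close> for the standard symplectic matrix of size two these are the entries
  of \<open>B\<^sup>T J = J B\<^sup>*\<close>.\<close>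

lemma symplectic_block_entry:
  assumes "F = Complexes_sc \<and> A = Reals_sc \<or> F = Quaternions_sc \<and> A = Complexes_sc"
    and "q \<in> scalar_set F"
  shows "qcnj (block_entry F A q 0 (Suc 0)) = - block_entry F A q (Suc 0) 0"
    "qcnj (block_entry F A q (Suc 0) 0) = - block_entry F A q 0 (Suc 0)"
    "qcnj (block_entry F A q 0 0) = block_entry F A q (Suc 0) (Suc 0)"
    "qcnj (block_entry F A q (Suc 0) (Suc 0)) = block_entry F A q 0 0"
  using assms
  by (auto simp: quat_of_complex_def qcnj_def of_real_quat qcoord_def qunit_def times_quat_def
      uminus_quat_def)

text \<open>The blockwise relation gives \<open>g\<^sup>T J = J g\<^sup>*\<close>, whence \<open>g\<^sup>T J g = J g\<^sup>* g = J\<close>.\<close>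

lemma preserves_symplectic_form:
  assumes X: "X = Sp_2inf_R \<or> X = Sp_2inf_C"
    and sc: "\<And>x y. h 0 x y \<in> scalar_set (heavy_factors X ! 0)"
    and g: "g = heavy_embedding X h" "fin_supported g" "mat_mult (mat_adjoint g) g = mat_one"
  shows "preserves_bilinear symplectic_form g"
proof -
  let ?J = symplectic_form and ?\<phi> = "block_entry (heavy_factors X ! 0) (scalars_of X)"
  have rf: "row_finite g" "row_finite (mat_transpose g)" "row_finite (mat_adjoint g)"
    using g(2) by (auto intro: fin_supported_row_finite fin_supported_transpose fin_supported_adjoint)
  have entry: "g (Main c n r) (Main c' n' r') = (if c = 0 \<and> c' = 0 \<and> r < 2 \<and> r' < 2
      then ?\<phi> (h 0 n n') r r' else mat_one (Main c n r) (Main c' n' r'))"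
    "g (Extra i) b = mat_one (Extra i) b" "g b (Extra i) = mat_one b (Extra i)"
    for c n r c' n' r' i b
    using X by (auto simp: g(1) heavy_embedding_def split: basis_vec.splits)
  note \<phi> = symplectic_block_entry[OF _ sc, of "scalars_of X"]
  have "mat_mult (mat_transpose g) ?J = mat_mult ?J (mat_adjoint g)"
  proof (intro ext)
    fix b b'
    show "mat_mult (mat_transpose g) ?J b b' = mat_mult ?J (mat_adjoint g) b b'"
      using X \<phi>
      by (cases b; cases b')
        (auto simp: mat_mult_symplectic_left mat_mult_symplectic_right rf mat_transpose_def
          mat_adjoint_def entry mat_one_def)
  qed
  then have "mat_mult (mat_transpose g) (mat_mult ?J g) = mat_mult (mat_mult ?J (mat_adjoint g)) g"
    using rf by (simp add: row_finite_symplectic_form flip: mat_mult_assoc)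
  also have "\<dots> = ?J"
    using rf g(3) by (simp add: mat_mult_assoc row_finite_symplectic_form mat_mult_one_right)
  finally show ?thesis by (simp add: preserves_bilinear_def)
qed

text \<open>The image is unitary. The hermitian form is preserved because \<open>g\<close> does not mix vectors of different
  signs, the skew hermitian one because the entries of \<open>g\<close> are complex and commute with \<open>\<i>\<close>, and
  the orthogonal one because the entries are real, so that transpose and adjoint agree.\<close>

lemma heavy_embedding_classical:
  assumes h: "\<And>c. c < length (heavy_factors X) \<Longrightarrow> h c \<in> irreducible_heavy (heavy_factors X ! c)"
  shows "heavy_embedding X h \<in> irreducible_classical X"
proof -
  interpret block_construction "heavy_lab X" "{..<length (heavy_factors X)}"
    "\<lambda>c. block_size (heavy_factors X ! c) (scalars_of X)" "\<lambda>c. heavy_factors X ! c" "scalars_of X"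
    "\<lambda>c. block_entry (heavy_factors X ! c) (scalars_of X)"
    by (rule heavy_block_construction)
  define g where "g = heavy_embedding X h"
  have g: "fin_supported g" "g b b' \<in> scalar_set (scalars_of X)"
    "mat_mult (mat_adjoint g) g = mat_one" "mat_mult g (mat_adjoint g) = mat_one" for b b'
    using block_map_unitary[of h] h by (auto simp: g_def heavy_embedding_eq_block_map)
  have sc: "h c x y \<in> scalar_set (heavy_factors X ! c)" if "c < length (heavy_factors X)" for c x y
    using h[OF that] by (simp add: irreducible_heavy_iff finite_mat_iff)
  have "supported_on (basis_of X) g"
    by (auto simp: supported_on_def g_def heavy_embedding_def)
  then have fin: "finite_mat (scalars_of X) (basis_of X) g"
    using g by (simp add: finite_mat_iff)
  have inv: "g \<in> invertible_mats (scalars_of X) (basis_of X)"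
    using fin g finite_mat_adjoint[OF fin] by (auto simp: invertible_mats_def)
  have rf: "row_finite g" "row_finite (mat_adjoint g)"
    using g(1) by (auto intro: fin_supported_row_finite fin_supported_adjoint)
  note sesq = preserves_sesquilinear_commuting[OF rf g(3)]
  have herm: "preserves_sesquilinear hermitian_form g"
  proof (intro sesq diagonal_commute rf)
    fix b b'
    have "hermitian_sign b = hermitian_sign b'" if "g b b' \<noteq> 0"
      using that by (auto simp: g_def heavy_embedding_def mat_one_def split: if_splits basis_vec.splits)
    moreover have "hermitian_sign b = 1 \<or> hermitian_sign b = - 1"
      by (cases b) auto
    ultimately show "hermitian_form b b * g b b' = g b b' * hermitian_form b' b'"
      by (cases "g b b' = 0") (auto simp: hermitian_form_def)
  qed (simp add: hermitian_form_def)
  have skew: "preserves_sesquilinear skew_hermitian_form g" if "X = SO_star"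
  proof (intro sesq diagonal_commute rf)
    fix b b'
    have "g b b' \<in> scalar_set Complexes_sc"
      using sc[of 0] that
      by (auto simp: g_def heavy_embedding_def mat_one_def split: basis_vec.splits
          simp del: scalar_set.simps)
    then show "skew_hermitian_form b b * g b b' = g b b' * skew_hermitian_form b' b'"
      using complex_scalars_commute[of "quat_of_complex \<i>" "g b b'"]
      by (auto simp: skew_hermitian_form_def)
  qed (simp add: skew_hermitian_form_def)
  have orth: "preserves_bilinear mat_one g" if "X = O_C"
  proof -
    have "g b b' \<in> scalar_set Reals_sc" for b b'
      using sc[of 0] that
      by (auto simp: g_def heavy_embedding_def mat_one_def split: basis_vec.splits
          simp del: scalar_set.simps)
    then have "mat_transpose g = mat_adjoint g"
      using qcnj_real_scalar by (simp add: mat_transpose_def mat_adjoint_def fun_eq_iff)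
    then show ?thesis using g(3) by (simp add: preserves_bilinear_def)
  qed
  have symp: "preserves_bilinear symplectic_form g" if "X = Sp_2inf_R \<or> X = Sp_2inf_C"
    using preserves_symplectic_form[OF that _ g_def g(1,3)] sc[of 0] that by auto
  have "classical_identity X g"
    using herm skew orth symp by (cases X) auto
  then show ?thesis using inv by (simp add: irreducible_classical_def g_def)
qed

lemma straight_hom_heavy:
  assumes S: "is_straight Ls A S" and l: "l \<in> carrier (heavy_group Ls)"
  shows "straight_hom Ls A S l \<in> irreducible_heavy A"
proof -
  interpret block_construction "straight_lab S" "{..<length (blocks S)}"
    "\<lambda>s. block_size (Ls ! fst (blocks S ! s)) A" "\<lambda>s. Ls ! fst (blocks S ! s)" A
    "straight_block Ls A S"
    by (rule straight_block_construction[OF S])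
  have "l (fst (blocks S ! s)) \<in> irreducible_heavy (Ls ! fst (blocks S ! s))"
    if "s \<in> {..<length (blocks S)}" for s
    using l straight_blockD(1)[OF S] that by (auto simp: heavy_group_def)
  then show ?thesis
    using block_map_unitary[of "\<lambda>s. l (fst (blocks S ! s))"]
    by (simp add: straight_hom_eq_block_map[OF S] irreducible_heavy_iff finite_mat_iff
        supported_on_def)
qed

lemma straight_hom_mult:
  assumes S: "is_straight Ls A S"
    and l: "l \<in> carrier (heavy_group Ls)" "l' \<in> carrier (heavy_group Ls)"
  shows "straight_hom Ls A S (\<lambda>j. mat_mult (l j) (l' j)) =
    mat_mult (straight_hom Ls A S l) (straight_hom Ls A S l')"
proof -
  interpret block_construction "straight_lab S" "{..<length (blocks S)}"
    "\<lambda>s. block_size (Ls ! fst (blocks S ! s)) A" "\<lambda>s. Ls ! fst (blocks S ! s)" A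
    "straight_block Ls A S"
    by (rule straight_block_construction[OF S])
  have sc: "f (fst (blocks S ! s)) x y \<in> scalar_set (Ls ! fst (blocks S ! s))"
    if "s \<in> {..<length (blocks S)}" "f \<in> carrier (heavy_group Ls)" for f s x y
    using straight_blockD(1)[OF S, of s] that
    by (auto simp: heavy_group_def irreducible_heavy_iff finite_mat_iff)
  show ?thesis
    unfolding straight_hom_eq_block_map[OF S]
    using sc l by (intro block_map_mult heavy_group_fin_supported[OF l(1)]) auto
qed

lemma heavy_embedding_mult:
  assumes "\<And>c. c < length (heavy_factors X) \<Longrightarrow> h c \<in> irreducible_heavy (heavy_factors X ! c)"
    and "\<And>c. c < length (heavy_factors X) \<Longrightarrow> h' c \<in> irreducible_heavy (heavy_factors X ! c)"
  shows "heavy_embedding X (\<lambda>c. mat_mult (h c) (h' c)) =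
    mat_mult (heavy_embedding X h) (heavy_embedding X h')"
proof -
  interpret block_construction "heavy_lab X" "{..<length (heavy_factors X)}"
    "\<lambda>c. block_size (heavy_factors X ! c) (scalars_of X)" "\<lambda>c. heavy_factors X ! c" "scalars_of X"
    "\<lambda>c. block_entry (heavy_factors X ! c) (scalars_of X)"
    by (rule heavy_block_construction)
  show ?thesis
    unfolding heavy_embedding_eq_block_map
    by (intro block_map_mult) (use assms in \<open>auto simp: irreducible_heavy_iff finite_mat_iff\<close>)
qed


section \<open>Finite permutations\<close>

definition fin_perm :: "('a \<Rightarrow> 'a) \<Rightarrow> bool" where
  "fin_perm f \<longleftrightarrow> bij f \<and> finite {x. f x \<noteq> x}"

abbreviation (input) pinv :: "('a \<Rightarrow> 'a) \<Rightarrow> 'a \<Rightarrow> 'a" where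
  "pinv f \<equiv> inv_into UNIV f"

lemma fin_perm_id: "fin_perm (\<lambda>x. x)"
  by (simp add: fin_perm_def bij_def)

lemma fin_perm_comp:
  assumes "fin_perm f" "fin_perm g"
  shows "fin_perm (f \<circ> g)"
proof -
  have "{x. (f \<circ> g) x \<noteq> x} \<subseteq> {x. f x \<noteq> x} \<union> {x. g x \<noteq> x}" by auto
  then have "finite {x. (f \<circ> g) x \<noteq> x}"
    by (rule finite_subset) (use assms in \<open>auto simp: fin_perm_def\<close>)
  then show ?thesis using assms by (auto simp: fin_perm_def intro: bij_comp)
qed

lemma fin_perm_inv:
  assumes "fin_perm f"
  shows "fin_perm (pinv f)"
proof -
  have "pinv f x = x" if "f x = x" for x
    using inv_f_eq[of f x x] that assms by (simp add: fin_perm_def bij_is_inj)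
  then have "{x. pinv f x \<noteq> x} \<subseteq> {x. f x \<noteq> x}" by auto
  then have "finite {x. pinv f x \<noteq> x}"
    by (rule finite_subset) (use assms in \<open>simp add: fin_perm_def\<close>)
  then show ?thesis using assms by (simp add: fin_perm_def bij_imp_bij_inv)
qed

lemma fin_perm_inv_simps [simp]:
  assumes "fin_perm f"
  shows "f (pinv f x) = x" "pinv f (f x) = x" "f \<circ> pinv f = id" "pinv f \<circ> f = id"
  using assms by (auto simp: fin_perm_def bij_is_inj bij_is_surj surj_f_inv_f fun_eq_iff)

lemma fin_perm_inj: "fin_perm f \<Longrightarrow> f x = f y \<longleftrightarrow> x = y"
  by (metis fin_perm_inv_simps(2))

text \<open>One more value is corrected by a transposition, which does not disturb the values corrected
  before.\<close>

lemma extend_to_fin_perm: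
  assumes "finite A" "inj_on f A"
  obtains p where "fin_perm p" "\<And>x. x \<in> A \<Longrightarrow> p x = f x"
proof -
  have "\<exists>p. fin_perm p \<and> (\<forall>x\<in>A. p x = f x)"
    using assms
  proof (induction A)
    case (insert a A)
    then obtain p where p: "fin_perm p" "\<forall>x\<in>A. p x = f x" by auto
    let ?t = "Transposition.transpose (f a) (p a)"
    have "{x. ?t x \<noteq> x} \<subseteq> {f a, p a}" by (auto simp: Transposition.transpose_def)
    then have "fin_perm ?t"
      unfolding fin_perm_def by (auto simp: finite_subset)
    moreover have "(?t \<circ> p) x = f x" if "x \<in> insert a A" for x
    proof (cases "x = a")
      case False
      then have "x \<in> A" using that by simp
      have "f x \<noteq> f a"
        using inj_onD[OF insert.prems, of x a] False that by auto
      moreover have "p x \<noteq> p a"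
        using False p(1) by (simp add: fin_perm_inj)
      ultimately show ?thesis using p(2) \<open>x \<in> A\<close> by (simp add: Transposition.transpose_def)
    qed simp
    ultimately show ?case using p(1) fin_perm_comp by blast
  qed (use fin_perm_id in auto)
  then show ?thesis using that by blast
qed

definition lift_perm :: "('a \<Rightarrow> 'b) \<Rightarrow> ('a \<Rightarrow> 'a) \<Rightarrow> 'b \<Rightarrow> 'b" where
  "lift_perm w f x = (if x \<in> range w then w (f (inv_into UNIV w x)) else x)"

lemma lift_perm_simps [simp]:
  assumes "inj w"
  shows "lift_perm w f (w i) = w (f i)" "x \<notin> range w \<Longrightarrow> lift_perm w f x = x"
  using assms by (auto simp: lift_perm_def)

lemma lift_perm_comp: "inj w \<Longrightarrow> lift_perm w f \<circ> lift_perm w g = lift_perm w (f \<circ> g)"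
  by (auto simp: fun_eq_iff lift_perm_def)

lemma fin_perm_lift_perm:
  assumes w: "inj w" and f: "fin_perm f"
  shows "fin_perm (lift_perm w f)"
proof -
  have id: "lift_perm w id = id"
    using w by (auto simp: fun_eq_iff lift_perm_def)
  have "bij (lift_perm w f)"
    by (rule o_bij[of "lift_perm w (pinv f)"]) (use w f id in \<open>simp_all add: lift_perm_comp\<close>)
  moreover have "{x. lift_perm w f x \<noteq> x} \<subseteq> w ` {i. f i \<noteq> i}"
    using w by (auto simp: lift_perm_def)
  then have "finite {x. lift_perm w f x \<noteq> x}"
    by (rule finite_subset) (use f in \<open>simp add: fin_perm_def\<close>)
  ultimately show ?thesis by (simp add: fin_perm_def)
qed

text \<open>The permutation of the indices of the \<open>\<Omega>\<close>-vectors that defines \<open>\<Theta>\<close>.\<close>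

definition nat_swap :: "nat \<Rightarrow> nat \<Rightarrow> nat" where
  "nat_swap m i = (if i < m then i + m else if i < 2 * m then i - m else i)"

lemma nat_swap_swap [simp]: "nat_swap m (nat_swap m i) = i"
  by (auto simp: nat_swap_def)

lemma fin_perm_nat_swap: "fin_perm (nat_swap m)"
proof -
  have "bij (nat_swap m)"
    by (rule o_bij[of "nat_swap m"]) (auto simp: fun_eq_iff)
  moreover have "{i. nat_swap m i \<noteq> i} \<subseteq> {..<2 * m}" by (auto simp: nat_swap_def)
  ultimately show ?thesis by (auto simp: fin_perm_def intro: finite_subset)
qed

lemma block_swap_eq:
  assumes "inj w"
  shows "block_swap w m = lift_perm w (nat_swap m)"
proof
  fix x
  show "block_swap w m x = lift_perm w (nat_swap m) x"
  proof (cases "x \<in> range w")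
    case True
    then obtain i where "x = w i" by blast
    then show ?thesis
      using assms by (auto simp: block_swap_def nat_swap_def inj_image_mem_iff)
  qed (auto simp: block_swap_def lift_perm_def)
qed


section \<open>Permutation matrices and stabilizers in heavy groups\<close>

definition perm_mat :: "('i \<Rightarrow> 'i) \<Rightarrow> 'i hmat" where
  "perm_mat f x y = (if x = f y then 1 else 0)"

lemma perm_mat_id: "perm_mat id = mat_one" "perm_mat (\<lambda>x. x) = mat_one"
  by (auto simp: perm_mat_def mat_one_def fun_eq_iff)

lemma fin_supported_perm_mat:
  assumes "fin_perm f"
  shows "fin_supported (perm_mat f)"
proof -
  have "supported_on {x. f x \<noteq> x} (perm_mat f)"
    unfolding supported_on_def
  proof (intro allI impI)
    fix x y assume "x \<notin> {x. f x \<noteq> x} \<or> y \<notin> {x. f x \<noteq> x}"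
    then have "x = f y \<longleftrightarrow> x = y"
      using fin_perm_inj[OF assms, of x y] by auto
    then show "perm_mat f x y = mat_one x y" by (simp add: perm_mat_def mat_one_def)
  qed
  then show ?thesis using assms by (auto simp: fin_supported_def fin_perm_def)
qed

lemma mat_mult_perm_mat_left:
  assumes "inj f"
  shows "mat_mult (perm_mat f) g (f x) y = g x y"
proof -
  have "mat_mult (perm_mat f) g (f x) y = perm_mat f (f x) x * g x y"
    by (rule mat_mult_single) (use assms in \<open>auto simp: perm_mat_def dest: injD\<close>)
  then show ?thesis by (simp add: perm_mat_def)
qed

lemma mat_mult_perm_mat_right:
  assumes "row_finite g"
  shows "mat_mult g (perm_mat f) x y = g x (f y)"
proof -
  have "mat_mult g (perm_mat f) x y = g x (f y) * perm_mat f (f y) y"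
    by (rule mat_mult_single_right) (use assms in \<open>auto simp: perm_mat_def row_finite_def\<close>)
  then show ?thesis by (simp add: perm_mat_def)
qed

lemma perm_mat_mult:
  assumes "row_finite (perm_mat f)"
  shows "mat_mult (perm_mat f) (perm_mat g) = perm_mat (f \<circ> g)"
  using assms by (simp add: fun_eq_iff mat_mult_perm_mat_right) (simp add: perm_mat_def)

lemma row_finite_perm_mat: "fin_perm f \<Longrightarrow> row_finite (perm_mat f)"
  by (intro fin_supported_row_finite fin_supported_perm_mat)

lemma perm_mat_irreducible_heavy:
  assumes "fin_perm f"
  shows "perm_mat f \<in> irreducible_heavy F"
proof -
  have "mat_adjoint (perm_mat f) = perm_mat (pinv f)"
    using assms by (auto simp: mat_adjoint_def perm_mat_def fun_eq_iff)
  then show ?thesis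
    using assms fin_supported_perm_mat[OF assms]
    by (auto simp: irreducible_heavy_iff finite_mat_iff supported_on_def perm_mat_mult fin_perm_inv
        row_finite_perm_mat perm_mat_id) (auto simp: perm_mat_def)
qed

definition perm_elem :: "scalars list \<Rightarrow> (nat \<Rightarrow> nat \<Rightarrow> nat) \<Rightarrow> nat \<Rightarrow> nat hmat" where
  "perm_elem Ls s j = (if j < length Ls then perm_mat (s j) else mat_one)"

definition fin_perms :: "scalars list \<Rightarrow> (nat \<Rightarrow> nat \<Rightarrow> nat) \<Rightarrow> bool" where
  "fin_perms Ls s \<longleftrightarrow> (\<forall>j<length Ls. fin_perm (s j))"

lemma perm_elem_carrier: "fin_perms Ls s \<Longrightarrow> perm_elem Ls s \<in> carrier (heavy_group Ls)"
  by (auto simp: heavy_group_def perm_elem_def fin_perms_def perm_mat_irreducible_heavy)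

lemma perm_elem_mult:
  "fin_perms Ls s \<Longrightarrow>
    perm_elem Ls s \<otimes>\<^bsub>heavy_group Ls\<^esub> perm_elem Ls t = perm_elem Ls (\<lambda>j. s j \<circ> t j)"
  by (auto simp: perm_elem_def fin_perms_def perm_mat_mult row_finite_perm_mat fun_eq_iff)

lemma perm_elem_id:
  "(\<And>j x. j < length Ls \<Longrightarrow> s j x = x) \<Longrightarrow> perm_elem Ls s = \<one>\<^bsub>heavy_group Ls\<^esub>"
  by (auto simp: perm_elem_def perm_mat_def mat_one_def fun_eq_iff)

lemma fin_perms_inv: "fin_perms Ls s \<Longrightarrow> fin_perms Ls (\<lambda>j. pinv (s j))"
  by (simp add: fin_perms_def fin_perm_inv)

lemma perm_elem_inv:
  assumes "fin_perms Ls s"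
  shows "inv\<^bsub>heavy_group Ls\<^esub> (perm_elem Ls s) = perm_elem Ls (\<lambda>j. pinv (s j))"
proof (rule group.inv_equality[OF group_heavy_group])
  show "perm_elem Ls (\<lambda>j. pinv (s j)) \<otimes>\<^bsub>heavy_group Ls\<^esub> perm_elem Ls s = \<one>\<^bsub>heavy_group Ls\<^esub>"
    unfolding perm_elem_mult[OF fin_perms_inv[OF assms]]
    by (rule perm_elem_id) (use assms in \<open>simp add: fin_perms_def\<close>)
qed (use assms in \<open>auto intro: perm_elem_carrier fin_perms_inv\<close>)

lemma perm_elem_stabilizer:
  assumes "fin_perms Ls s" "\<And>j x. j < length Ls \<Longrightarrow> x \<in> Y j \<Longrightarrow> s j x = x"
  shows "perm_elem Ls s \<in> stabilizer Ls Y"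
  using assms perm_elem_carrier[OF assms(1)]
  by (auto simp: stabilizer_def perm_elem_def perm_mat_def mat_one_def)

lemma stabilizer_carrier: "l \<in> stabilizer Ls Y \<Longrightarrow> l \<in> carrier (heavy_group Ls)"
  by (simp add: stabilizer_def)

lemma stabilizer_antimono:
  assumes "\<And>j. j < length Ls \<Longrightarrow> Y j \<subseteq> Z j"
  shows "stabilizer Ls Z \<subseteq> stabilizer Ls Y"
  using assms by (fastforce simp: stabilizer_def)

lemma stabilizer_column:
  "l \<in> stabilizer Ls Y \<Longrightarrow> j < length Ls \<Longrightarrow> x \<in> Y j \<Longrightarrow> l j y x = mat_one y x"
  by (simp add: stabilizer_def)

text \<open>A unitary matrix that fixes a basis vector also preserves its orthogonal complement.\<close>

lemma stabilizer_row:
  assumes "l \<in> stabilizer Ls Y" "j < length Ls" "x \<in> Y j"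
  shows "l j x y = mat_one x y"
proof -
  have l: "l j \<in> irreducible_heavy (Ls ! j)"
    using assms by (auto simp: stabilizer_def heavy_group_def)
  have "row_finite (mat_adjoint (l j))"
    using l by (auto simp: irreducible_heavy_iff finite_mat_iff fin_supported_adjoint
        intro: fin_supported_row_finite)
  then have "mat_mult (mat_adjoint (l j)) (l j) y x = mat_adjoint (l j) y x"
    using assms by (intro mat_mult_trivial_column) (auto simp: row_finite_def stabilizer_column)
  then have "qcnj (l j x y) = mat_one y x"
    using l by (simp add: irreducible_heavy_iff mat_adjoint_def)
  then show ?thesis
    by (metis mat_one_def qcnj_0 qcnj_1 qcnj_qcnj)
qed

lemma subgroup_stabilizer: "subgroup (stabilizer Ls Y) (heavy_group Ls)"
proof -
  interpret L: group "heavy_group Ls" by (rule group_heavy_group)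
  have rf: "row_finite (l j)" if "l \<in> carrier (heavy_group Ls)" for l j
    using that by (intro fin_supported_row_finite heavy_group_fin_supported)
  have col: "mat_mult (k j) (l j) y x = k j y x"
    if "l \<in> stabilizer Ls Y" "k \<in> carrier (heavy_group Ls)" "j < length Ls" "x \<in> Y j" for k l j x y
    using that rf[OF that(2), of j]
    by (intro mat_mult_trivial_column) (auto simp: row_finite_def stabilizer_column)
  show ?thesis
  proof (rule L.subgroupI)
    show "stabilizer Ls Y \<subseteq> carrier (heavy_group Ls)" by (auto simp: stabilizer_def)
    have "\<one>\<^bsub>heavy_group Ls\<^esub> \<in> stabilizer Ls Y"
      using L.one_closed by (auto simp: stabilizer_def)
    then show "stabilizer Ls Y \<noteq> {}" by blast
  next
    fix l assume l: "l \<in> stabilizer Ls Y"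
    then have inv: "inv\<^bsub>heavy_group Ls\<^esub> l \<in> carrier (heavy_group Ls)"
      by (simp add: stabilizer_carrier)
    have "(inv\<^bsub>heavy_group Ls\<^esub> l) j y x = mat_one y x" if "j < length Ls" "x \<in> Y j" for j x y
    proof -
      have "mat_mult ((inv\<^bsub>heavy_group Ls\<^esub> l) j) (l j) = mat_one"
        using fun_cong[OF L.l_inv[OF stabilizer_carrier[OF l]], of j] by simp
      then show ?thesis using col[OF l inv that] by simp
    qed
    then show "inv\<^bsub>heavy_group Ls\<^esub> l \<in> stabilizer Ls Y"
      using inv by (simp add: stabilizer_def)
  next
    fix l l' assume l: "l \<in> stabilizer Ls Y" "l' \<in> stabilizer Ls Y"
    then show "l \<otimes>\<^bsub>heavy_group Ls\<^esub> l' \<in> stabilizer Ls Y"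
      using col[OF l(2) stabilizer_carrier[OF l(1)]] L.m_closed[OF l[THEN stabilizer_carrier]]
      by (auto simp: stabilizer_def)
  qed
qed

text \<open>Stated with an inclusion because the set of vectors that has to be fixed is usually
  smaller than the set that is known to be fixed.\<close>

lemma conjugate_stabilizer:
  assumes "l \<in> stabilizer Ls Y" "fin_perms Ls s" "\<And>j. j < length Ls \<Longrightarrow> Z j \<subseteq> s j ` Y j"
  shows "perm_elem Ls s \<otimes>\<^bsub>heavy_group Ls\<^esub> l \<otimes>\<^bsub>heavy_group Ls\<^esub> inv\<^bsub>heavy_group Ls\<^esub> (perm_elem Ls s)
     \<in> stabilizer Ls Z"
proof -
  interpret L: group "heavy_group Ls" by (rule group_heavy_group)
  note l = stabilizer_carrier[OF assms(1)] and s = perm_elem_carrier[OF assms(2)]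
  let ?c = "perm_elem Ls s \<otimes>\<^bsub>heavy_group Ls\<^esub> l \<otimes>\<^bsub>heavy_group Ls\<^esub> inv\<^bsub>heavy_group Ls\<^esub> (perm_elem Ls s)"
  have "?c \<in> carrier (heavy_group Ls)"
    using l s by (intro L.m_closed L.inv_closed)
  moreover have "?c j y x = mat_one y x" if "j < length Ls" "x \<in> Z j" for j x y
  proof -
    have s: "fin_perm (s j)" using assms(2) that by (simp add: fin_perms_def)
    obtain z where z: "z \<in> Y j" "x = s j z" using assms(3) \<open>j < length Ls\<close> \<open>x \<in> Z j\<close> by blast
    have rf: "row_finite (mat_mult (perm_mat (s j)) (l j))"
      by (intro fin_supported_row_finite fin_supported_mult fin_supported_perm_mat s
          heavy_group_fin_supported[OF l])
    have "?c j y x = mat_mult (perm_mat (s j)) (l j) y z"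
      using that s rf by (simp add: perm_elem_inv[OF assms(2)] perm_elem_def mat_mult_perm_mat_right z)
    also have "\<dots> = mat_mult (perm_mat (s j)) (l j) (s j (pinv (s j) y)) z"
      using s by simp
    also have "\<dots> = l j (pinv (s j) y) z"
      by (rule mat_mult_perm_mat_left) (use s in \<open>simp add: fin_perm_def bij_is_inj\<close>)
    also have "\<dots> = mat_one y x"
      using s that z assms(1) by (auto simp: stabilizer_column mat_one_def)
    finally show ?thesis .
  qed
  ultimately show ?thesis by (simp add: stabilizer_def)
qed

lemma theta_eq_perm_elem: "theta Ls \<omega> m = perm_elem Ls (\<lambda>j. block_swap (\<omega> j) (m j))"
  by (auto simp: theta_def perm_elem_def perm_mat_def fun_eq_iff)


section \<open>The embedded heavy group\<close>

locale gl_pair =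
  fixes Gs :: "classical list" and Ls :: "scalars list" and S :: "nat \<Rightarrow> nat \<Rightarrow> straight_data"
  assumes pair: "GL_pair Gs Ls S"
begin

abbreviation "G \<equiv> classical_group Gs"
abbreviation "L \<equiv> heavy_group Ls"
abbreviation "E \<equiv> straight_embedding Gs Ls S"
abbreviation G_mult (infixl "\<cdot>" 70) where "g \<cdot> h \<equiv> g \<otimes>\<^bsub>G\<^esub> h"
abbreviation L_mult (infixl "\<star>" 70) where "l \<star> l' \<equiv> l \<otimes>\<^bsub>L\<^esub> l'"

sublocale G: monoid G by (rule monoid_classical_group)
sublocale L: group L by (rule group_heavy_group)

lemma straight:
  "k < length Gs \<Longrightarrow> c < length (heavy_factors (Gs ! k)) \<Longrightarrow>
    is_straight Ls (heavy_factors (Gs ! k) ! c) (S k c)"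
  using pair by (simp add: GL_pair_def)

lemma E_closed:
  assumes "l \<in> carrier L"
  shows "E l \<in> carrier G"
  using assms straight straight_hom_heavy
  by (auto simp: classical_group_def straight_embedding_def intro!: heavy_embedding_classical)

lemma E_mult:
  assumes "l \<in> carrier L" "l' \<in> carrier L"
  shows "E (l \<star> l') = E l \<cdot> E l'"
proof
  fix k
  show "E (l \<star> l') k = (E l \<cdot> E l') k"
  proof (cases "k < length Gs")
    case True
    let ?h = "\<lambda>l c. straight_hom Ls (heavy_factors (Gs ! k) ! c) (S k c) l"
    have "heavy_embedding (Gs ! k) (?h (\<lambda>j. mat_mult (l j) (l' j))) =
      heavy_embedding (Gs ! k) (\<lambda>c. mat_mult (?h l c) (?h l' c))"
      using straight_hom_mult[OF straight[OF True] assms]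
      by (auto simp: heavy_embedding_def fun_eq_iff split: basis_vec.splits)
    then show ?thesis
      using True straight_hom_heavy[OF straight[OF True]] assms
      by (simp add: straight_embedding_def heavy_embedding_mult)
  qed (simp add: straight_embedding_def)
qed

text \<open>The pair \<open>(j, x)\<close> is the basis vector of the \<open>\<ell>\<^sub>2\<close> of \<open>L\<^sub>j\<close> of which \<open>b\<close> is a copy. Without origin are
  the vectors fixed by \<open>L\<close>, and the indices outside the basis, where all matrices are continued
  by the identity.\<close>

definition origin :: "nat \<Rightarrow> basis_vec \<Rightarrow> (nat \<times> nat) option" where
  "origin k b =
     (if k < length Gs \<and> b \<in> basis_of (Gs ! k) then
        (case b of
           Main c n r \<Rightarrow>
             (case labelling (S k c) n of
                Copy s x d \<Rightarrow> Some (fst (blocks (S k c) ! s), x)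
              | Fixed i \<Rightarrow> None)
         | Extra i \<Rightarrow> None)
      else None)"

lemma labelling_inj:
  assumes "k < length Gs" "c < length (heavy_factors (Gs ! k))"
  shows "labelling (S k c) n = labelling (S k c) n' \<longleftrightarrow> n = n'"
  using straight[OF assms] by (auto simp: is_straight_def bij_betw_def dest: injD)

lemma labelling_Copy:
  assumes "k < length Gs" "c < length (heavy_factors (Gs ! k))" "labelling (S k c) n = Copy s x d"
  shows "s < length (blocks (S k c))" "fst (blocks (S k c) ! s) < length Ls"
    "Copy s y d \<in> range (labelling (S k c))"
proof -
  have st: "is_straight Ls (heavy_factors (Gs ! k) ! c) (S k c)" by (rule straight[OF assms(1,2)])
  then have range: "range (labelling (S k c)) = label_set Ls (heavy_factors (Gs ! k) ! c) (S k c)"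
    by (simp add: is_straight_def bij_betw_def)
  have "Copy s x d \<in> range (labelling (S k c))" using assms(3) by (metis rangeI)
  then show "s < length (blocks (S k c))" "Copy s y d \<in> range (labelling (S k c))"
    unfolding range by (auto simp: label_set_def)
  then show "fst (blocks (S k c) ! s) < length Ls"
    using straight_blockD(1)[OF st] by simp
qed

lemma origin_less: "origin k b = Some (j, x) \<Longrightarrow> j < length Ls"
  by (auto simp: origin_def labelling_Copy split: basis_vec.splits label.splits if_splits)

text \<open>Both embeddings are block maps, so a basis vector is fixed by \<open>E l\<close> as soon as \<open>l\<close> fixes its origin.
  This is how stabilizers in \<open>L\<close> are seen inside \<open>G\<close>.\<close>

lemma E_trivial:
  assumes "l \<in> stabilizer Ls Y" "\<And>j x. origin k b = Some (j, x) \<Longrightarrow> x \<in> Y j"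
  shows "E l k b b' = mat_one b b'" "E l k b' b = mat_one b' b"
proof -
  have "E l k b b' = mat_one b b' \<and> E l k b' b = mat_one b' b"
  proof (cases "k < length Gs")
    case k: True
    let ?h = "\<lambda>c. straight_hom Ls (heavy_factors (Gs ! k) ! c) (S k c) l"
    interpret H: block_construction "heavy_lab (Gs ! k)" "{..<length (heavy_factors (Gs ! k))}"
      "\<lambda>c. block_size (heavy_factors (Gs ! k) ! c) (scalars_of (Gs ! k))"
      "\<lambda>c. heavy_factors (Gs ! k) ! c" "scalars_of (Gs ! k)"
      "\<lambda>c. block_entry (heavy_factors (Gs ! k) ! c) (scalars_of (Gs ! k))"
      by (rule heavy_block_construction)
    have h: "?h c n n' = mat_one n n' \<and> ?h c n' n = mat_one n' n"
      if "heavy_lab (Gs ! k) b = Some (c, n, r)" for c n r n'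
    proof -
      have b: "b = Main c n r" "b \<in> basis_of (Gs ! k)" using that by auto
      then have c: "c < length (heavy_factors (Gs ! k))" by simp
      note st = straight[OF k c]
      interpret T: block_construction "straight_lab (S k c)" "{..<length (blocks (S k c))}"
        "\<lambda>s. block_size (Ls ! fst (blocks (S k c) ! s)) (heavy_factors (Gs ! k) ! c)"
        "\<lambda>s. Ls ! fst (blocks (S k c) ! s)" "heavy_factors (Gs ! k) ! c"
        "straight_block Ls (heavy_factors (Gs ! k) ! c) (S k c)"
        by (rule straight_block_construction[OF st])
      have "l (fst (blocks (S k c) ! s)) x y = mat_one x y \<and>
          l (fst (blocks (S k c) ! s)) y x = mat_one y x"
        if "straight_lab (S k c) n = Some (s, x, d)" for s x d y
      proof -
        have lab: "labelling (S k c) n = Copy s x d" using that by simp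
        then have "origin k b = Some (fst (blocks (S k c) ! s), x)"
          using k b by (simp add: origin_def)
        then have "x \<in> Y (fst (blocks (S k c) ! s))" by (rule assms(2))
        then show ?thesis
          using labelling_Copy(2)[OF k c lab] assms(1) by (simp add: stabilizer_row stabilizer_column)
      qed
      then show ?thesis
        unfolding straight_hom_eq_block_map[OF st]
        using T.block_map_trivial_row[of n "\<lambda>s. l (fst (blocks (S k c) ! s))" n']
          T.block_map_trivial_column[of n "\<lambda>s. l (fst (blocks (S k c) ! s))" n']
        by blast
    qed
    show ?thesis
      unfolding straight_embedding_def heavy_embedding_eq_block_map
      using k h H.block_map_trivial_row[of b ?h b'] H.block_map_trivial_column[of b ?h b']
      by (simp del: heavy_lab_eq_Some)
  qed (simp add: straight_embedding_def)
  then show "E l k b b' = mat_one b b'" "E l k b' b = mat_one b' b" by auto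
qed

lemma E_one: "E \<one>\<^bsub>L\<^esub> = \<one>\<^bsub>G\<^esub>"
proof (intro ext)
  fix k b b'
  have "\<one>\<^bsub>L\<^esub> \<in> stabilizer Ls (\<lambda>_. UNIV)"
    by (rule subgroup.one_closed[OF subgroup_stabilizer])
  then show "E \<one>\<^bsub>L\<^esub> k b b' = \<one>\<^bsub>G\<^esub> k b b'"
    by (subst E_trivial(1)) auto
qed

definition shift_index :: "(nat \<Rightarrow> nat \<Rightarrow> nat) \<Rightarrow> nat \<Rightarrow> nat \<Rightarrow> nat \<Rightarrow> nat" where
  "shift_index f k c n =
     (case labelling (S k c) n of
        Copy s x d \<Rightarrow> inv_into UNIV (labelling (S k c)) (Copy s (f (fst (blocks (S k c) ! s)) x) d)
      | Fixed i \<Rightarrow> n)"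

lemma relabel_eq:
  "relabel S f k (Main c n r) = Main c (shift_index f k c n) r" "relabel S f k (Extra i) = Extra i"
  by (auto simp: relabel_def shift_index_def split: label.splits)

lemma labelling_shift_index:
  assumes "k < length Gs" "c < length (heavy_factors (Gs ! k))"
  shows "labelling (S k c) (shift_index f k c n) =
    (case labelling (S k c) n of
       Copy s x d \<Rightarrow> Copy s (f (fst (blocks (S k c) ! s)) x) d
     | Fixed i \<Rightarrow> Fixed i)"
  using labelling_Copy(3)[OF assms] by (auto simp: shift_index_def f_inv_into_f split: label.splits)

lemma relabel_in_basis [simp]: "relabel S f k b \<in> basis_of X \<longleftrightarrow> b \<in> basis_of X"
  by (cases b) (simp_all add: relabel_eq)

lemma relabel_inj:
  assumes k: "k < length Gs" and f: "\<And>j. j < length Ls \<Longrightarrow> inj (f j)"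
    and b: "b \<in> basis_of (Gs ! k)" "b' \<in> basis_of (Gs ! k)"
  shows "relabel S f k b = relabel S f k b' \<longleftrightarrow> b = b'"
proof
  assume eq: "relabel S f k b = relabel S f k b'"
  show "b = b'"
  proof (cases b)
    case (Main c n r)
    then obtain n' where b': "b' = Main c n' r" and sh: "shift_index f k c n = shift_index f k c n'"
      using eq by (cases b') (auto simp: relabel_eq)
    have c: "c < length (heavy_factors (Gs ! k))" using b Main by simp
    have "labelling (S k c) (shift_index f k c n) = labelling (S k c) (shift_index f k c n')"
      using sh by simp
    moreover have "x = y" if "labelling (S k c) n = Copy s x d"
      "f (fst (blocks (S k c) ! s)) x = f (fst (blocks (S k c) ! s)) y" for s x y d
      using injD[OF f[OF labelling_Copy(2)[OF k c that(1)]] that(2)] .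
    ultimately have "labelling (S k c) n = labelling (S k c) n'"
      unfolding labelling_shift_index[OF k c] by (auto split: label.splits)
    then show ?thesis using labelling_inj[OF k c] Main b' by simp
  next
    case (Extra i)
    then show ?thesis using eq by (cases b') (auto simp: relabel_eq)
  qed
qed simp

lemma origin_relabel:
  "origin k (relabel S f k b) = map_option (\<lambda>(j, x). (j, f j x)) (origin k b)"
proof (cases "k < length Gs \<and> b \<in> basis_of (Gs ! k)")
  case True
  show ?thesis
  proof (cases b)
    case (Main c n r)
    then have "c < length (heavy_factors (Gs ! k))" using True by simp
    then show ?thesis
      using True Main by (auto simp: relabel_eq origin_def labelling_shift_index split: label.splits)
  qed (use True in \<open>simp add: relabel_eq origin_def\<close>)
qed (auto simp: origin_def)

lemma relabel_cong:
  assumes "k < length Gs" "b \<in> basis_of (Gs ! k)"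
    and "\<And>j x. origin k b = Some (j, x) \<Longrightarrow> f j x = g j x"
  shows "relabel S f k b = relabel S g k b"
  using assms
  by (cases b) (auto simp: relabel_eq shift_index_def origin_def split: label.splits)

text \<open>The relabelling, made into a map of all indices by the identity outside the basis; the embedded
  permutation matrices permute all indices in this way.\<close>

definition shift :: "(nat \<Rightarrow> nat \<Rightarrow> nat) \<Rightarrow> nat \<Rightarrow> basis_vec \<Rightarrow> basis_vec" where
  "shift f k b = (if k < length Gs \<and> b \<in> basis_of (Gs ! k) then relabel S f k b else b)"

lemma E_perm_elem:
  assumes f: "fin_perms Ls f"
  shows "E (perm_elem Ls f) k = perm_mat (shift f k)"
proof (cases "k < length Gs")
  case k: True
  let ?h = "\<lambda>c. straight_hom Ls (heavy_factors (Gs ! k) ! c) (S k c) (perm_elem Ls f)"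
  interpret H: block_construction "heavy_lab (Gs ! k)" "{..<length (heavy_factors (Gs ! k))}"
    "\<lambda>c. block_size (heavy_factors (Gs ! k) ! c) (scalars_of (Gs ! k))"
    "\<lambda>c. heavy_factors (Gs ! k) ! c" "scalars_of (Gs ! k)"
    "\<lambda>c. block_entry (heavy_factors (Gs ! k) ! c) (scalars_of (Gs ! k))"
    by (rule heavy_block_construction)
  have h: "?h c n n' = (if n = shift_index f k c n' then 1 else 0)"
    if "c \<in> {..<length (heavy_factors (Gs ! k))}" for c n n'
  proof -
    have c: "c < length (heavy_factors (Gs ! k))" using that by simp
    note st = straight[OF k c]
    interpret T: block_construction "straight_lab (S k c)" "{..<length (blocks (S k c))}"
      "\<lambda>s. block_size (Ls ! fst (blocks (S k c) ! s)) (heavy_factors (Gs ! k) ! c)"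
      "\<lambda>s. Ls ! fst (blocks (S k c) ! s)" "heavy_factors (Gs ! k) ! c"
      "straight_block Ls (heavy_factors (Gs ! k) ! c) (S k c)"
      by (rule straight_block_construction[OF st])
    show ?thesis
      unfolding straight_hom_eq_block_map[OF st]
    proof (rule T.block_map_permutation[where p = "\<lambda>s. f (fst (blocks (S k c) ! s))"])
      show "perm_elem Ls f (fst (blocks (S k c) ! s)) x y =
          (if x = f (fst (blocks (S k c) ! s)) y then 1 else 0)"
        if "s \<in> {..<length (blocks (S k c))}" for s x y
        using that straight_blockD(1)[OF st] by (simp add: perm_elem_def perm_mat_def)
      show "straight_lab (S k c) (shift_index f k c n) = Some (s, f (fst (blocks (S k c) ! s)) x, r)"
        if "straight_lab (S k c) n = Some (s, x, r)" for n s x r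
        using that by (simp add: labelling_shift_index[OF k c])
      show "shift_index f k c n = n" if "straight_lab (S k c) n = None" for n
        using that by (auto simp: straight_lab_def shift_index_def split: label.splits)
    qed
  qed
  show ?thesis
  proof (intro ext)
    fix b b'
    have "heavy_embedding (Gs ! k) ?h b b' = (if b = shift f k b' then 1 else 0)"
      unfolding heavy_embedding_eq_block_map
    proof (rule H.block_map_permutation[OF h])
      show "heavy_lab (Gs ! k) (shift f k b) = Some (c, shift_index f k c n, r)"
        if "heavy_lab (Gs ! k) b = Some (c, n, r)" for b c n r
        using that k by (auto simp: shift_def relabel_eq)
      show "shift f k b = b" if "heavy_lab (Gs ! k) b = None" for b
        using that k by (auto simp: shift_def heavy_lab_def relabel_eq split: if_splits basis_vec.splits)
    qed
    then show "E (perm_elem Ls f) k b b' = perm_mat (shift f k) b b'"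
      using k by (simp add: straight_embedding_def perm_mat_def)
  qed
next
  case False
  then have "shift f k = id" by (auto simp: shift_def)
  then show ?thesis using False by (simp add: straight_embedding_def perm_mat_id)
qed

lemma finite_support:
  assumes "g \<in> carrier G"
  obtains B where "\<And>k. finite (B k)" "\<And>k. supported_on (B k) (g k)"
    "\<And>k. k < length Gs \<Longrightarrow> B k \<subseteq> basis_of (Gs ! k)"
proof -
  obtain T where T: "\<And>k. finite (T k) \<and> supported_on (T k) (g k)"
    using classical_group_fin_supported[OF assms] unfolding fin_supported_def by metis
  have "supported_on (T k \<inter> basis_of (Gs ! k)) (g k)" if "k < length Gs" for k
    using T[of k] classical_group_supported_on[OF assms that] unfolding supported_on_def by blast
  then show ?thesis
    using T by (intro that[of "\<lambda>k. if k < length Gs then T k \<inter> basis_of (Gs ! k) else T k"]) auto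
qed

end


section \<open>The splitting and the elements that realize it\<close>

locale mantle_data = gl_pair Gs Ls S
  for Gs :: "classical list" and Ls :: "scalars list" and S :: "nat \<Rightarrow> nat \<Rightarrow> straight_data" +
  fixes \<Xi> :: "nat \<Rightarrow> nat set" and \<tau> \<omega> :: "nat \<Rightarrow> nat \<Rightarrow> nat"
  assumes splitting: "is_splitting (length Ls) \<Xi> \<tau> \<omega>"
begin

abbreviation "stab \<equiv> stabilizer Ls"
abbreviation "K \<equiv> stab \<Xi>"
abbreviation "\<theta> \<equiv> theta Ls \<omega>"
abbreviation "i\<^sub>\<tau> \<equiv> i_tau Gs S \<tau>"
abbreviation "C \<equiv> stabilizer_coset Gs Ls S \<Xi>"

lemma splittingD:
  assumes "j < length Ls"
  shows "inj (\<tau> j)" "range (\<tau> j) = \<Xi> j" "inj (\<omega> j)" "range (\<omega> j) = - \<Xi> j"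
  using splitting assms by (auto simp: is_splitting_def bij_betw_def)

text \<open>The elements of \<open>L\<^sup>\<Xi>\<close> that act on the \<open>\<Omega>\<close>-vectors of index at least \<open>N\<close> only. For large \<open>N\<close> they
  commute with a given element of \<open>G\<close>, and lie in a given neighbourhood of the identity of \<open>L\<close>.\<close>

definition K_fixing :: "nat \<Rightarrow> (nat \<Rightarrow> nat hmat) set" where
  "K_fixing N = stab (\<lambda>j. \<Xi> j \<union> \<omega> j ` {..<N})"

lemma K_fixing_subset: "K_fixing N \<subseteq> K"
  unfolding K_fixing_def by (rule stabilizer_antimono) simp

lemma K_fixing_antimono: "M \<le> N \<Longrightarrow> K_fixing N \<subseteq> K_fixing M"
  unfolding K_fixing_def by (rule stabilizer_antimono) auto

lemma stab_carrier: "l \<in> stab Y \<Longrightarrow> l \<in> carrier L"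
  by (rule stabilizer_carrier)

lemma stab_Un: "l \<in> stab Y \<Longrightarrow> l \<in> stab Z \<Longrightarrow> l \<in> stab (\<lambda>j. Y j \<union> Z j)"
  by (auto simp: stabilizer_def)

text \<open>Here the finiteness of the matrices in \<open>L\<close> enters.\<close>

lemma fixes_tail:
  assumes "l \<in> carrier L"
  obtains M where "l \<in> stab (\<lambda>j. \<omega> j ` {M..})"
proof -
  obtain T where T: "\<And>j. finite (T j) \<and> supported_on (T j) (l j)"
    using heavy_group_fin_supported[OF assms] unfolding fin_supported_def by metis
  have "finite (\<omega> j -` T j)" if "j < length Ls" for j
    using T splittingD(3)[OF that] by (intro finite_vimageI) auto
  then have "finite (\<Union>j<length Ls. \<omega> j -` T j)" by simp
  then obtain M where M: "\<forall>i\<in>(\<Union>j<length Ls. \<omega> j -` T j). i < M"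
    using finite_nat_set_iff_bounded by blast
  have "l j y (\<omega> j i) = mat_one y (\<omega> j i)" if "j < length Ls" "M \<le> i" for j y i
  proof -
    have "\<omega> j i \<notin> T j" using M that by (auto dest: leD)
    then show ?thesis using T[of j] by (simp add: supported_on_def)
  qed
  then have "l \<in> stab (\<lambda>j. \<omega> j ` {M..})"
    using assms by (auto simp: stabilizer_def)
  then show ?thesis by (rule that)
qed

lemma initial_segment_covered:
  obtains N where "\<And>j. j < length Ls \<Longrightarrow> {..<n} \<subseteq> \<tau> j ` {..<N} \<union> \<omega> j ` {..<N}"
proof -
  let ?I = "\<Union>j<length Ls. \<tau> j -` {..<n} \<union> \<omega> j -` {..<n}"
  have "finite ?I"
    using splittingD by (auto intro!: finite_vimageI)
  then obtain N where N: "\<forall>i\<in>?I. i < N"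
    using finite_nat_set_iff_bounded by blast
  have "{..<n} \<subseteq> \<tau> j ` {..<N} \<union> \<omega> j ` {..<N}" if "j < length Ls" for j
  proof
    fix x assume "x \<in> {..<n}"
    moreover have "x \<in> range (\<tau> j) \<union> range (\<omega> j)"
      using splittingD(2,4)[OF that] by simp
    ultimately show "x \<in> \<tau> j ` {..<N} \<union> \<omega> j ` {..<N}"
      using N that by blast
  qed
  then show ?thesis by (rule that)
qed

lemma K_fixing_subset_initial:
  obtains N where "K_fixing N \<subseteq> stab (\<lambda>_. {..<n})"
proof -
  obtain N where "\<And>j. j < length Ls \<Longrightarrow> {..<n} \<subseteq> \<tau> j ` {..<N} \<union> \<omega> j ` {..<N}"
    using initial_segment_covered by blast
  then have "K_fixing N \<subseteq> stab (\<lambda>_. {..<n})"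
    unfolding K_fixing_def using splittingD(2) by (intro stabilizer_antimono) blast
  then show ?thesis by (rule that)
qed

subsection \<open>The involutions\<close>

lemma theta_perm:
  "\<theta> m = perm_elem Ls (\<lambda>j. lift_perm (\<omega> j) (nat_swap (m j)))"
  "fin_perms Ls (\<lambda>j. lift_perm (\<omega> j) (nat_swap (m j)))"
  by (auto simp: theta_eq_perm_elem perm_elem_def fun_eq_iff splittingD(3) block_swap_eq
      fin_perms_def fin_perm_lift_perm fin_perm_nat_swap)

lemma theta_K: "\<theta> m \<in> K"
  unfolding theta_perm(1)
proof (rule perm_elem_stabilizer[OF theta_perm(2)])
  fix j x assume "j < length Ls" "x \<in> \<Xi> j"
  then have "x \<notin> range (\<omega> j)" using splittingD(4) by auto
  then show "lift_perm (\<omega> j) (nat_swap (m j)) x = x" by (simp add: lift_perm_def)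
qed

lemma theta_carrier: "\<theta> m \<in> carrier L"
  using theta_K by (rule stab_carrier)

lemma theta_theta: "\<theta> m \<star> \<theta> m = \<one>\<^bsub>L\<^esub>"
  unfolding theta_perm(1) perm_elem_mult[OF theta_perm(2)]
  by (rule perm_elem_id) (auto simp: lift_perm_def splittingD(3))

lemma inv_theta: "inv\<^bsub>L\<^esub> (\<theta> m) = \<theta> m"
  by (rule L.inv_equality[OF theta_theta theta_carrier theta_carrier])

lemma theta_conj_stab:
  assumes "l \<in> stab Y"
    and "\<And>j. j < length Ls \<Longrightarrow> Z j \<subseteq> lift_perm (\<omega> j) (nat_swap (m j)) ` Y j"
  shows "\<theta> m \<star> l \<star> \<theta> m \<in> stab Z"
  using conjugate_stabilizer[OF assms(1) theta_perm(2) assms(2)] inv_theta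
  by (simp flip: theta_perm(1))

lemma theta_moves_away:
  assumes "N \<le> m j" "M \<le> m j" "j < length Ls"
  shows "\<omega> j ` {..<N} \<subseteq> lift_perm (\<omega> j) (nat_swap (m j)) ` (\<omega> j ` {M..})"
proof
  fix x assume "x \<in> \<omega> j ` {..<N}"
  then obtain i where i: "x = \<omega> j i" "i < N" by blast
  then have "x = lift_perm (\<omega> j) (nat_swap (m j)) (\<omega> j (i + m j))"
    using assms splittingD(3) by (simp add: nat_swap_def)
  then show "x \<in> lift_perm (\<omega> j) (nat_swap (m j)) ` (\<omega> j ` {M..})"
    using assms by auto
qed

lemma theta_fixes_Xi:
  assumes "Z \<subseteq> \<Xi> j" "j < length Ls"
  shows "Z \<subseteq> lift_perm (\<omega> j) (nat_swap (m j)) ` Z"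
proof
  fix x assume x: "x \<in> Z"
  then have "x \<notin> range (\<omega> j)" using splittingD(4) assms by auto
  then have "x = lift_perm (\<omega> j) (nat_swap (m j)) x" by (simp add: lift_perm_def)
  then show "x \<in> lift_perm (\<omega> j) (nat_swap (m j)) ` Z" using x by blast
qed

text \<open>Conjugation with \<open>\<theta> m\<close> exchanges the first \<open>m\<close> vectors in \<open>\<Omega>\<close> with the next \<open>m\<close>. If \<open>l\<close> acts on
  the former only, then the result fixes them.\<close>

lemma theta_conj_K:
  assumes "l \<in> K"
  obtains M where "\<And>m. (\<And>j. j < length Ls \<Longrightarrow> M \<le> m j) \<Longrightarrow> \<theta> m \<star> l \<star> \<theta> m \<in> K_fixing N"
proof -
  obtain M where "l \<in> stab (\<lambda>j. \<omega> j ` {M..})"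
    using fixes_tail[OF stab_carrier[OF assms]] .
  then have l: "l \<in> stab (\<lambda>j. \<Xi> j \<union> \<omega> j ` {M..})"
    by (rule stab_Un[OF assms])
  have "\<theta> m \<star> l \<star> \<theta> m \<in> K_fixing N"
    if "\<And>j. j < length Ls \<Longrightarrow> max M N \<le> m j" for m
    unfolding K_fixing_def
  proof (rule theta_conj_stab[OF l])
    fix j assume j: "j < length Ls"
    show "\<Xi> j \<union> \<omega> j ` {..<N} \<subseteq>
        lift_perm (\<omega> j) (nat_swap (m j)) ` (\<Xi> j \<union> \<omega> j ` {M..})"
      unfolding image_Un
      using theta_moves_away[of N m j M] theta_fixes_Xi[of "\<Xi> j" j m] that[OF j] j
      by (intro Un_mono) auto
  qed
  then show ?thesis by (rule that)
qed

text \<open>Both \<open>\<theta> m\<close> and \<open>\<theta> m'\<close> move the first \<open>N\<close> vectors of \<open>\<Omega>\<close> to vectors of index at least \<open>N\<close>.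
  A permutation \<open>f\<close> that fixes the first \<open>N\<close> indices and carries the images under the one to the
  images under the other conjugates the difference into a permutation that fixes the first \<open>N\<close>
  indices as well.\<close>

lemma theta_change_index:
  assumes "\<And>j. j < length Ls \<Longrightarrow> N \<le> m j \<and> N \<le> m' j"
  obtains p q where "p \<in> K_fixing N" "q \<in> K_fixing N" "\<theta> m' = p \<star> \<theta> m \<star> q"
proof -
  have "\<exists>f. fin_perm f \<and> (\<forall>i<N. f i = i \<and> f (m j + i) = m' j + i)" if "j < length Ls" for j
  proof -
    let ?A = "{..<N} \<union> {m j..<m j + N}" and ?f = "\<lambda>i. if i < N then i else i - m j + m' j"
    have "inj_on ?f ?A"
      using assms[OF that] by (auto simp: inj_on_def split: if_splits)
    then obtain f where "fin_perm f" "\<And>x. x \<in> ?A \<Longrightarrow> f x = ?f x"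
      using extend_to_fin_perm[of ?A ?f] by auto
    then show ?thesis
      using assms[OF that] by (intro exI[of _ f]) auto
  qed
  then obtain f where f: "\<And>j. j < length Ls \<Longrightarrow> fin_perm (f j)"
    "\<And>j i. j < length Ls \<Longrightarrow> i < N \<Longrightarrow> f j i = i \<and> f j (m j + i) = m' j + i"
    by metis
  define P where "P j = lift_perm (\<omega> j) (f j)" for j
  define Q where "Q j = lift_perm (\<omega> j) (nat_swap (m j) \<circ> pinv (f j) \<circ> nat_swap (m' j))" for j
  have PQ: "fin_perms Ls P" "fin_perms Ls Q"
    using f(1) splittingD(3)
    by (auto simp: fin_perms_def P_def Q_def intro!: fin_perm_lift_perm fin_perm_comp fin_perm_inv
        fin_perm_nat_swap)
  have "P j x = x \<and> Q j x = x" if "j < length Ls" "x \<in> \<Xi> j \<union> \<omega> j ` {..<N}" for j x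
    using that(2)
  proof
    assume "x \<in> \<Xi> j"
    then have "x \<notin> range (\<omega> j)" using splittingD(4)[OF that(1)] by auto
    then show ?thesis by (simp add: P_def Q_def lift_perm_def)
  next
    assume "x \<in> \<omega> j ` {..<N}"
    then obtain i where i: "x = \<omega> j i" "i < N" by blast
    have "pinv (f j) (m' j + i) = m j + i"
      using f[OF that(1)] i(2) by (metis fin_perm_inv_simps(2))
    then have "nat_swap (m j) (pinv (f j) (nat_swap (m' j) i)) = i"
      using assms[OF that(1)] i(2) by (simp add: nat_swap_def add.commute)
    then show ?thesis
      using splittingD(3)[OF that(1)] f(2)[OF that(1)] i by (simp add: P_def Q_def)
  qed
  then have mem: "perm_elem Ls P \<in> K_fixing N" "perm_elem Ls Q \<in> K_fixing N"
    unfolding K_fixing_def using PQ by (auto intro!: perm_elem_stabilizer)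
  let ?s = "\<lambda>m j. lift_perm (\<omega> j) (nat_swap (m j))"
  have "perm_elem Ls P \<star> \<theta> m \<star> perm_elem Ls Q = perm_elem Ls (\<lambda>j. P j \<circ> ?s m j \<circ> Q j)"
  proof -
    have "fin_perms Ls (\<lambda>j. P j \<circ> ?s m j)"
      using PQ(1) theta_perm(2)[of m] by (auto simp: fin_perms_def intro: fin_perm_comp)
    then show ?thesis
      unfolding theta_perm(1) by (simp only: perm_elem_mult[OF PQ(1)] perm_elem_mult)
  qed
  also have "\<dots> = \<theta> m'"
  proof -
    have "P j (?s m j (Q j x)) = ?s m' j x" if "j < length Ls" for j x
    proof (cases "x \<in> range (\<omega> j)")
      case True
      then show ?thesis
        using f(1)[OF that] splittingD(3)[OF that] by (auto simp: P_def Q_def)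
    qed (simp add: P_def Q_def lift_perm_def)
    then show ?thesis
      by (auto simp: theta_perm(1) perm_elem_def perm_mat_def fun_eq_iff)
  qed
  finally show ?thesis using that mem by metis
qed

subsection \<open>Finite permutations approximating the relabelling\<close>

lemma exists_sigma: "\<exists>f. fin_perms Ls f \<and> (\<forall>j<length Ls. \<forall>x<n. f j x = \<tau> j x)"
proof -
  have "\<exists>f. fin_perm f \<and> (\<forall>x<n. f x = \<tau> j x)" if "j < length Ls" for j
  proof -
    have "inj_on (\<tau> j) {..<n}" using splittingD(1)[OF that] by (rule inj_on_subset) simp
    then show ?thesis by (metis extend_to_fin_perm finite_lessThan lessThan_iff)
  qed
  then show ?thesis unfolding fin_perms_def by metis
qed

text \<open>These permutations converge pointwise to \<open>\<tau>\<close>, which is not surjective; so the limit lies outside \<open>L\<close>.\<close>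

definition \<sigma> :: "nat \<Rightarrow> nat \<Rightarrow> nat \<Rightarrow> nat" where
  "\<sigma> n = (SOME f. fin_perms Ls f \<and> (\<forall>j<length Ls. \<forall>x<n. f j x = \<tau> j x))"

lemma sigma: "fin_perms Ls (\<sigma> n)" "j < length Ls \<Longrightarrow> x < n \<Longrightarrow> \<sigma> n j x = \<tau> j x"
  using someI_ex[OF exists_sigma[of n], folded \<sigma>_def] by auto

definition s :: "nat \<Rightarrow> nat \<Rightarrow> nat hmat" where
  "s n = perm_elem Ls (\<sigma> n)"

lemma s_carrier: "s n \<in> carrier L"
  unfolding s_def by (rule perm_elem_carrier[OF sigma(1)])

lemma sigma_fin_perm: "j < length Ls \<Longrightarrow> fin_perm (\<sigma> n j)"
  using sigma(1) by (simp add: fin_perms_def)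

lemma inv_s: "inv\<^bsub>L\<^esub> (s n) = perm_elem Ls (\<lambda>j. pinv (\<sigma> n j))"
  unfolding s_def by (rule perm_elem_inv[OF sigma(1)])

text \<open>The next three lemmas measure how far \<open>s n\<close> has converged: \<open>s n\<close> and \<open>s m\<close> agree on the first
  vectors, their inverses agree on the images of these, and \<open>\<Xi>\<close> contains those images.\<close>

lemma inv_s_s_stab:
  assumes "N \<le> n" "N \<le> m"
  shows "inv\<^bsub>L\<^esub> (s n) \<star> s m \<in> stab (\<lambda>_. {..<N})"
proof -
  have "perm_elem Ls (\<lambda>j. pinv (\<sigma> n j) \<circ> \<sigma> m j) \<in> stab (\<lambda>_. {..<N})"
  proof (rule perm_elem_stabilizer)
    show "fin_perms Ls (\<lambda>j. pinv (\<sigma> n j) \<circ> \<sigma> m j)"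
      unfolding fin_perms_def by (auto intro: fin_perm_comp fin_perm_inv sigma_fin_perm)
    fix j x assume *: "j < length Ls" "x \<in> {..<N}"
    then have "\<sigma> m j x = \<sigma> n j x" using assms by (simp add: sigma(2))
    then show "(pinv (\<sigma> n j) \<circ> \<sigma> m j) x = x"
      using sigma_fin_perm[OF *(1)] by simp
  qed
  then show ?thesis
    unfolding inv_s unfolding s_def by (simp only: perm_elem_mult[OF fin_perms_inv[OF sigma(1)]])
qed

lemma s_inv_s_stab:
  assumes "N \<le> n" "N \<le> m"
  shows "s n \<star> inv\<^bsub>L\<^esub> (s m) \<in> stab (\<lambda>j. \<tau> j ` {..<N})"
proof -
  have "perm_elem Ls (\<lambda>j. \<sigma> n j \<circ> pinv (\<sigma> m j)) \<in> stab (\<lambda>j. \<tau> j ` {..<N})"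
  proof (rule perm_elem_stabilizer)
    show "fin_perms Ls (\<lambda>j. \<sigma> n j \<circ> pinv (\<sigma> m j))"
      unfolding fin_perms_def by (auto intro: fin_perm_comp fin_perm_inv sigma_fin_perm)
    fix j x assume *: "j < length Ls" "x \<in> \<tau> j ` {..<N}"
    then obtain y where y: "x = \<tau> j y" "y < N" by blast
    then have "x = \<sigma> m j y" "x = \<sigma> n j y" using assms * by (auto simp: sigma(2))
    then show "(\<sigma> n j \<circ> pinv (\<sigma> m j)) x = x"
      using sigma_fin_perm[OF *(1), of m] by simp
  qed
  then show ?thesis
    unfolding inv_s unfolding s_def by (simp only: perm_elem_mult[OF sigma(1)])
qed

lemma conj_K_stab:
  assumes "l \<in> K"
  shows "inv\<^bsub>L\<^esub> (s n) \<star> l \<star> s n \<in> stab (\<lambda>_. {..<n})"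
proof -
  have "perm_elem Ls (\<lambda>j. pinv (\<sigma> n j)) \<star> l \<star> inv\<^bsub>L\<^esub> (perm_elem Ls (\<lambda>j. pinv (\<sigma> n j)))
      \<in> stab (\<lambda>_. {..<n})"
  proof (rule conjugate_stabilizer[OF assms fin_perms_inv[OF sigma(1)]])
    fix j assume j: "j < length Ls"
    show "{..<n} \<subseteq> pinv (\<sigma> n j) ` \<Xi> j"
    proof
      fix x assume "x \<in> {..<n}"
      then have "x = pinv (\<sigma> n j) (\<tau> j x)"
        using sigma(2)[OF j, of x n, symmetric] sigma_fin_perm[OF j] by simp
      then show "x \<in> pinv (\<sigma> n j) ` \<Xi> j"
        using splittingD(2)[OF j] by blast
    qed
  qed
  then show ?thesis
    using s_carrier by (simp flip: inv_s)
qed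

text \<open>The finitely many \<open>\<Omega>\<close>-vectors on which \<open>l\<close> acts can be moved arbitrarily far by conjugation
  with some \<open>\<theta> m\<close>. So \<open>N\<close> only has to account for the \<open>\<Xi>\<close>-vectors below \<open>n\<close>, and can be chosen
  independently of \<open>l\<close>.\<close>

lemma conj_into_neighbourhood:
  obtains N where "\<And>l. l \<in> stab (\<lambda>j. \<tau> j ` {..<N}) \<Longrightarrow>
    \<exists>m. \<theta> m \<star> l \<star> \<theta> m \<in> stab (\<lambda>_. {..<n})"
proof -
  obtain N where N: "\<And>j. j < length Ls \<Longrightarrow> {..<n} \<subseteq> \<tau> j ` {..<N} \<union> \<omega> j ` {..<N}"
    using initial_segment_covered by blast
  have "\<exists>m. \<theta> m \<star> l \<star> \<theta> m \<in> stab (\<lambda>_. {..<n})" if "l \<in> stab (\<lambda>j. \<tau> j ` {..<N})" for l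
  proof -
    note l0 = that
    obtain M where "l \<in> stab (\<lambda>j. \<omega> j ` {M..})"
      using fixes_tail[OF stab_carrier[OF l0]] .
    then have l: "l \<in> stab (\<lambda>j. \<tau> j ` {..<N} \<union> \<omega> j ` {M..})"
      by (rule stab_Un[OF l0])
    have "\<theta> (\<lambda>_. max M N) \<star> l \<star> \<theta> (\<lambda>_. max M N) \<in> stab (\<lambda>_. {..<n})"
    proof (rule theta_conj_stab[OF l])
      fix j assume j: "j < length Ls"
      have "\<tau> j ` {..<N} \<subseteq> \<Xi> j" using splittingD(2)[OF j] by blast
      then have "\<tau> j ` {..<N} \<union> \<omega> j ` {..<N} \<subseteq>
        lift_perm (\<omega> j) (nat_swap (max M N)) ` (\<tau> j ` {..<N} \<union> \<omega> j ` {M..})"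
        unfolding image_Un[of "lift_perm (\<omega> j) (nat_swap (max M N))"]
        using theta_moves_away[of N "\<lambda>_. max M N" j M]
          theta_fixes_Xi[of "\<tau> j ` {..<N}" j "\<lambda>_. max M N"] j
        by (intro Un_mono) auto
      with N[OF j]
      show "{..<n} \<subseteq> lift_perm (\<omega> j) (nat_swap (max M N)) ` (\<tau> j ` {..<N} \<union> \<omega> j ` {M..})"
        by (rule order_trans)
    qed
    then show ?thesis by blast
  qed
  then show ?thesis by (rule that)
qed


section \<open>The relabelled group\<close>

lemma G_row_finite: "g \<in> carrier G \<Longrightarrow> row_finite (g k)"
  by (intro fin_supported_row_finite classical_group_fin_supported)

lemma relabel_tau_inj:
  assumes "k < length Gs"
  shows "inj_on (relabel S \<tau> k) (basis_of (Gs ! k))"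
  using relabel_inj[OF assms] splittingD(1) by (auto intro: inj_onI)

lemma i_tau_relabel:
  assumes "k < length Gs" "b \<in> basis_of (Gs ! k)" "b' \<in> basis_of (Gs ! k)"
  shows "i\<^sub>\<tau> g k (relabel S \<tau> k b) (relabel S \<tau> k b') = g k b b'"
  using assms by (simp add: i_tau_def inv_into_f_f[OF relabel_tau_inj])

lemma i_tau_outside:
  assumes "\<not> k < length Gs \<or> b \<notin> relabel S \<tau> k ` basis_of (Gs ! k) \<or>
    b' \<notin> relabel S \<tau> k ` basis_of (Gs ! k)"
  shows "i\<^sub>\<tau> g k b b' = mat_one b b'"
  using assms by (auto simp: i_tau_def)

lemma supported_on_i_tau:
  assumes k: "k < length Gs" and B: "supported_on B (g k)"
  shows "supported_on (relabel S \<tau> k ` B) (i\<^sub>\<tau> g k)"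
  unfolding supported_on_def
proof (intro allI impI)
  fix b b' assume *: "b \<notin> relabel S \<tau> k ` B \<or> b' \<notin> relabel S \<tau> k ` B"
  show "i\<^sub>\<tau> g k b b' = mat_one b b'"
  proof (cases "b \<in> relabel S \<tau> k ` basis_of (Gs ! k) \<and> b' \<in> relabel S \<tau> k ` basis_of (Gs ! k)")
    case True
    then obtain c c' where c: "c \<in> basis_of (Gs ! k)" "c' \<in> basis_of (Gs ! k)"
      "b = relabel S \<tau> k c" "b' = relabel S \<tau> k c'" by blast
    then have "g k c c' = mat_one c c'"
      using * B by (auto simp: supported_on_def)
    then show ?thesis
      using relabel_inj[OF k splittingD(1) c(1,2)] c k by (simp add: i_tau_relabel mat_one_def)
  qed (auto intro: i_tau_outside)
qed

lemma i_tau_row_finite: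
  assumes "g \<in> carrier G"
  shows "row_finite (i\<^sub>\<tau> g k)"
proof (cases "k < length Gs")
  case True
  obtain B where "\<And>k. finite (B k)" "\<And>k. supported_on (B k) (g k)"
    by (rule finite_support[OF assms]) blast
  then have "fin_supported (i\<^sub>\<tau> g k)"
    unfolding fin_supported_def
    by (intro exI[of _ "relabel S \<tau> k ` B k"]) (simp add: supported_on_i_tau[OF True])
  then show ?thesis by (rule fin_supported_row_finite)
next
  case False
  then have "i\<^sub>\<tau> g k = mat_one" by (intro ext i_tau_outside) simp
  then show ?thesis by simp
qed

text \<open>The embedded permutation matrix has an embedded permutation matrix as its inverse, and both are
  matrices of the shifts.\<close>

lemma shift_bij:
  assumes f: "fin_perms Ls f"
  shows "bij (shift f k)"
proof -
  let ?f' = "\<lambda>j. pinv (f j)"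
  note f' = fin_perms_inv[OF f]
  have comp: "shift g k \<circ> shift h k = id"
    if "fin_perms Ls g" "fin_perms Ls h" "\<And>j x. j < length Ls \<Longrightarrow> g j (h j x) = x" for g h
  proof -
    have "E (perm_elem Ls g) \<cdot> E (perm_elem Ls h) = \<one>\<^bsub>G\<^esub>"
      using that perm_elem_carrier
      by (simp only: E_mult[symmetric] perm_elem_mult) (simp add: perm_elem_id E_one[simplified])
    then have "mat_mult (perm_mat (shift g k)) (perm_mat (shift h k)) = mat_one"
      by (simp add: E_perm_elem that fun_eq_iff)
    moreover have "row_finite (perm_mat (shift g k))"
      using G_row_finite[OF E_closed[OF perm_elem_carrier[OF that(1)]], of k]
      by (simp add: E_perm_elem[OF that(1)])
    ultimately have "perm_mat (shift g k \<circ> shift h k) = mat_one"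
      by (simp add: perm_mat_mult)
    then have "x = (shift g k \<circ> shift h k) x" for x
      by (metis mat_one_same perm_mat_def zero_neq_one)
    then show ?thesis by auto
  qed
  show ?thesis
    by (rule o_bij[of "shift ?f' k"]) (use f f' in \<open>auto simp: fin_perms_def intro!: comp\<close>)
qed

text \<open>Only the values of the relabelling on the finite support of \<open>g\<close> enter into \<open>i\<^sub>\<tau> g\<close>.\<close>

lemma i_tau_perm_elem:
  assumes g: "g \<in> carrier G"
  obtains N where "\<And>f. fin_perms Ls f \<Longrightarrow> (\<And>j x. j < length Ls \<Longrightarrow> x < N \<Longrightarrow> f j x = \<tau> j x) \<Longrightarrow>
    E (perm_elem Ls f) \<cdot> g = i\<^sub>\<tau> g \<cdot> E (perm_elem Ls f)"
proof -
  obtain B where B: "\<And>k. finite (B k)" "\<And>k. supported_on (B k) (g k)"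
    "\<And>k. k < length Gs \<Longrightarrow> B k \<subseteq> basis_of (Gs ! k)"
    by (rule finite_support[OF g]) blast
  let ?I = "\<Union>k<length Gs. \<Union>b\<in>B k. {x. \<exists>j. origin k b = Some (j, x)}"
  have "finite {x. \<exists>j. origin k b = Some (j, x)}" for k b
    by (rule finite_subset[of _ "{snd (the (origin k b))}"]) auto
  then have "finite ?I" using B(1) by auto
  then obtain N where N: "\<forall>x\<in>?I. x < N"
    using finite_nat_set_iff_bounded by blast
  have "E (perm_elem Ls f) \<cdot> g = i\<^sub>\<tau> g \<cdot> E (perm_elem Ls f)"
    if f: "fin_perms Ls f" and f\<tau>: "\<And>j x. j < length Ls \<Longrightarrow> x < N \<Longrightarrow> f j x = \<tau> j x" for f
  proof
    fix k
    let ?\<psi> = "shift f k" and ?t = "relabel S \<tau> k"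
    have inj: "inj ?\<psi>" using shift_bij[OF f] by (rule bij_is_inj)
    have eq: "i\<^sub>\<tau> g k (?\<psi> a) (?\<psi> b) = g k a b" for a b
    proof (cases "k < length Gs")
      case k: True
      have agree: "?\<psi> c = ?t c" if "c \<in> B k" for c
      proof -
        have "c \<in> basis_of (Gs ! k)" using B(3)[OF k] that by blast
        moreover have "x < N" if "origin k c = Some (j, x)" for j x
          using N k \<open>c \<in> B k\<close> that by blast
        ultimately show ?thesis
          using f\<tau> origin_less k by (auto simp: shift_def intro!: relabel_cong)
      qed
      show ?thesis
      proof (cases "a \<in> B k \<and> b \<in> B k")
        case True
        then show ?thesis
          using subsetD[OF B(3)[OF k]] k by (simp add: agree i_tau_relabel)
      next
        case False
        have "c \<in> B k" if "?\<psi> c \<in> ?t ` B k" for c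
        proof -
          from that obtain c' where "c' \<in> B k" "?\<psi> c = ?\<psi> c'"
            by (auto simp: agree)
          then show ?thesis using injD[OF inj] by blast
        qed
        then have "i\<^sub>\<tau> g k (?\<psi> a) (?\<psi> b) = mat_one (?\<psi> a) (?\<psi> b)"
          using supported_on_i_tau[where k = k and B = "B k" and g = g] k B(2)[of k] False
          unfolding supported_on_def by blast
        also have "\<dots> = mat_one a b"
          using inj by (simp add: mat_one_def inj_eq)
        also have "\<dots> = g k a b"
          using False B(2)[of k] by (auto simp: supported_on_def)
        finally show ?thesis .
      qed
    next
      case False
      then show ?thesis
        using g inj by (simp add: i_tau_outside classical_group_def mat_one_def inj_eq)
    qed
    have "mat_mult (perm_mat ?\<psi>) (g k) b b' = mat_mult (i\<^sub>\<tau> g k) (perm_mat ?\<psi>) b b'" for b b'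
    proof -
      obtain a where "b = ?\<psi> a" using shift_bij[OF f] by (metis bij_pointE)
      then show ?thesis
        by (simp add: mat_mult_perm_mat_left[OF inj]
            mat_mult_perm_mat_right[OF i_tau_row_finite[OF g]] eq)
    qed
    then show "(E (perm_elem Ls f) \<cdot> g) k = (i\<^sub>\<tau> g \<cdot> E (perm_elem Ls f)) k"
      by (simp add: E_perm_elem[OF f] fun_eq_iff)
  qed
  then show ?thesis by (rule that)
qed

lemma E_inv:
  assumes "l \<in> carrier L"
  shows "E l \<cdot> E (inv\<^bsub>L\<^esub> l) = \<one>\<^bsub>G\<^esub>" "E (inv\<^bsub>L\<^esub> l) \<cdot> E l = \<one>\<^bsub>G\<^esub>"
  by (simp_all only: E_mult[symmetric] assms L.inv_closed L.r_inv L.l_inv E_one)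

lemma i_tau_conj:
  assumes g: "g \<in> carrier G"
  shows "\<forall>\<^sub>F n in sequentially. i\<^sub>\<tau> g = E (s n) \<cdot> g \<cdot> E (inv\<^bsub>L\<^esub> (s n))"
proof -
  obtain N where N: "\<And>f. fin_perms Ls f \<Longrightarrow> (\<And>j x. j < length Ls \<Longrightarrow> x < N \<Longrightarrow> f j x = \<tau> j x) \<Longrightarrow>
    E (perm_elem Ls f) \<cdot> g = i\<^sub>\<tau> g \<cdot> E (perm_elem Ls f)"
    using i_tau_perm_elem[OF g] by blast
  show ?thesis
  proof (rule eventually_sequentiallyI[of N])
    fix n assume "N \<le> n"
    then have "E (s n) \<cdot> g = i\<^sub>\<tau> g \<cdot> E (s n)"
      unfolding s_def by (intro N sigma) auto
    moreover have "i\<^sub>\<tau> g \<cdot> E (s n) \<cdot> E (inv\<^bsub>L\<^esub> (s n)) = i\<^sub>\<tau> g \<cdot> (E (s n) \<cdot> E (inv\<^bsub>L\<^esub> (s n)))"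
      by (simp add: mat_mult_assoc i_tau_row_finite[OF g] G_row_finite[OF E_closed[OF s_carrier]])
    moreover have "i\<^sub>\<tau> g \<cdot> \<one>\<^bsub>G\<^esub> = i\<^sub>\<tau> g"
      by (simp add: mat_mult_one_right i_tau_row_finite[OF g])
    ultimately show "i\<^sub>\<tau> g = E (s n) \<cdot> g \<cdot> E (inv\<^bsub>L\<^esub> (s n))"
      by (simp only: E_inv[OF s_carrier])
  qed
qed

lemma Es_closed [simp]: "E (s n) \<in> carrier G" "E (inv\<^bsub>L\<^esub> (s n)) \<in> carrier G"
  by (simp_all add: E_closed s_carrier L.inv_closed)

text \<open>A conjugate of \<open>g\<close> by an element of \<open>G\<close> satisfies the identities of \<open>G\<close>. The conjugating
  element depends on \<open>g\<close>, but for finitely many elements of \<open>G\<close> at once a common \<open>n\<close> can be used,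
  which gives the next lemmas.\<close>

lemma i_tau_closed:
  assumes g: "g \<in> carrier G"
  shows "i\<^sub>\<tau> g \<in> carrier G"
proof -
  obtain n where "i\<^sub>\<tau> g = E (s n) \<cdot> g \<cdot> E (inv\<^bsub>L\<^esub> (s n))"
    using eventually_happens'[OF sequentially_bot i_tau_conj[OF g]] by blast
  then show ?thesis using g by (simp only: G.m_closed Es_closed)
qed

lemma i_tau_s:
  assumes g: "g \<in> carrier G"
  shows "\<forall>\<^sub>F n in sequentially. i\<^sub>\<tau> g \<cdot> E (s n) = E (s n) \<cdot> g"
  using i_tau_conj[OF g]
proof eventually_elim
  case (elim n)
  then show ?case
    using g by (simp only: G.m_assoc G.m_closed Es_closed E_inv[OF s_carrier] G.r_one)
qed

lemma i_tau_mult: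
  assumes g: "g \<in> carrier G" and h: "h \<in> carrier G"
  shows "i\<^sub>\<tau> (g \<cdot> h) = i\<^sub>\<tau> g \<cdot> i\<^sub>\<tau> h"
proof -
  have "\<forall>\<^sub>F n in sequentially. i\<^sub>\<tau> (g \<cdot> h) = i\<^sub>\<tau> g \<cdot> i\<^sub>\<tau> h"
    using i_tau_conj[OF G.m_closed[OF g h]] i_tau_s[OF g] i_tau_conj[OF h]
  proof eventually_elim
    case (elim n)
    have "i\<^sub>\<tau> g \<cdot> i\<^sub>\<tau> h = (i\<^sub>\<tau> g \<cdot> E (s n)) \<cdot> h \<cdot> E (inv\<^bsub>L\<^esub> (s n))"
      using elim(3) i_tau_closed[OF g] h by (simp only: G.m_assoc G.m_closed Es_closed)
    then show ?case
      unfolding elim(1,2) using g h by (simp only: G.m_assoc G.m_closed Es_closed)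
  qed
  then show ?thesis by simp
qed

lemma i_tau_inj:
  assumes g: "g \<in> carrier G" and h: "h \<in> carrier G" and eq: "i\<^sub>\<tau> g = i\<^sub>\<tau> h"
  shows "g = h"
proof -
  have "\<forall>\<^sub>F n in sequentially. g = h"
    using i_tau_s[OF g] i_tau_s[OF h]
  proof eventually_elim
    case (elim n)
    then have "E (s n) \<cdot> g = E (s n) \<cdot> h" by (simp only: eq)
    then have "E (inv\<^bsub>L\<^esub> (s n)) \<cdot> E (s n) \<cdot> g = E (inv\<^bsub>L\<^esub> (s n)) \<cdot> E (s n) \<cdot> h"
      using g h by (simp only: G.m_assoc Es_closed)
    then show "g = h" using g h by (simp only: E_inv[OF s_carrier] G.l_one)
  qed
  then show ?thesis by simp
qed

text \<open>The origins of the relabelled vectors lie in \<open>\<Xi>\<close>.\<close>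

lemma relabelled_fixed_by_K:
  assumes "a \<in> K" "k < length Gs" "b \<in> relabel S \<tau> k ` basis_of (Gs ! k)"
  shows "E a k b b' = mat_one b b'" "E a k b' b = mat_one b' b"
proof -
  have "x \<in> \<Xi> j" if jx: "origin k b = Some (j, x)" for j x
  proof -
    obtain y where "x = \<tau> j y"
      using assms(3) jx by (auto simp: origin_relabel)
    then show ?thesis using splittingD(2)[OF origin_less[OF jx]] by blast
  qed
  then show "E a k b b' = mat_one b b'" "E a k b' b = mat_one b' b"
    using E_trivial[OF assms(1), of k b b'] by blast+
qed

lemma i_tau_commutes_K:
  assumes g: "g \<in> carrier G" and a: "a \<in> K"
  shows "i\<^sub>\<tau> g \<cdot> E a = E a \<cdot> i\<^sub>\<tau> g"
proof
  fix k
  have "mat_mult (i\<^sub>\<tau> g k) (E a k) = mat_mult (E a k) (i\<^sub>\<tau> g k)"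
  proof (rule mat_mult_commute_disjoint)
    fix b
    show "(\<forall>b'. i\<^sub>\<tau> g k b b' = mat_one b b' \<and> i\<^sub>\<tau> g k b' b = mat_one b' b) \<or>
      (\<forall>b'. E a k b b' = mat_one b b' \<and> E a k b' b = mat_one b' b)"
    proof (cases "k < length Gs \<and> b \<in> relabel S \<tau> k ` basis_of (Gs ! k)")
      case True
      then show ?thesis using relabelled_fixed_by_K[OF a] by blast
    next
      case False
      then show ?thesis using i_tau_outside by blast
    qed
  qed (use i_tau_row_finite[OF g] G_row_finite[OF E_closed[OF stab_carrier[OF a]]] in auto)
  then show "(i\<^sub>\<tau> g \<cdot> E a) k = (E a \<cdot> i\<^sub>\<tau> g) k" by simp
qed

text \<open>The relabelled vectors are fixed by \<open>E a\<close> since \<open>a \<in> K\<close>. All others are fixed by \<open>i\<^sub>\<tau> g\<close> and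
  \<open>i\<^sub>\<tau> h\<close>, hence by \<open>E a\<close> as well.\<close>

lemma i_tau_eq_K_mult:
  assumes g: "g \<in> carrier G" and h: "h \<in> carrier G" and a: "a \<in> K"
    and eq: "i\<^sub>\<tau> g = E a \<cdot> i\<^sub>\<tau> h"
  shows "E a = \<one>\<^bsub>G\<^esub>"
proof (intro ext)
  fix k b' b
  show "E a k b' b = \<one>\<^bsub>G\<^esub> k b' b"
  proof (cases "k < length Gs \<and> b \<in> relabel S \<tau> k ` basis_of (Gs ! k)")
    case True
    then show ?thesis using relabelled_fixed_by_K[OF a] by simp
  next
    case False
    then have "i\<^sub>\<tau> g k b' b = mat_one b' b" "\<And>c. i\<^sub>\<tau> h k c b = mat_one c b"
      by (auto intro: i_tau_outside)
    moreover have "mat_mult (E a k) (i\<^sub>\<tau> h k) b' b = E a k b' b"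
      using calculation(2) G_row_finite[OF E_closed[OF stab_carrier[OF a]], of k]
      by (intro mat_mult_trivial_column) (auto simp: row_finite_def)
    ultimately show ?thesis using eq by simp
  qed
qed


section \<open>Double cosets and the product of the mantle\<close>

text \<open>Only finitely many \<open>\<Omega>\<close>-vectors are origins of vectors in the support of \<open>g\<close>.\<close>

lemma commutes_K_fixing:
  assumes g: "g \<in> carrier G"
  obtains N where "\<And>a. a \<in> K_fixing N \<Longrightarrow> E a \<cdot> g = g \<cdot> E a"
proof -
  obtain B where B: "\<And>k. finite (B k)" "\<And>k. supported_on (B k) (g k)"
    by (rule finite_support[OF g]) blast
  let ?I = "\<Union>k<length Gs. \<Union>b\<in>B k. {i. \<exists>j. origin k b = Some (j, \<omega> j i)}"
  have "finite {i. \<exists>j. origin k b = Some (j, \<omega> j i)}" for k b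
  proof (rule finite_subset)
    show "{i. \<exists>j. origin k b = Some (j, \<omega> j i)} \<subseteq>
      (case origin k b of Some (j, x) \<Rightarrow> {inv_into UNIV (\<omega> j) x} | None \<Rightarrow> {})"
    proof
      fix i assume "i \<in> {i. \<exists>j. origin k b = Some (j, \<omega> j i)}"
      then obtain j where j: "origin k b = Some (j, \<omega> j i)" by blast
      then show "i \<in> (case origin k b of Some (j, x) \<Rightarrow> {inv_into UNIV (\<omega> j) x} | None \<Rightarrow> {})"
        using splittingD(3)[OF origin_less[OF j]] by simp
    qed
  qed (auto split: option.splits)
  then have "finite ?I" using B(1) by auto
  then obtain N where N: "\<forall>i\<in>?I. i < N"
    using finite_nat_set_iff_bounded by blast
  have "E a \<cdot> g = g \<cdot> E a" if a: "a \<in> K_fixing N" for a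
  proof
    fix k
    have "mat_mult (E a k) (g k) = mat_mult (g k) (E a k)"
    proof (rule mat_mult_commute_disjoint)
      fix b
      show "(\<forall>b'. E a k b b' = mat_one b b' \<and> E a k b' b = mat_one b' b) \<or>
        (\<forall>b'. g k b b' = mat_one b b' \<and> g k b' b = mat_one b' b)"
      proof (cases "k < length Gs \<and> b \<in> B k")
        case True
        have "x \<in> \<Xi> j \<union> \<omega> j ` {..<N}" if jx: "origin k b = Some (j, x)" for j x
        proof (cases "x \<in> \<Xi> j")
          case False
          then obtain i where i: "x = \<omega> j i"
            using splittingD(4)[OF origin_less[OF jx]] by blast
          then have "i < N" using N True jx by blast
          then show ?thesis using i by blast
        qed simp
        then show ?thesis
          using E_trivial[OF a[unfolded K_fixing_def], of k b] by blast
      next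
        case False
        then have "g k b b' = mat_one b b' \<and> g k b' b = mat_one b' b" for b'
        proof (cases "k < length Gs")
          case True
          then show ?thesis using False B(2)[of k] by (simp add: supported_on_def)
        qed (use g in \<open>simp add: classical_group_def\<close>)
        then show ?thesis by blast
      qed
    qed (use G_row_finite[OF g] G_row_finite[OF E_closed] a K_fixing_def stab_carrier in auto)
    then show "(E a \<cdot> g) k = (g \<cdot> E a) k" by simp
  qed
  then show ?thesis by (rule that)
qed

definition large :: "nat \<Rightarrow> (nat \<Rightarrow> nat) \<Rightarrow> bool" where
  "large M m \<longleftrightarrow> (\<forall>j<length Ls. M \<le> m j)"

lemma large_max: "large (max M N) m \<longleftrightarrow> large M m \<and> large N m"
  by (auto simp: large_def)

lemma subgroup_K: "subgroup K L"
  by (rule subgroup_stabilizer)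

lemma E_K_closed: "a \<in> K \<Longrightarrow> E a \<in> carrier G"
  by (rule E_closed[OF stab_carrier])

lemma E_K_mult: "a \<in> K \<Longrightarrow> b \<in> K \<Longrightarrow> E a \<cdot> E b = E (a \<star> b)"
  by (rule E_mult[symmetric]) (auto intro: stab_carrier)

lemma coset_eq: "C g = {E a \<cdot> g \<cdot> E b | a b. a \<in> K \<and> b \<in> K}"
  unfolding stabilizer_coset_def double_coset_def by blast

lemma coset_memE:
  assumes "h \<in> C g"
  obtains a b where "a \<in> K" "b \<in> K" "h = E a \<cdot> g \<cdot> E b"
  using assms unfolding coset_eq by blast

lemma coset_memI: "a \<in> K \<Longrightarrow> b \<in> K \<Longrightarrow> E a \<cdot> g \<cdot> E b \<in> C g"
  unfolding coset_eq by blast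

lemma coset_self:
  assumes "g \<in> carrier G"
  shows "g \<in> C g"
proof -
  have "E \<one>\<^bsub>L\<^esub> \<cdot> g \<cdot> E \<one>\<^bsub>L\<^esub> \<in> C g"
    by (intro coset_memI subgroup.one_closed[OF subgroup_K])
  then show ?thesis using assms by (simp only: E_one G.l_one G.r_one)
qed

lemma coset_subset:
  assumes g: "g \<in> carrier G" and ab: "a \<in> K" "b \<in> K"
  shows "C (E a \<cdot> g \<cdot> E b) \<subseteq> C g"
proof
  fix h assume "h \<in> C (E a \<cdot> g \<cdot> E b)"
  then obtain c d where cd: "c \<in> K" "d \<in> K"
    "h = E c \<cdot> (E a \<cdot> g \<cdot> E b) \<cdot> E d"
    by (rule coset_memE)
  then have "h = (E c \<cdot> E a) \<cdot> g \<cdot> (E b \<cdot> E d)"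
    using g ab by (simp only: G.m_assoc G.m_closed E_K_closed)
  also have "\<dots> = E (c \<star> a) \<cdot> g \<cdot> E (b \<star> d)"
    using ab cd by (simp only: E_K_mult)
  finally show "h \<in> C g"
    using ab cd by (simp only: coset_memI subgroup.m_closed[OF subgroup_K])
qed

lemma coset_absorb:
  assumes g: "g \<in> carrier G" and ab: "a \<in> K" "b \<in> K"
  shows "C (E a \<cdot> g \<cdot> E b) = C g"
proof (rule antisym[OF coset_subset[OF g ab]])
  let ?h = "E a \<cdot> g \<cdot> E b"
  have h: "?h \<in> carrier G" using g ab by (simp only: G.m_closed E_K_closed)
  have inv: "inv\<^bsub>L\<^esub> a \<in> K" "inv\<^bsub>L\<^esub> b \<in> K"
    using ab by (simp_all only: subgroup.m_inv_closed[OF subgroup_K])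
  have "E (inv\<^bsub>L\<^esub> a) \<cdot> ?h \<cdot> E (inv\<^bsub>L\<^esub> b) =
    (E (inv\<^bsub>L\<^esub> a) \<cdot> E a) \<cdot> g \<cdot> (E b \<cdot> E (inv\<^bsub>L\<^esub> b))"
    using g ab inv by (simp only: G.m_assoc G.m_closed E_K_closed)
  also have "\<dots> = g"
    using g by (simp only: E_inv[OF stab_carrier[OF ab(1)]] E_inv[OF stab_carrier[OF ab(2)]]
        G.l_one G.r_one)
  finally show "C g \<subseteq> C ?h"
    using coset_subset[OF h inv] by simp
qed

text \<open>The factors \<open>p\<close> and \<open>q\<close> by which \<open>\<theta> m\<close> and \<open>\<theta> m'\<close> differ commute with \<open>g\<close> and \<open>h\<close>, and are
  absorbed by the double coset.\<close>

lemma product_change_index: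
  assumes g: "g \<in> carrier G" and h: "h \<in> carrier G"
  obtains M where "\<And>m m'. large M m \<Longrightarrow> large M m' \<Longrightarrow>
    C (g \<cdot> E (\<theta> m) \<cdot> h) = C (g \<cdot> E (\<theta> m') \<cdot> h)"
proof -
  obtain N1 where N1: "\<And>a. a \<in> K_fixing N1 \<Longrightarrow> E a \<cdot> g = g \<cdot> E a"
    by (rule commutes_K_fixing[OF g]) blast
  obtain N2 where N2: "\<And>a. a \<in> K_fixing N2 \<Longrightarrow> E a \<cdot> h = h \<cdot> E a"
    by (rule commutes_K_fixing[OF h]) blast
  define N where "N = max N1 N2"
  have sub: "K_fixing N \<subseteq> K_fixing N1" "K_fixing N \<subseteq> K_fixing N2" "K_fixing N \<subseteq> K"
    by (simp_all add: N_def K_fixing_antimono K_fixing_subset)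
  have "C (g \<cdot> E (\<theta> m) \<cdot> h) = C (g \<cdot> E (\<theta> m') \<cdot> h)"
    if mm: "large N m" "large N m'" for m m'
  proof -
    obtain p q where pq: "p \<in> K_fixing N" "q \<in> K_fixing N" "\<theta> m' = p \<star> \<theta> m \<star> q"
      using theta_change_index[of N m m'] mm unfolding large_def by blast
    have K: "p \<in> K" "q \<in> K" "\<theta> m \<in> K" "p \<star> \<theta> m \<in> K"
      using pq sub theta_K by (auto intro: subgroup.m_closed[OF subgroup_K] simp del: heavy_group_mult)
    have comm: "g \<cdot> E p = E p \<cdot> g" "E q \<cdot> h = h \<cdot> E q"
      using N1[of p] N2[of q] pq sub by auto
    have "g \<cdot> E (\<theta> m') \<cdot> h = g \<cdot> (E p \<cdot> E (\<theta> m) \<cdot> E q) \<cdot> h"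
      using K by (simp only: pq(3) E_K_mult)
    also have "\<dots> = (g \<cdot> E p) \<cdot> E (\<theta> m) \<cdot> (E q \<cdot> h)"
      using g h K by (simp only: G.m_assoc G.m_closed E_K_closed)
    also have "\<dots> = E p \<cdot> (g \<cdot> E (\<theta> m) \<cdot> h) \<cdot> E q"
      unfolding comm using g h K by (simp only: G.m_assoc G.m_closed E_K_closed)
    finally show ?thesis
      using coset_absorb[of "g \<cdot> E (\<theta> m) \<cdot> h" p q] g h K
      by (simp only: G.m_closed E_K_closed)
  qed
  then show ?thesis by (rule that)
qed

text \<open>If \<open>g\<close> is replaced by \<open>g b\<close> and \<open>h\<close> by \<open>c h\<close>, then \<open>\<theta> m\<close> carries \<open>b\<close> across to a factor that
  commutes with \<open>c h\<close>, and \<open>c\<close> to a factor that commutes with \<open>g\<close>.\<close>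

lemma product_change_representatives:
  assumes g: "g \<in> carrier G" and h: "h \<in> carrier G" and "g' \<in> C g" "h' \<in> C h"
  obtains M where "\<And>m. large M m \<Longrightarrow>
    C (g' \<cdot> E (\<theta> m) \<cdot> h') = C (g \<cdot> E (\<theta> m) \<cdot> h)"
proof -
  obtain a b where ab: "a \<in> K" "b \<in> K" and g': "g' = E a \<cdot> g \<cdot> E b"
    using assms(3) by (rule coset_memE)
  obtain c d where cd: "c \<in> K" "d \<in> K" and h': "h' = E c \<cdot> h \<cdot> E d"
    using assms(4) by (rule coset_memE)
  have ch: "E c \<cdot> h \<in> carrier G" using h cd by (simp only: G.m_closed E_K_closed)
  obtain N1 where N1: "\<And>a. a \<in> K_fixing N1 \<Longrightarrow> E a \<cdot> g = g \<cdot> E a"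
    by (rule commutes_K_fixing[OF g]) blast
  obtain N2 where N2: "\<And>a. a \<in> K_fixing N2 \<Longrightarrow>
      E a \<cdot> (E c \<cdot> h) = (E c \<cdot> h) \<cdot> E a"
    by (rule commutes_K_fixing[OF ch]) blast
  obtain M1 where M1: "\<And>m. (\<And>j. j < length Ls \<Longrightarrow> M1 \<le> m j) \<Longrightarrow>
      \<theta> m \<star> c \<star> \<theta> m \<in> K_fixing N1"
    by (rule theta_conj_K[OF cd(1)]) blast
  obtain M2 where M2: "\<And>m. (\<And>j. j < length Ls \<Longrightarrow> M2 \<le> m j) \<Longrightarrow>
      \<theta> m \<star> b \<star> \<theta> m \<in> K_fixing N2"
    by (rule theta_conj_K[OF ab(2)]) blast
  have "C (g' \<cdot> E (\<theta> m) \<cdot> h') = C (g \<cdot> E (\<theta> m) \<cdot> h)"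
    if m: "large (max M1 M2) m" for m
  proof -
    let ?t = "\<theta> m"
    define b' where "b' = ?t \<star> b \<star> ?t"
    define c' where "c' = ?t \<star> c \<star> ?t"
    have t: "?t \<in> K" "?t \<in> carrier L" by (rule theta_K, rule theta_carrier)
    have L: "b \<in> carrier L" "c \<in> carrier L" using ab cd by (auto intro: stab_carrier)
    have mem: "c' \<in> K_fixing N1" "b' \<in> K_fixing N2"
      unfolding b'_def c'_def using m by (auto intro!: M1 M2 simp: large_def simp del: heavy_group_mult)
    then have K: "c' \<in> K" "b' \<in> K" "b' \<star> d \<in> K" "a \<star> c' \<in> K"
      using K_fixing_subset ab cd
      by (auto intro!: subgroup.m_closed[OF subgroup_K] simp del: heavy_group_mult)
    have "b \<star> ?t = (?t \<star> ?t) \<star> (b \<star> ?t)"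
      using L t by (simp only: theta_theta L.l_one L.m_closed)
    also have "\<dots> = ?t \<star> b'"
      using L t by (simp only: b'_def L.m_assoc L.m_closed)
    finally have b: "E b \<cdot> E ?t = E ?t \<cdot> E b'"
      using ab K t by (simp only: E_K_mult)
    have "?t \<star> c = (?t \<star> c) \<star> (?t \<star> ?t)"
      using L t by (simp only: theta_theta L.r_one L.m_closed)
    also have "\<dots> = c' \<star> ?t"
      using L t by (simp only: c'_def L.m_assoc L.m_closed)
    finally have c: "E ?t \<cdot> E c = E c' \<cdot> E ?t"
      using cd K t by (simp only: E_K_mult)
    have "g' \<cdot> E ?t \<cdot> h' =
        E a \<cdot> g \<cdot> (E b \<cdot> E ?t) \<cdot> (E c \<cdot> h) \<cdot> E d"
      unfolding g' h' using g h ab cd t by (simp only: G.m_assoc G.m_closed E_K_closed)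
    also have "\<dots> = E a \<cdot> g \<cdot> E ?t \<cdot> (E b' \<cdot> (E c \<cdot> h)) \<cdot> E d"
      unfolding b using g h ab cd t K by (simp only: G.m_assoc G.m_closed E_K_closed)
    also have "\<dots> = E a \<cdot> g \<cdot> (E ?t \<cdot> E c) \<cdot> h \<cdot> (E b' \<cdot> E d)"
      unfolding N2[OF mem(2)] using g h ab cd t K by (simp only: G.m_assoc G.m_closed E_K_closed)
    also have "\<dots> = E a \<cdot> (g \<cdot> E c') \<cdot> E ?t \<cdot> h \<cdot> (E b' \<cdot> E d)"
      unfolding c using g h ab cd t K by (simp only: G.m_assoc G.m_closed E_K_closed)
    also have "\<dots> = (E a \<cdot> E c') \<cdot> (g \<cdot> E ?t \<cdot> h) \<cdot> (E b' \<cdot> E d)"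
      unfolding N1[OF mem(1), symmetric] using g h ab cd t K
      by (simp only: G.m_assoc G.m_closed E_K_closed)
    also have "\<dots> = E (a \<star> c') \<cdot> (g \<cdot> E ?t \<cdot> h) \<cdot> E (b' \<star> d)"
      using ab cd K by (simp only: E_K_mult)
    finally show ?thesis
      using coset_absorb[of "g \<cdot> E ?t \<cdot> h" "a \<star> c'" "b' \<star> d"] g h t K
      by (simp only: G.m_closed E_K_closed)
  qed
  then show ?thesis by (rule that)
qed

abbreviation "\<Gamma> \<equiv> mantle Gs Ls S \<Xi> \<omega>"

lemma mantle_carrier: "carrier \<Gamma> = C ` carrier G"
  by (simp add: mantle_def)

text \<open>Eventual constancy for one pair of representatives and the comparison with all other pairs show
  that the product is defined by a unique value.\<close>

lemma mantle_mult:
  assumes g: "g \<in> carrier G" and h: "h \<in> carrier G"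
  obtains M where "\<And>m. large M m \<Longrightarrow> C g \<otimes>\<^bsub>\<Gamma>\<^esub> C h = C (g \<cdot> E (\<theta> m) \<cdot> h)"
proof -
  obtain M0 where M0: "\<And>m m'. large M0 m \<Longrightarrow> large M0 m' \<Longrightarrow>
    C (g \<cdot> E (\<theta> m) \<cdot> h) = C (g \<cdot> E (\<theta> m') \<cdot> h)"
    by (rule product_change_index[OF g h]) blast
  define c where "c = C (g \<cdot> E (\<theta> (\<lambda>_. M0)) \<cdot> h)"
  have c: "C (g \<cdot> E (\<theta> m) \<cdot> h) = c" if "large M0 m" for m
    unfolding c_def by (rule M0[OF that]) (simp add: large_def)
  have "C g \<otimes>\<^bsub>\<Gamma>\<^esub> C h = (THE c. \<forall>g'\<in>C g. \<forall>h'\<in>C h. \<exists>M. \<forall>m. large M m \<longrightarrow>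
      C (g' \<cdot> E (\<theta> m) \<cdot> h') = c)"
    unfolding mantle_def large_def by (simp del: classical_group_mult)
  also have "\<dots> = c"
  proof (rule the_equality)
    show "\<forall>g'\<in>C g. \<forall>h'\<in>C h. \<exists>M. \<forall>m. large M m \<longrightarrow> C (g' \<cdot> E (\<theta> m) \<cdot> h') = c"
    proof (intro ballI)
      fix g' h' assume *: "g' \<in> C g" "h' \<in> C h"
      obtain M where "\<And>m. large M m \<Longrightarrow>
          C (g' \<cdot> E (\<theta> m) \<cdot> h') = C (g \<cdot> E (\<theta> m) \<cdot> h)"
        by (rule product_change_representatives[OF g h *]) blast
      then show "\<exists>M. \<forall>m. large M m \<longrightarrow> C (g' \<cdot> E (\<theta> m) \<cdot> h') = c"
        using c by (metis large_max)
    qed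
  next
    fix c' assume "\<forall>g'\<in>C g. \<forall>h'\<in>C h. \<exists>M. \<forall>m. large M m \<longrightarrow> C (g' \<cdot> E (\<theta> m) \<cdot> h') = c'"
    then obtain M where M: "\<And>m. large M m \<Longrightarrow> C (g \<cdot> E (\<theta> m) \<cdot> h) = c'"
      using coset_self[OF g] coset_self[OF h] by blast
    have "large M (\<lambda>_. max M M0)" "large M0 (\<lambda>_. max M M0)" by (simp_all add: large_def)
    then show "c' = c" using M c by metis
  qed
  finally show ?thesis using c by (intro that[of M0]) (simp only:)
qed

abbreviation "\<iota> \<equiv> mantle_embedding Gs Ls S \<Xi> \<tau>"

lemma mantle_embedding_hom: "\<iota> \<in> hom G \<Gamma>"
proof (rule homI)
  fix g assume "g \<in> carrier G"
  then show "\<iota> g \<in> carrier \<Gamma>"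
    unfolding mantle_carrier mantle_embedding_def using i_tau_closed by blast
next
  fix g h assume gh: "g \<in> carrier G" "h \<in> carrier G"
  note i = i_tau_closed[OF gh(1)] i_tau_closed[OF gh(2)]
  obtain M where M: "\<And>m. large M m \<Longrightarrow>
      C (i\<^sub>\<tau> g) \<otimes>\<^bsub>\<Gamma>\<^esub> C (i\<^sub>\<tau> h) = C (i\<^sub>\<tau> g \<cdot> E (\<theta> m) \<cdot> i\<^sub>\<tau> h)"
    by (rule mantle_mult[OF i]) blast
  let ?m = "\<lambda>_. M" and ?e = "\<one>\<^bsub>L\<^esub>"
  have e: "?e \<in> K" by (rule subgroup.one_closed[OF subgroup_K])
  have "i\<^sub>\<tau> g \<cdot> E (\<theta> ?m) \<cdot> i\<^sub>\<tau> h = E (\<theta> ?m) \<cdot> (i\<^sub>\<tau> g \<cdot> i\<^sub>\<tau> h) \<cdot> E ?e"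
    unfolding i_tau_commutes_K[OF gh(1) theta_K] E_one using i
    by (simp only: G.m_assoc G.m_closed E_K_closed theta_K G.r_one)
  then have "C (i\<^sub>\<tau> g \<cdot> E (\<theta> ?m) \<cdot> i\<^sub>\<tau> h) = C (i\<^sub>\<tau> g \<cdot> i\<^sub>\<tau> h)"
    using coset_absorb[OF G.m_closed[OF i] theta_K e] by simp
  moreover have "C (i\<^sub>\<tau> g) \<otimes>\<^bsub>\<Gamma>\<^esub> C (i\<^sub>\<tau> h) = C (i\<^sub>\<tau> g \<cdot> E (\<theta> ?m) \<cdot> i\<^sub>\<tau> h)"
    by (rule M) (simp add: large_def)
  ultimately show "\<iota> (g \<cdot> h) = \<iota> g \<otimes>\<^bsub>\<Gamma>\<^esub> \<iota> h"
    unfolding mantle_embedding_def i_tau_mult[OF gh] by simp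
qed

lemma mantle_embedding_inj: "inj_on \<iota> (carrier G)"
proof (rule inj_onI)
  fix g h assume gh: "g \<in> carrier G" "h \<in> carrier G" and eq: "\<iota> g = \<iota> h"
  note i = i_tau_closed[OF gh(1)] i_tau_closed[OF gh(2)]
  have "i\<^sub>\<tau> g \<in> C (i\<^sub>\<tau> h)"
    using coset_self[OF i(1)] eq by (simp add: mantle_embedding_def)
  then obtain a b where ab: "a \<in> K" "b \<in> K" "i\<^sub>\<tau> g = E a \<cdot> i\<^sub>\<tau> h \<cdot> E b"
    by (rule coset_memE)
  have "i\<^sub>\<tau> g = E a \<cdot> (i\<^sub>\<tau> h \<cdot> E b)"
    unfolding ab(3) using ab(1,2) i by (simp only: G.m_assoc E_K_closed)
  also have "\<dots> = E a \<cdot> E b \<cdot> i\<^sub>\<tau> h"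
    unfolding i_tau_commutes_K[OF gh(2) ab(2)] using ab(1,2) i by (simp only: G.m_assoc E_K_closed)
  also have "\<dots> = E (a \<star> b) \<cdot> i\<^sub>\<tau> h"
    using ab by (simp only: E_K_mult)
  finally have *: "i\<^sub>\<tau> g = E (a \<star> b) \<cdot> i\<^sub>\<tau> h" .
  have "E (a \<star> b) = \<one>\<^bsub>G\<^esub>"
    using ab(1,2) by (intro i_tau_eq_K_mult[OF gh _ *] subgroup.m_closed[OF subgroup_K])
  then have "i\<^sub>\<tau> g = i\<^sub>\<tau> h"
    using * i by (simp only: G.l_one)
  then show "g = h" by (rule i_tau_inj[OF gh])
qed

end


section \<open>Complex Hilbert spaces\<close>

text \<open>Reduces statements on the complex inner product to the real one, for which limits and
  Cauchy-Schwarz are available.\<close>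

lemma cinner_eq_inner: "cinner x y = Complex (inner x y) (inner (scaleC (- \<i>) x) y)"
  for x y :: "'h::chilbert_space"
  by (simp add: inner_eq_Re_cinner cinner_scaleC_left complex_eq_iff)

lemma isometry_inner:
  assumes "isometry_onto W T"
  shows "inner (T x) (T y) = inner x y" "norm (T x) = norm x" "T (x + y) = T x + T y"
    "T (scaleC a x) = scaleC a (T x)" "T (x - y) = T x - T y" "T x = T y \<longleftrightarrow> x = y"
proof -
  show inner: "inner (T x) (T y) = inner x y" for x y
    using assms by (simp add: isometry_onto_def inner_eq_Re_cinner)
  then show norm: "norm (T x) = norm x" for x by (simp add: norm_eq_sqrt_inner)
  show add: "T (x + y) = T x + T y" for x y
    using assms by (simp add: isometry_onto_def complex_linear_def)
  show "T (scaleC a x) = scaleC a (T x)"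
    using assms by (simp add: isometry_onto_def complex_linear_def)
  show diff: "T (x - y) = T x - T y" using add[of "x - y" y] by simp
  show "T x = T y \<longleftrightarrow> x = y"
    using norm[of "x - y"] diff by auto
qed

text \<open>The projection theorem. A minimizing sequence is a Cauchy sequence by the parallelogram law.\<close>

lemma projection_exists:
  fixes V :: "'h::chilbert_space set"
  assumes V: "subspace V" "closed V"
  obtains q where "q \<in> V" "\<And>w. w \<in> V \<Longrightarrow> inner (u - q) w = 0"
proof -
  define D where "D = (\<lambda>v. (norm (u - v))\<^sup>2) ` V"
  have D: "D \<noteq> {}" "bdd_below D"
    using subspace_0[OF V(1)] by (auto simp: D_def intro!: bdd_belowI[of _ 0])
  define \<delta> where "\<delta> = Inf D"
  have lower: "\<delta> \<le> (norm (u - v))\<^sup>2" if "v \<in> V" for v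
    unfolding \<delta>_def by (rule cInf_lower[OF _ D(2)]) (use that in \<open>auto simp: D_def\<close>)
  have "\<exists>v\<in>V. (norm (u - v))\<^sup>2 < \<delta> + 1 / real (Suc n)" for n
    using cInf_lessD[OF D(1), of "\<delta> + 1 / real (Suc n)"] by (auto simp: \<delta>_def D_def)
  then obtain v where v: "\<And>n. v n \<in> V" "\<And>n. (norm (u - v n))\<^sup>2 < \<delta> + 1 / real (Suc n)"
    by metis
  have close: "(norm (v m - v n))\<^sup>2 \<le> 2 / real (Suc m) + 2 / real (Suc n)" for m n
  proof -
    have mid: "(1/2) *\<^sub>R (v m + v n) \<in> V"
      using V(1) v(1) by (intro subspace_scale subspace_add)
    have "(norm (v m - v n))\<^sup>2 =
      2 * (norm (u - v m))\<^sup>2 + 2 * (norm (u - v n))\<^sup>2 - 4 * (norm (u - (1/2) *\<^sub>R (v m + v n)))\<^sup>2"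
      by (simp add: power2_norm_eq_inner inner_diff_left inner_diff_right inner_add_left
          inner_add_right inner_commute algebra_simps)
    also have "\<dots> \<le> 2 * (\<delta> + 1 / real (Suc m)) + 2 * (\<delta> + 1 / real (Suc n)) - 4 * \<delta>"
      using less_imp_le[OF v(2)[of m]] less_imp_le[OF v(2)[of n]] lower[OF mid]
      by (intro diff_mono add_mono mult_left_mono) auto
    finally show ?thesis by (simp add: algebra_simps)
  qed
  have "Cauchy v"
  proof (rule metric_CauchyI)
    fix e :: real assume e: "0 < e"
    obtain N where N: "4 / e\<^sup>2 < real N" using reals_Archimedean2 by blast
    then have Npos: "0 < real N" using e by (smt (verit) divide_pos_pos zero_less_power)
    have "dist (v m) (v n) < e" if "N \<le> m" "N \<le> n" for m n
    proof -
      have *: "2 / real (Suc k) \<le> 2 / real N" if "N \<le> k" for k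
        using that Npos by (intro divide_left_mono) auto
      have "(norm (v m - v n))\<^sup>2 \<le> 4 / real N"
        using close[of m n] add_mono[OF *[OF that(1)] *[OF that(2)]] by simp
      also have "\<dots> < e\<^sup>2"
        using N Npos e by (simp add: field_simps)
      finally show ?thesis
        using e by (simp add: dist_norm power_less_imp_less_base)
    qed
    then show "\<exists>M. \<forall>m\<ge>M. \<forall>n\<ge>M. dist (v m) (v n) < e" by blast
  qed
  then obtain q where q: "v \<longlonglongrightarrow> q"
    using Cauchy_convergent convergent_def by blast
  have qV: "q \<in> V"
    using V(2) q v(1) closed_sequentially by blast
  have "(\<lambda>n. (norm (u - v n))\<^sup>2) \<longlonglongrightarrow> (norm (u - q))\<^sup>2"
    by (intro tendsto_intros q)
  moreover have "(\<lambda>n. \<delta> + 1 / real (Suc n)) \<longlonglongrightarrow> \<delta> + 0"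
    by (intro tendsto_intros LIMSEQ_Suc[OF lim_1_over_n])
  ultimately have min: "(norm (u - q))\<^sup>2 \<le> \<delta>"
    using v(2) by (intro LIMSEQ_le[of "\<lambda>n. (norm (u - v n))\<^sup>2" _ "\<lambda>n. \<delta> + 1 / real (Suc n)"])
      (auto intro: less_imp_le)
  have "inner (u - q) w = 0" if w: "w \<in> V" for w
  proof -
    let ?a = "inner (u - q) w" and ?b = "inner w w"
    have quad: "2 * t * ?a \<le> t\<^sup>2 * ?b" for t
    proof -
      have "q + t *\<^sub>R w \<in> V" using V(1) qV w by (intro subspace_add subspace_scale)
      then have "(norm (u - q))\<^sup>2 \<le> (norm (u - (q + t *\<^sub>R w)))\<^sup>2"
        using lower min by (meson order_trans)
      also have "\<dots> = (norm (u - q))\<^sup>2 - 2 * t * ?a + t\<^sup>2 * ?b"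
        by (simp only: power2_norm_eq_inner) (simp add: inner_diff_left inner_diff_right
            inner_add_left inner_add_right inner_commute algebra_simps power2_eq_square)
      finally show ?thesis by simp
    qed
    show ?thesis
    proof (cases "?b = 0")
      case False
      then have b: "?b > 0" by (metis inner_gt_zero_iff inner_zero_left)
      have "2 * (?a / ?b) * ?a \<le> (?a / ?b)\<^sup>2 * ?b" by (rule quad)
      then have "2 * (?a * ?a) \<le> ?a * ?a"
        using b by (simp add: power2_eq_square field_simps)
      then show ?thesis
        by (smt (verit) mult_eq_0_iff zero_le_square)
    qed simp
  qed
  then show ?thesis using qV that by blast
qed


section \<open>Neighbourhoods of the identity in the weak operator topology\<close>

text \<open>The columns of \<open>l\<close> in \<open>T\<close> are orthonormal, and vanish outside \<open>T\<close>.\<close>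

lemma unitary_isometry:
  assumes l: "l \<in> irreducible_heavy F" and T: "finite T" "supported_on T l"
  shows "(\<Sum>x\<in>T. (norm (\<Sum>y\<in>T. l x y * u y))\<^sup>2) = (\<Sum>y\<in>T. (norm (u y))\<^sup>2)"
proof -
  have gram: "(\<Sum>x\<in>T. qcnj (l x y) * l x z) = mat_one y z" if "y \<in> T" for y z
  proof -
    have "mat_mult (mat_adjoint l) l y z = (\<Sum>x\<in>T. mat_adjoint l y x * l x z)"
    proof (rule mat_mult_superset[OF T(1)])
      show "{x. mat_adjoint l y x \<noteq> 0} \<subseteq> T"
      proof
        fix x assume "x \<in> {x. mat_adjoint l y x \<noteq> 0}"
        then have "l x y \<noteq> 0" by (simp add: mat_adjoint_def)
        then show "x \<in> T"
          using T(2) that by (auto simp: supported_on_def mat_one_def split: if_splits)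
      qed
    qed
    then show ?thesis using l by (simp add: irreducible_heavy_iff mat_adjoint_def)
  qed
  have "(\<Sum>x\<in>T. (norm (\<Sum>y\<in>T. l x y * u y))\<^sup>2) =
    (\<Sum>x\<in>T. \<Sum>y\<in>T. \<Sum>z\<in>T. inner (l x y * u y) (l x z * u z))"
    by (simp add: power2_norm_eq_inner inner_sum_left inner_sum_right)
      (rule sum.cong[OF refl], rule sum.swap)
  also have "\<dots> = (\<Sum>y\<in>T. \<Sum>z\<in>T. \<Sum>x\<in>T. inner (l x y * u y) (l x z * u z))"
    by (rule trans[OF sum.swap]) (rule sum.cong[OF refl], rule sum.swap)
  also have "\<dots> = (\<Sum>y\<in>T. \<Sum>z\<in>T. inner (u y) (mat_one y z * u z))"
  proof (intro sum.cong refl)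
    fix y z assume y: "y \<in> T"
    have "(\<Sum>x\<in>T. inner (l x y * u y) (l x z * u z)) = inner (u y) ((\<Sum>x\<in>T. qcnj (l x y) * l x z) * u z)"
      by (simp add: inner_mult_left_quat inner_sum_right sum_distrib_right mult.assoc)
    then show "(\<Sum>x\<in>T. inner (l x y * u y) (l x z * u z)) = inner (u y) (mat_one y z * u z)"
      by (simp add: gram[OF y])
  qed
  also have "\<dots> = (\<Sum>y\<in>T. \<Sum>z\<in>T. if y = z then inner (u y) (u z) else 0)"
    by (intro sum.cong refl) (simp add: mat_one_def)
  also have "\<dots> = (\<Sum>y\<in>T. (norm (u y))\<^sup>2)"
    using T(1) by (simp add: power2_norm_eq_inner)
  finally show ?thesis .
qed

text \<open>A change of finitely many terms does not affect convergence; and two divergent series have the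
  same default value as their sum.\<close>

lemma suminf_change_finitely:
  fixes f g :: "nat \<Rightarrow> quat"
  assumes "finite T" "\<And>x. x \<notin> T \<Longrightarrow> f x = g x"
  shows "suminf f = suminf g \<or> suminf f = suminf g + (\<Sum>x\<in>T. f x - g x)"
proof -
  have d: "(\<lambda>x. f x - g x) sums (\<Sum>x\<in>T. f x - g x)"
    using assms by (intro sums_finite) auto
  show ?thesis
  proof (cases "summable g")
    case True
    have "(\<lambda>x. g x + (f x - g x)) sums (suminf g + (\<Sum>x\<in>T. f x - g x))"
      by (intro sums_add summable_sums[OF True] d)
    then show ?thesis by (simp add: sums_iff)
  next
    case False
    have "\<not> summable f"
    proof
      assume "summable f"
      then have "summable (\<lambda>x. f x - (f x - g x))"
        by (rule summable_diff[OF _ sums_summable[OF d]])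
      then show False using False by simp
    qed
    then have "(\<lambda>y. f sums y) = (\<lambda>y. g sums y)"
      using False by (auto simp: summable_def)
    then show ?thesis by (simp add: suminf_def)
  qed
qed

text \<open>If \<open>l\<close> fixes the first \<open>N\<close> basis vectors, then \<open>l v - v = l t - t\<close> for the tail \<open>t\<close> of \<open>v\<close>, and
  since \<open>l\<close> is an isometry this has norm at most \<open>2 \<parallel>t\<parallel>\<close>.\<close>

lemma matrix_coefficient_near_identity:
  assumes v: "v \<in> ell2 F" and w: "w \<in> ell2 F" and e: "0 < e"
  obtains N where "\<And>l. l \<in> irreducible_heavy F \<Longrightarrow> (\<And>x y. x < N \<Longrightarrow> l y x = mat_one y x) \<Longrightarrow>
    dist (ell2_inner w (mat_apply l v)) (ell2_inner w v) < e"
proof -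
  let ?f = "\<lambda>x. (norm (v x))\<^sup>2" and ?h = "\<lambda>x. (norm (w x))\<^sup>2"
  have sv: "summable ?f" and sw: "summable ?h" using v w by (auto simp: ell2_def)
  define W where "W = sqrt (suminf ?h)"
  have W0: "0 \<le> W" unfolding W_def by (intro real_sqrt_ge_zero suminf_nonneg sw) simp
  define \<delta> where "\<delta> = e / (2 * (W + 1))"
  have \<delta>: "0 < \<delta>" using e W0 by (simp add: \<delta>_def)
  have "(\<lambda>n. suminf ?f - (\<Sum>x<n. ?f x)) \<longlonglongrightarrow> suminf ?f - suminf ?f"
    by (intro tendsto_intros summable_LIMSEQ sv)
  then have "\<forall>\<^sub>F n in sequentially. suminf ?f - (\<Sum>x<n. ?f x) < \<delta>\<^sup>2"
    using \<delta> by (intro order_tendstoD) auto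
  then obtain N where N: "suminf ?f - (\<Sum>x<N. ?f x) < \<delta>\<^sup>2"
    by (auto simp: eventually_sequentially)
  have "dist (ell2_inner w (mat_apply l v)) (ell2_inner w v) < e"
    if l: "l \<in> irreducible_heavy F" and fixed: "\<And>x y. x < N \<Longrightarrow> l y x = mat_one y x" for l
  proof -
    obtain T where T: "finite T" "supported_on T l"
      using l by (auto simp: irreducible_heavy_iff finite_mat_iff fin_supported_def)
    define t where "t x = (if x < N then 0 else v x)" for x
    define d where "d x = mat_apply l v x - v x" for x
    have apply_T: "mat_apply l v x = (\<Sum>y\<in>T. l x y * v y)" if "x \<in> T" for x
      unfolding mat_apply_def
    proof (rule sum.mono_neutral_left[OF T(1)])
      show "{y. l x y \<noteq> 0} \<subseteq> T"
        using T(2) that by (auto simp: supported_on_def mat_one_def split: if_splits)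
    qed auto
    have out: "d x = 0" if "x \<notin> T" for x
    proof -
      have "l x y = mat_one x y" for y using T(2) that by (simp add: supported_on_def)
      then have "mat_apply l v x = (\<Sum>y\<in>{x}. l x y * v y)"
        unfolding mat_apply_def
        by (intro sum.mono_neutral_left) (auto simp: mat_one_def split: if_splits)
      then show ?thesis using \<open>\<And>y. l x y = mat_one x y\<close> by (simp add: d_def)
    qed
    have d_eq: "d x = (\<Sum>y\<in>T. l x y * t y) - t x" if "x \<in> T" for x
    proof -
      have z: "(\<Sum>y\<in>T. mat_one x y * f y) = f x" for f
      proof -
        have "(\<Sum>y\<in>T. mat_one x y * f y) = (\<Sum>y\<in>T. if x = y then f y else 0)"
          by (intro sum.cong refl) (simp add: mat_one_def)
        then show ?thesis using T(1) that by simp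
      qed
      have "d x = (\<Sum>y\<in>T. (l x y - mat_one x y) * v y)"
        using that by (simp add: d_def apply_T left_diff_distrib sum_subtractf z)
      also have "\<dots> = (\<Sum>y\<in>T. (l x y - mat_one x y) * t y)"
        by (intro sum.cong refl) (simp add: t_def fixed)
      finally show ?thesis by (simp add: left_diff_distrib sum_subtractf z)
    qed
    have "(\<Sum>x\<in>T. (norm (t x))\<^sup>2) = (\<Sum>x\<in>T - {..<N}. ?f x)"
      using T(1) by (intro sum.mono_neutral_cong_right) (auto simp: t_def)
    moreover have "(\<Sum>x<N. ?f x) + (\<Sum>x\<in>T - {..<N}. ?f x) = (\<Sum>x\<in>{..<N} \<union> (T - {..<N}). ?f x)"
      using T(1) by (intro sum.union_disjoint[symmetric]) auto
    moreover have "(\<Sum>x\<in>{..<N} \<union> (T - {..<N}). ?f x) \<le> suminf ?f"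
      using T(1) by (intro sum_le_suminf sv) auto
    ultimately have "(\<Sum>x\<in>T. (norm (t x))\<^sup>2) \<le> \<delta>\<^sup>2" using N by linarith
    then have tT: "L2_set (\<lambda>x. norm (t x)) T \<le> \<delta>"
      using \<delta> by (simp add: L2_set_def real_le_lsqrt sum_nonneg)
    have wT: "L2_set (\<lambda>x. norm (w x)) T \<le> W"
      unfolding L2_set_def W_def using T(1) by (intro real_sqrt_le_mono sum_le_suminf sw) auto
    have "L2_set (\<lambda>x. norm (d x)) T \<le>
        L2_set (\<lambda>x. norm (\<Sum>y\<in>T. l x y * t y) + norm (t x)) T"
      by (intro L2_set_mono) (auto simp: d_eq norm_triangle_ineq4)
    also have "\<dots> \<le> L2_set (\<lambda>x. norm (\<Sum>y\<in>T. l x y * t y)) T + L2_set (\<lambda>x. norm (t x)) T"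
      by (rule L2_set_triangle_ineq)
    also have "L2_set (\<lambda>x. norm (\<Sum>y\<in>T. l x y * t y)) T = L2_set (\<lambda>x. norm (t x)) T"
      by (simp add: L2_set_def unitary_isometry[OF l T])
    finally have dT: "L2_set (\<lambda>x. norm (d x)) T \<le> 2 * \<delta>" using tT by simp
    have "norm (\<Sum>x\<in>T. qcnj (w x) * d x) \<le> (\<Sum>x\<in>T. \<bar>norm (w x)\<bar> * \<bar>norm (d x)\<bar>)"
      by (rule order_trans[OF norm_sum]) (simp add: norm_mult_quat)
    also have "\<dots> \<le> L2_set (\<lambda>x. norm (w x)) T * L2_set (\<lambda>x. norm (d x)) T"
      by (rule L2_set_mult_ineq)
    also have "\<dots> \<le> W * (2 * \<delta>)"
      using wT dT W0 by (intro mult_mono) (auto simp: L2_set_nonneg)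
    also have "\<dots> < e"
      using e W0 by (simp add: \<delta>_def field_simps)
    finally have bound: "norm (\<Sum>x\<in>T. qcnj (w x) * d x) < e" .
    have "(\<Sum>x\<in>T. qcnj (w x) * mat_apply l v x - qcnj (w x) * v x) = (\<Sum>x\<in>T. qcnj (w x) * d x)"
      by (simp add: d_def right_diff_distrib)
    moreover have "qcnj (w x) * mat_apply l v x = qcnj (w x) * v x" if "x \<notin> T" for x
      using out[OF that] by (simp add: d_def)
    ultimately show ?thesis
      using suminf_change_finitely[OF T(1), of "\<lambda>x. qcnj (w x) * mat_apply l v x" "\<lambda>x. qcnj (w x) * v x"]
        bound e by (auto simp: ell2_inner_def dist_norm)
  qed
  then show ?thesis using that by blast
qed

lemma mat_apply_mat_one: "mat_apply mat_one v = v"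
proof
  fix x :: nat
  have "{y. mat_one x y \<noteq> (0::quat)} = {x}" by (auto simp: mat_one_def)
  then show "mat_apply mat_one v x = v x" by (simp add: mat_apply_def)
qed

text \<open>By directedness of the stabilizers of initial segments it suffices to consider the generating open
  sets. The stabilizers themselves are not neighbourhoods of the identity.\<close>

lemma weak_operator_neighbourhood:
  assumes "openin (weak_operator_topology Ls) U" "(\<lambda>_. mat_one) \<in> U"
  obtains N where "stabilizer Ls (\<lambda>_. {..<N}) \<subseteq> U"
proof -
  have mono: "stabilizer Ls (\<lambda>_. {..<N}) \<subseteq> stabilizer Ls (\<lambda>_. {..<M})" if "M \<le> N" for M N
    using that by (intro stabilizer_antimono) auto
  let ?B = "insert (carrier (heavy_group Ls))
       {{l \<in> carrier (heavy_group Ls). ell2_inner w (mat_apply (l j) v) \<in> V} | j v w V.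
          j < length Ls \<and> v \<in> ell2 (Ls ! j) \<and> w \<in> ell2 (Ls ! j) \<and> open V}"
  have "generate_topology_on ?B U"
    using assms(1) by (simp add: weak_operator_topology_def openin_topology_generated_by_iff)
  then have "(\<lambda>_. mat_one) \<in> U \<longrightarrow> (\<exists>N. stabilizer Ls (\<lambda>_. {..<N}) \<subseteq> U)"
  proof (induction rule: generate_topology_on.induct)
    case (Int a b)
    show ?case
    proof
      assume "(\<lambda>_. mat_one) \<in> a \<inter> b"
      then obtain M N where "stabilizer Ls (\<lambda>_. {..<M}) \<subseteq> a" "stabilizer Ls (\<lambda>_. {..<N}) \<subseteq> b"
        using Int.IH by blast
      then have "stabilizer Ls (\<lambda>_. {..<max M N}) \<subseteq> a \<inter> b"
        using order_trans[OF mono[of M "max M N"]] order_trans[OF mono[of N "max M N"]] by simp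
      then show "\<exists>N. stabilizer Ls (\<lambda>_. {..<N}) \<subseteq> a \<inter> b" by blast
    qed
  next
    case (UN K)
    show ?case
    proof
      assume "(\<lambda>_. mat_one) \<in> \<Union> K"
      then obtain k where k: "k \<in> K" "(\<lambda>_. mat_one) \<in> k" by blast
      then obtain N where "stabilizer Ls (\<lambda>_. {..<N}) \<subseteq> k" using UN.IH[OF k(1)] by blast
      then show "\<exists>N. stabilizer Ls (\<lambda>_. {..<N}) \<subseteq> \<Union> K" using k(1) by blast
    qed
  next
    case (Basis U)
    then consider "U = carrier (heavy_group Ls)" |
      j v w V where "U = {l \<in> carrier (heavy_group Ls). ell2_inner w (mat_apply (l j) v) \<in> V}"
        "j < length Ls" "v \<in> ell2 (Ls ! j)" "w \<in> ell2 (Ls ! j)" "open V"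
      by blast
    then show ?case
    proof cases
      case 1
      then show ?thesis using stabilizer_carrier by blast
    next
      case 2
      show ?thesis
      proof
        assume "(\<lambda>_. mat_one) \<in> U"
        then have "ell2_inner w v \<in> V" by (simp add: 2(1) mat_apply_mat_one)
        then obtain e where e: "0 < e" "\<And>q. dist q (ell2_inner w v) < e \<Longrightarrow> q \<in> V"
          using 2(5) unfolding open_dist by blast
        obtain N where N: "\<And>l. l \<in> irreducible_heavy (Ls ! j) \<Longrightarrow>
            (\<And>x y. x < N \<Longrightarrow> l y x = mat_one y x) \<Longrightarrow>
            dist (ell2_inner w (mat_apply l v)) (ell2_inner w v) < e"
          by (rule matrix_coefficient_near_identity[OF 2(3,4) e(1)]) blast
        have "l \<in> U" if "l \<in> stabilizer Ls (\<lambda>_. {..<N})" for l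
        proof -
          have "l j \<in> irreducible_heavy (Ls ! j)"
            using that 2(2) by (auto simp: stabilizer_def heavy_group_def)
          moreover have "l j y x = mat_one y x" if "x < N" for x y
            using \<open>l \<in> _\<close> that 2(2) by (simp add: stabilizer_def)
          ultimately show ?thesis
            using e(2) N stabilizer_carrier[OF that] by (simp add: 2(1))
        qed
        then show "\<exists>N. stabilizer Ls (\<lambda>_. {..<N}) \<subseteq> U" by blast
      qed
    qed
  qed simp
  then show ?thesis using assms(2) that by blast
qed

lemma weak_operator_topspace: "topspace (weak_operator_topology Ls) = carrier (heavy_group Ls)"
  by (auto simp: weak_operator_topology_def topology_generated_by_topspace)

lemma mult_divide_less:
  fixes e x :: real
  assumes "0 < e" "0 \<le> x"
  shows "x * (e / (x + 1)) < e"
proof -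
  have "x * e < e * (x + 1)" using assms by (simp add: algebra_simps)
  then have "x * e / (x + 1) < e" using assms by (subst pos_divide_less_eq) auto
  then show ?thesis by simp
qed

lemma subspace_closure:
  fixes V :: "'a::real_normed_vector set"
  assumes "subspace V"
  shows "subspace (closure V)"
proof (rule subspaceI)
  show "0 \<in> closure V"
    using subspace_0[OF assms] closure_subset by blast
next
  fix x y assume "x \<in> closure V" "y \<in> closure V"
  then obtain a b where "\<And>n. a n \<in> V" "a \<longlonglongrightarrow> x" "\<And>n. b n \<in> V" "b \<longlonglongrightarrow> y"
    by (auto simp: closure_sequential)
  then have "(\<forall>n. a n + b n \<in> V) \<and> (\<lambda>n. a n + b n) \<longlonglongrightarrow> x + y"
    using assms by (auto intro: subspace_add tendsto_add)
  then show "x + y \<in> closure V"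
    unfolding closure_sequential by (intro exI[of _ "\<lambda>n. a n + b n"])
next
  fix c x assume "x \<in> closure V"
  then obtain a where "\<And>n. a n \<in> V" "a \<longlonglongrightarrow> x"
    by (auto simp: closure_sequential)
  then have "(\<forall>n. c *\<^sub>R a n \<in> V) \<and> (\<lambda>n. c *\<^sub>R a n) \<longlonglongrightarrow> c *\<^sub>R x"
    using assms by (auto intro: subspace_scale tendsto_scaleR)
  then show "c *\<^sub>R x \<in> closure V"
    unfolding closure_sequential by (intro exI[of _ "\<lambda>n. c *\<^sub>R a n"])
qed

lemma isometry_tendsto:
  assumes T: "isometry_onto W T" and f: "(f \<longlongrightarrow> x) F"
  shows "((\<lambda>n. T (f n)) \<longlongrightarrow> T x) F"
proof -
  have "dist (T (f n)) (T x) = dist (f n) x" for n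
    by (simp only: dist_norm isometry_inner(5)[OF T, symmetric] isometry_inner(2)[OF T])
  then show ?thesis
    using f unfolding tendsto_dist_iff[of "\<lambda>n. T (f n)"] tendsto_dist_iff[of f] by simp
qed


section \<open>Representations of the pair\<close>

locale mantle_representation = mantle_data Gs Ls S \<Xi> \<tau> \<omega>
  for Gs :: "classical list" and Ls :: "scalars list" and S :: "nat \<Rightarrow> nat \<Rightarrow> straight_data"
    and \<Xi> :: "nat \<Rightarrow> nat set" and \<tau> \<omega> :: "nat \<Rightarrow> nat \<Rightarrow> nat" +
  fixes \<rho> :: "(nat \<Rightarrow> basis_vec hmat) \<Rightarrow> 'h::chilbert_space \<Rightarrow> 'h"
  assumes rep: "pair_representation Gs Ls S \<rho>"
begin

lemma rho_isometry: "g \<in> carrier G \<Longrightarrow> isometry_onto UNIV (\<rho> g)"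
  using rep by (auto simp: pair_representation_def hom_def unitary_operators_def Pi_def)

lemma rho_surj: "g \<in> carrier G \<Longrightarrow> \<exists>x. \<rho> g x = y"
  using rho_isometry by (metis isometry_onto_def rangeE UNIV_I)

lemma rho_mult:
  assumes "g \<in> carrier G" "h \<in> carrier G"
  shows "\<rho> (g \<cdot> h) v = \<rho> g (\<rho> h v)"
proof -
  have "\<rho> (g \<cdot> h) = \<rho> g \<circ> \<rho> h"
    using rep hom_mult[of \<rho> G unitary_operators g h] assms
    by (simp add: pair_representation_def unitary_operators_def)
  then show ?thesis by simp
qed

lemma rho_one: "\<rho> \<one>\<^bsub>G\<^esub> v = v"
proof -
  have "\<rho> \<one>\<^bsub>G\<^esub> (\<rho> \<one>\<^bsub>G\<^esub> v) = \<rho> \<one>\<^bsub>G\<^esub> v"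
    by (simp only: rho_mult[symmetric] G.one_closed G.l_one)
  then show ?thesis
    using isometry_inner(6)[OF rho_isometry[OF G.one_closed]] by blast
qed

definition \<pi> :: "(nat \<Rightarrow> nat hmat) \<Rightarrow> 'h \<Rightarrow> 'h" where
  "\<pi> l = \<rho> (E l)"

lemma pi_mult: "l \<in> carrier L \<Longrightarrow> l' \<in> carrier L \<Longrightarrow> \<pi> (l \<star> l') v = \<pi> l (\<pi> l' v)"
  by (simp only: \<pi>_def E_mult rho_mult E_closed)

lemma pi_one: "\<pi> \<one>\<^bsub>L\<^esub> v = v"
  by (simp only: \<pi>_def E_one rho_one)

lemma pi_isometry: "l \<in> carrier L \<Longrightarrow> isometry_onto UNIV (\<pi> l)"
  unfolding \<pi>_def by (intro rho_isometry E_closed)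

lemma pi_inv: "l \<in> carrier L \<Longrightarrow> \<pi> l (\<pi> (inv\<^bsub>L\<^esub> l) v) = v" "l \<in> carrier L \<Longrightarrow> \<pi> (inv\<^bsub>L\<^esub> l) (\<pi> l v) = v"
  by (simp_all only: pi_mult[symmetric] L.inv_closed L.r_inv L.l_inv pi_one)

lemma norm_pi_diff: "l \<in> carrier L \<Longrightarrow> norm (\<pi> l u - \<pi> l v) = norm (u - v)"
  using isometry_inner(2,5)[OF pi_isometry] by metis

text \<open>Continuity at the identity, in the form in which it enters all limits below.\<close>

lemma near_identity:
  assumes "0 < e"
  obtains N where "\<And>l. l \<in> stab (\<lambda>_. {..<N}) \<Longrightarrow> norm (\<pi> l v - v) < e"
proof -
  let ?U = "{l \<in> topspace (weak_operator_topology Ls). \<pi> l v \<in> ball v e}"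
  have "continuous_map (weak_operator_topology Ls) euclidean (\<lambda>l. \<pi> l v)"
    using rep unfolding pair_representation_def \<pi>_def by blast
  then have "openin (weak_operator_topology Ls) ?U"
    by (rule openin_continuous_map_preimage) simp
  moreover have "(\<lambda>_. mat_one) \<in> ?U"
    using pi_one[of v] L.one_closed assms by (simp add: weak_operator_topspace)
  ultimately obtain N where N: "stab (\<lambda>_. {..<N}) \<subseteq> ?U"
    by (rule weak_operator_neighbourhood)
  have "norm (\<pi> l v - v) < e" if "l \<in> stab (\<lambda>_. {..<N})" for l
    using subsetD[OF N that] by (simp add: dist_norm norm_minus_commute)
  then show ?thesis by (rule that)
qed

abbreviation "H0 \<equiv> fixed_space Gs Ls S \<Xi> \<rho>"

lemma fixed_space_iff: "v \<in> H0 \<longleftrightarrow> (\<forall>l\<in>K. \<pi> l v = v)"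
  by (simp add: fixed_space_def \<pi>_def)

subsection \<open>The intertwining isometry\<close>

text \<open>The distance of the terms with indices \<open>m\<close> and \<open>n\<close> is the distance by which \<open>(s n)\<^sup>-\<^sup>1 (s m)\<close>
  moves \<open>v\<close>.\<close>

lemma s_Cauchy: "Cauchy (\<lambda>n. \<pi> (s n) v)"
proof (rule metric_CauchyI)
  fix e :: real assume "0 < e"
  then obtain N where N: "\<And>l. l \<in> stab (\<lambda>_. {..<N}) \<Longrightarrow> norm (\<pi> l v - v) < e"
    by (rule near_identity) blast
  have "dist (\<pi> (s m) v) (\<pi> (s n) v) < e" if "N \<le> m" "N \<le> n" for m n
  proof -
    have "\<pi> (s m) v = \<pi> (s n) (\<pi> (inv\<^bsub>L\<^esub> (s n) \<star> s m) v)"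
      by (simp only: pi_mult L.inv_closed s_carrier pi_inv)
    then have "dist (\<pi> (s m) v) (\<pi> (s n) v) = norm (\<pi> (inv\<^bsub>L\<^esub> (s n) \<star> s m) v - v)"
      by (simp only: dist_norm norm_pi_diff s_carrier)
    then show ?thesis using N[OF inv_s_s_stab[OF that(2,1)]] by simp
  qed
  then show "\<exists>M. \<forall>m\<ge>M. \<forall>n\<ge>M. dist (\<pi> (s m) v) (\<pi> (s n) v) < e" by blast
qed

definition U :: "'h \<Rightarrow> 'h" where
  "U v = lim (\<lambda>n. \<pi> (s n) v)"

lemma U_limit: "(\<lambda>n. \<pi> (s n) v) \<longlonglongrightarrow> U v"
  unfolding U_def using s_Cauchy[of v] by (simp add: Cauchy_convergent_iff convergent_LIMSEQ_iff)

lemma U_add: "U (x + y) = U x + U y"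
proof -
  have "(\<lambda>n. \<pi> (s n) (x + y)) = (\<lambda>n. \<pi> (s n) x + \<pi> (s n) y)"
    using isometry_inner(3)[OF pi_isometry[OF s_carrier]] by blast
  then show ?thesis
    using tendsto_add[OF U_limit[of x] U_limit[of y]] U_limit[of "x + y"] LIMSEQ_unique by metis
qed

lemma norm_scaleC: "norm (scaleC a x) = cmod a * norm x" for x :: 'h
proof -
  have "cinner (scaleC a x) (scaleC a x) = a * cnj a * cinner x x"
    by (simp add: cinner_scaleC_left cinner_commute[of x "scaleC a x"]) (metis cinner_commute)
  moreover have "Im (cinner x x) = 0"
    using cinner_commute[of x x] by (metis cnj.simps(2) equal_neg_zero)
  then have "cinner x x = complex_of_real ((norm x)\<^sup>2)"
    by (simp add: complex_eq_iff power2_norm_eq_inner[of x] inner_eq_Re_cinner[of x])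
  ultimately have "cinner (scaleC a x) (scaleC a x) = complex_of_real ((cmod a * norm x)\<^sup>2)"
    by (simp add: power_mult_distrib flip: complex_norm_square)
  then have "(norm (scaleC a x))\<^sup>2 = (cmod a * norm x)\<^sup>2"
    by (simp only: power2_norm_eq_inner[of "scaleC a x"] inner_eq_Re_cinner[of "scaleC a x"]
        Re_complex_of_real)
  then show ?thesis
    by (simp add: power2_eq_iff_nonneg)
qed

lemma tendsto_scaleC:
  assumes "f \<longlonglongrightarrow> (x::'h)"
  shows "(\<lambda>n. scaleC a (f n)) \<longlonglongrightarrow> scaleC a x"
proof -
  have "scaleC a (f n) - scaleC a x = scaleC a (f n - x)" for n
    using scaleC_add_right[of a "f n - x" x] by simp
  then have "dist (scaleC a (f n)) (scaleC a x) = cmod a * dist (f n) x" for n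
    by (simp add: dist_norm norm_scaleC)
  then show ?thesis
    using tendsto_mult_right_zero[OF assms[unfolded tendsto_dist_iff[of f]], of "cmod a"]
    by (simp add: tendsto_dist_iff[of "\<lambda>n. scaleC a (f n)"])
qed

lemma U_scaleC: "U (scaleC a x) = scaleC a (U x)"
proof -
  have "(\<lambda>n. \<pi> (s n) (scaleC a x)) = (\<lambda>n. scaleC a (\<pi> (s n) x))"
    using isometry_inner(4)[OF pi_isometry[OF s_carrier]] by blast
  then show ?thesis
    using tendsto_scaleC[OF U_limit[of x]] U_limit[of "scaleC a x"] LIMSEQ_unique by metis
qed

lemma U_inner: "inner (U x) (U y) = inner x y"
proof -
  have "(\<lambda>n. inner (\<pi> (s n) x) (\<pi> (s n) y)) = (\<lambda>_. inner x y)"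
    using isometry_inner(1)[OF pi_isometry[OF s_carrier]] by blast
  then show ?thesis
    using tendsto_inner[OF U_limit[of x] U_limit[of y]] LIMSEQ_unique tendsto_const by metis
qed

lemma U_cinner: "cinner (U x) (U y) = cinner x y"
  by (simp add: cinner_eq_inner U_inner flip: U_scaleC)

text \<open>The limit of the vectors \<open>\<pi> (s n) v\<close> is fixed by \<open>K\<close>, since the inverse of
  \<open>s n\<close> conjugates \<open>K\<close> into the stabilizer of the first \<open>n\<close> basis vectors.\<close>

lemma U_fixed: "U v \<in> H0"
  unfolding fixed_space_iff
proof
  fix l assume l: "l \<in> K"
  note lL = stab_carrier[OF l]
  have "(\<lambda>n. \<pi> l (\<pi> (s n) v) - \<pi> (s n) v) \<longlonglongrightarrow> 0"
  proof (rule LIMSEQ_I)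
    fix e :: real assume "0 < e"
    then obtain N where N: "\<And>l. l \<in> stab (\<lambda>_. {..<N}) \<Longrightarrow> norm (\<pi> l v - v) < e"
      by (rule near_identity) blast
    have "norm (\<pi> l (\<pi> (s n) v) - \<pi> (s n) v - 0) < e" if "N \<le> n" for n
    proof -
      let ?c = "inv\<^bsub>L\<^esub> (s n) \<star> l \<star> s n"
      have "\<pi> l (\<pi> (s n) v) = \<pi> (s n) (\<pi> ?c v)"
        by (simp only: pi_mult L.inv_closed L.m_closed s_carrier lL pi_inv)
      then have "norm (\<pi> l (\<pi> (s n) v) - \<pi> (s n) v - 0) = norm (\<pi> ?c v - v)"
        by (simp only: diff_0_right norm_pi_diff s_carrier)
      moreover have "stab (\<lambda>_. {..<n}) \<subseteq> stab (\<lambda>_. {..<N})"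
        using that by (intro stabilizer_antimono) auto
      ultimately show ?thesis using N[OF subsetD[OF _ conj_K_stab[OF l]]] by simp
    qed
    then show "\<exists>N. \<forall>n\<ge>N. norm (\<pi> l (\<pi> (s n) v) - \<pi> (s n) v - 0) < e" by blast
  qed
  moreover have "(\<lambda>n. \<pi> l (\<pi> (s n) v)) \<longlonglongrightarrow> \<pi> l (U v)"
    by (rule isometry_tendsto[OF pi_isometry[OF lL] U_limit])
  ultimately have "(\<lambda>n. \<pi> l (\<pi> (s n) v) - \<pi> (s n) v) \<longlonglongrightarrow> 0"
    "(\<lambda>n. \<pi> l (\<pi> (s n) v) - \<pi> (s n) v) \<longlonglongrightarrow> \<pi> l (U v) - U v"
    by (auto intro: tendsto_diff U_limit)
  then have "\<pi> l (U v) - U v = 0" by (blast intro: LIMSEQ_unique)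
  then show "\<pi> l (U v) = U v" by simp
qed

text \<open>Conjugation with \<open>\<theta> m\<close> does not change \<open>norm (\<pi> l v - v)\<close> since \<open>\<pi> (\<theta> m) v = v\<close>, but it makes \<open>l\<close> fix
  the first vectors in \<open>\<Omega>\<close> too.\<close>

lemma fixed_vector_near_identity:
  assumes v: "v \<in> H0" and e: "0 < e"
  obtains N where "\<And>l. l \<in> stab (\<lambda>j. \<tau> j ` {..<N}) \<Longrightarrow> norm (\<pi> l v - v) < e"
proof -
  obtain n where n: "\<And>l. l \<in> stab (\<lambda>_. {..<n}) \<Longrightarrow> norm (\<pi> l v - v) < e"
    by (rule near_identity[OF e]) blast
  obtain N where N: "\<And>l. l \<in> stab (\<lambda>j. \<tau> j ` {..<N}) \<Longrightarrow>
      \<exists>m. \<theta> m \<star> l \<star> \<theta> m \<in> stab (\<lambda>_. {..<n})"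
    by (rule conj_into_neighbourhood[of n]) blast
  have "norm (\<pi> l v - v) < e" if l: "l \<in> stab (\<lambda>j. \<tau> j ` {..<N})" for l
  proof -
    obtain m where m: "\<theta> m \<star> l \<star> \<theta> m \<in> stab (\<lambda>_. {..<n})"
      using N[OF l] by blast
    have t: "\<pi> (\<theta> m) v = v" using v theta_K by (simp add: fixed_space_iff)
    have "\<pi> (\<theta> m \<star> l \<star> \<theta> m) v = \<pi> (\<theta> m) (\<pi> l v)"
      by (simp only: pi_mult L.m_closed theta_carrier stab_carrier[OF l] t)
    then have "norm (\<pi> (\<theta> m \<star> l \<star> \<theta> m) v - v) = norm (\<pi> l v - v)"
      using norm_pi_diff[OF theta_carrier, of m "\<pi> l v" v] t by simp
    then show ?thesis using n[OF m] by simp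
  qed
  then show ?thesis by (rule that)
qed

text \<open>The preimage is the limit of \<open>\<pi> (s n)\<^sup>-\<^sup>1 v\<close>, since \<open>\<pi> (s n)\<close> is isometric.\<close>

lemma fixed_in_range_U:
  assumes v: "v \<in> H0"
  shows "v \<in> range U"
proof -
  let ?w = "\<lambda>n. \<pi> (inv\<^bsub>L\<^esub> (s n)) v"
  have "Cauchy ?w"
  proof (rule metric_CauchyI)
    fix e :: real assume "0 < e"
    then obtain N where N: "\<And>l. l \<in> stab (\<lambda>j. \<tau> j ` {..<N}) \<Longrightarrow> norm (\<pi> l v - v) < e"
      by (rule fixed_vector_near_identity[OF v]) blast
    have "dist (?w m) (?w n) < e" if "N \<le> m" "N \<le> n" for m n
    proof -
      have "norm (?w m - ?w n) = norm (\<pi> (s n) (?w m) - \<pi> (s n) (?w n))"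
        by (simp only: norm_pi_diff s_carrier)
      also have "\<dots> = norm (\<pi> (s n \<star> inv\<^bsub>L\<^esub> (s m)) v - v)"
        by (simp only: pi_mult L.inv_closed s_carrier pi_inv)
      also have "\<dots> < e" by (rule N[OF s_inv_s_stab[OF that(2,1)]])
      finally show ?thesis by (simp add: dist_norm)
    qed
    then show "\<exists>M. \<forall>m\<ge>M. \<forall>n\<ge>M. dist (?w m) (?w n) < e" by blast
  qed
  then obtain w where w: "?w \<longlonglongrightarrow> w"
    using Cauchy_convergent convergent_def by blast
  have "dist (\<pi> (s n) w) v = dist (?w n) w" for n
  proof -
    have "norm (\<pi> (s n) w - \<pi> (s n) (?w n)) = norm (w - ?w n)"
      by (rule norm_pi_diff[OF s_carrier])
    then show ?thesis by (simp only: pi_inv s_carrier dist_norm norm_minus_commute[of w])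
  qed
  then have "(\<lambda>n. \<pi> (s n) w) \<longlonglongrightarrow> v"
    using w unfolding tendsto_dist_iff[of "\<lambda>n. \<pi> (s n) w"] tendsto_dist_iff[of ?w] by simp
  then have "v = U w" using U_limit LIMSEQ_unique by blast
  then show ?thesis by blast
qed

lemma range_U: "range U = H0"
  using U_fixed fixed_in_range_U by blast

lemma U_isometry_onto: "isometry_onto H0 U"
  by (simp add: isometry_onto_def complex_linear_def U_add U_scaleC range_U U_cinner)

text \<open>The limit of \<open>(i\<^sub>\<tau> g) (s n) = (s n) g\<close>, which holds for all large \<open>n\<close>.\<close>

lemma U_intertwines:
  assumes g: "g \<in> carrier G"
  shows "\<rho> (i\<^sub>\<tau> g) (U v) = U (\<rho> g v)"
proof -
  have "\<forall>\<^sub>F n in sequentially. \<rho> (i\<^sub>\<tau> g) (\<pi> (s n) v) = \<pi> (s n) (\<rho> g v)"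
    using i_tau_s[OF g]
  proof eventually_elim
    case (elim n)
    have "\<rho> (i\<^sub>\<tau> g) (\<pi> (s n) v) = \<rho> (i\<^sub>\<tau> g \<cdot> E (s n)) v"
      unfolding \<pi>_def by (rule rho_mult[symmetric, OF i_tau_closed[OF g] Es_closed(1)])
    also have "\<dots> = \<pi> (s n) (\<rho> g v)"
      unfolding elim \<pi>_def by (rule rho_mult[OF Es_closed(1) g])
    finally show ?case .
  qed
  then have "(\<lambda>n. \<rho> (i\<^sub>\<tau> g) (\<pi> (s n) v)) \<longlonglongrightarrow> U (\<rho> g v)"
    using U_limit[of "\<rho> g v"] by (simp add: tendsto_cong)
  moreover have "(\<lambda>n. \<rho> (i\<^sub>\<tau> g) (\<pi> (s n) v)) \<longlonglongrightarrow> \<rho> (i\<^sub>\<tau> g) (U v)"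
    by (rule isometry_tendsto[OF rho_isometry[OF i_tau_closed[OF g]] U_limit])
  ultimately show ?thesis by (blast intro: LIMSEQ_unique)
qed

subsection \<open>The projection onto the fixed vectors\<close>

text \<open>The orthogonal complement of the fixed vectors is spanned by the differences \<open>\<pi> l u - u\<close>.\<close>

definition W :: "'h set" where
  "W = closure (span {\<pi> l u - u | l u. l \<in> K})"

lemma W_subspace: "subspace W" "closed W"
  by (simp_all add: W_def subspace_closure)

lemma cinner_fixed_W:
  assumes u: "u \<in> H0" and w: "w \<in> W"
  shows "cinner u w = 0"
proof -
  have real: "inner u w = 0" if u: "u \<in> H0" for u
  proof -
    let ?Z = "{w. inner u w = 0}"
    have "inner u (\<pi> l x - x) = 0" if "l \<in> K" for l x
    proof -
      have "inner (\<pi> l u) (\<pi> l x) = inner u x"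
        by (rule isometry_inner(1)[OF pi_isometry[OF stab_carrier[OF that]]])
      then show ?thesis using u that by (simp add: fixed_space_iff inner_diff_right)
    qed
    then have "span {\<pi> l x - x | l x. l \<in> K} \<subseteq> ?Z"
      by (intro span_minimal subspace_hyperplane) auto
    then have "W \<subseteq> ?Z"
      unfolding W_def by (intro closure_minimal closed_hyperplane)
    then show ?thesis using w by blast
  qed
  moreover have "scaleC (- \<i>) u \<in> H0"
    using u isometry_inner(4)[OF pi_isometry[OF stab_carrier]] by (simp add: fixed_space_iff)
  ultimately show ?thesis using u by (simp add: cinner_eq_inner complex_eq_iff)
qed

text \<open>As \<open>\<pi> l\<close> is isometric, \<open>r\<close> is orthogonal to \<open>\<pi> l r - r\<close> only if this vector is zero.\<close>

lemma orthogonal_W_fixed: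
  assumes "\<And>w. w \<in> W \<Longrightarrow> inner r w = 0"
  shows "r \<in> H0"
  unfolding fixed_space_iff
proof
  fix l assume l: "l \<in> K"
  let ?d = "\<pi> l r - r"
  have "?d \<in> W"
    unfolding W_def using l by (intro subsetD[OF closure_subset] span_base) blast
  then have "inner r (\<pi> l r) = inner r r" using assms[of ?d] by (simp add: inner_diff_right)
  moreover have "inner (\<pi> l r) (\<pi> l r) = inner r r"
    by (rule isometry_inner(1)[OF pi_isometry[OF stab_carrier[OF l]]])
  ultimately have "inner ?d ?d = 0"
    by (simp add: inner_diff_left inner_diff_right inner_commute)
  then show "\<pi> l r = r" by simp
qed

abbreviation "P \<equiv> orthogonal_projection H0"

lemma H0_diff: "u \<in> H0 \<Longrightarrow> v \<in> H0 \<Longrightarrow> u - v \<in> H0"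
  using isometry_inner(5)[OF pi_isometry[OF stab_carrier]] by (simp add: fixed_space_iff)

lemma P_eqI:
  assumes "w \<in> H0" "v - w \<in> W"
  shows "P v = w"
  unfolding orthogonal_projection_def
proof (rule the_equality)
  show "w \<in> H0 \<and> (\<forall>u\<in>H0. cinner u (v - w) = 0)"
    using assms cinner_fixed_W by blast
next
  fix w' assume w': "w' \<in> H0 \<and> (\<forall>u\<in>H0. cinner u (v - w') = 0)"
  then have "w - w' \<in> H0" using assms(1) H0_diff by blast
  then have "inner (w - w') (v - w) = 0" "inner (w - w') (v - w') = 0"
    using w' cinner_fixed_W[OF _ assms(2)] by (simp_all add: inner_eq_Re_cinner)
  then have "inner (w - w') (w - w') = 0" by (simp add: inner_diff_right)
  then show "w' = w" by simp
qed

lemma P_fixed: "P v \<in> H0" and P_diff_W: "v - P v \<in> W"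
proof -
  obtain q where q: "q \<in> W" "\<And>w. w \<in> W \<Longrightarrow> inner (v - q) w = 0"
    using projection_exists[OF W_subspace] by blast
  have r: "v - q \<in> H0" by (rule orthogonal_W_fixed[OF q(2)])
  then have "P v = v - q" using q(1) by (intro P_eqI) simp_all
  then show "P v \<in> H0" "v - P v \<in> W" using r q(1) by simp_all
qed

lemma inner_P_left: "inner (P u) v = inner (P u) (P v)"
proof -
  have "inner (P u) (v - P v) = 0"
    using cinner_fixed_W[OF P_fixed P_diff_W] by (simp add: inner_eq_Re_cinner)
  then show ?thesis by (simp add: inner_diff_right)
qed

lemma P_self_adjoint: "inner (P u) v = inner u (P v)"
  by (metis inner_P_left inner_commute)

lemma P_id: "v \<in> H0 \<Longrightarrow> P v = v"
  by (rule P_eqI) (simp_all add: subspace_0 W_subspace)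

lemma P_norm: "norm (P v) \<le> norm v"
proof -
  have "(norm (P v))\<^sup>2 = inner (P v) v"
    using inner_P_left[of v v] by (simp add: power2_norm_eq_inner)
  also have "\<dots> \<le> norm (P v) * norm v" by (rule norm_cauchy_schwarz)
  finally show ?thesis
    by (cases "norm (P v) = 0") (auto simp: power2_eq_square)
qed

lemma inner_scaleC_right: "inner x (scaleC a y) = inner (scaleC (cnj a) x) (y::'h)"
proof -
  have "cinner x (scaleC a y) = cnj (a * cinner y x)"
    by (subst cinner_commute) (simp add: cinner_scaleC_left)
  also have "\<dots> = cinner (scaleC (cnj a) x) y"
    by (simp add: cinner_scaleC_left) (metis cinner_commute)
  finally show ?thesis by (simp add: inner_eq_Re_cinner)
qed

lemma eq_by_inner: "(\<And>w. inner x w = inner y w) \<Longrightarrow> x = (y::'h)"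
  by (metis inner_commute vector_eq_rdot)

lemma P_add: "P (x + y) = P x + P y"
  by (rule eq_by_inner) (simp add: P_self_adjoint inner_add_left)

lemma H0_scaleC: "u \<in> H0 \<Longrightarrow> scaleC a u \<in> H0"
  using isometry_inner(4)[OF pi_isometry[OF stab_carrier]] by (simp add: fixed_space_iff)

lemma P_scaleC: "P (scaleC a x) = scaleC a (P x)"
proof (rule eq_by_inner)
  fix w
  have "inner (scaleC a (P x)) w = inner (scaleC a (P x)) (P w)"
    using cinner_fixed_W[OF H0_scaleC[OF P_fixed] P_diff_W, of a x w]
    by (simp add: inner_eq_Re_cinner[symmetric] inner_diff_right complex_eq_iff)
  also have "\<dots> = inner (P x) (scaleC (cnj a) (P w))"
    by (simp add: inner_scaleC_right)
  also have "\<dots> = inner x (scaleC (cnj a) (P w))"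
    by (simp add: P_self_adjoint P_id[OF H0_scaleC[OF P_fixed]])
  also have "\<dots> = inner (P (scaleC a x)) w"
    by (simp add: inner_scaleC_right P_self_adjoint)
  finally show "inner (P (scaleC a x)) w = inner (scaleC a (P x)) w" by simp
qed

lemma P_pi: "l \<in> K \<Longrightarrow> P (\<pi> l v) = P v"
proof -
  assume l: "l \<in> K"
  have "\<pi> l v - v \<in> W"
    unfolding W_def using l by (intro subsetD[OF closure_subset] span_base) blast
  then have "(\<pi> l v - v) + (v - P v) \<in> W"
    by (intro subspace_add W_subspace P_diff_W)
  then show ?thesis by (intro P_eqI P_fixed) simp
qed

text \<open>The involutions \<open>\<theta> m\<close> tend weakly to the projection: on \<open>\<pi> l u - u\<close> they act by
  \<open>\<theta> m l = l' \<theta> m\<close> where \<open>l'\<close> tends to the identity.\<close>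

lemma theta_weakly_null_difference:
  assumes l: "l \<in> K"
  shows "(\<lambda>n. inner (\<pi> (\<theta> (\<lambda>_. n)) (\<pi> l u - u)) w) \<longlonglongrightarrow> 0"
proof (rule LIMSEQ_I)
  fix e :: real assume e: "0 < e"
  have "0 < e / (norm u + 1)" using e by (simp add: add_nonneg_pos)
  then obtain n0 where n0: "\<And>l. l \<in> stab (\<lambda>_. {..<n0}) \<Longrightarrow> norm (\<pi> l w - w) < e / (norm u + 1)"
    by (rule near_identity) blast
  obtain N where N: "K_fixing N \<subseteq> stab (\<lambda>_. {..<n0})"
    by (rule K_fixing_subset_initial)
  obtain M where M: "\<And>m. (\<And>j. j < length Ls \<Longrightarrow> M \<le> m j) \<Longrightarrow> \<theta> m \<star> l \<star> \<theta> m \<in> K_fixing N"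
    by (rule theta_conj_K[OF l]) blast
  have "norm (inner (\<pi> (\<theta> (\<lambda>_. n)) (\<pi> l u - u)) w - 0) < e" if "M \<le> n" for n
  proof -
    let ?t = "\<theta> (\<lambda>_. n)"
    let ?l = "?t \<star> l \<star> ?t" and ?u = "\<pi> ?t u"
    have l': "?l \<in> stab (\<lambda>_. {..<n0})" using M[of "\<lambda>_. n"] that N by blast
    note lL = stab_carrier[OF l'] and tL = theta_carrier
    have "\<pi> ?l ?u = \<pi> ?t (\<pi> l (\<pi> (?t \<star> ?t) u))"
      by (simp only: pi_mult L.m_closed tL stab_carrier[OF l])
    then have "\<pi> ?t (\<pi> l u - u) = \<pi> ?l ?u - ?u"
      by (simp only: theta_theta pi_one isometry_inner(5)[OF pi_isometry[OF tL]])
    then have "inner (\<pi> ?t (\<pi> l u - u)) w = inner (\<pi> ?l ?u) w - inner ?u w"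
      by (simp only: inner_diff_left)
    also have "inner ?u w = inner (\<pi> ?l ?u) (\<pi> ?l w)"
      by (rule isometry_inner(1)[OF pi_isometry[OF lL], symmetric])
    also have "inner (\<pi> ?l ?u) w - \<dots> = inner (\<pi> ?l ?u) (w - \<pi> ?l w)"
      by (simp only: inner_diff_right)
    finally have "\<bar>inner (\<pi> ?t (\<pi> l u - u)) w\<bar> \<le> norm (\<pi> ?l ?u) * norm (w - \<pi> ?l w)"
      using Cauchy_Schwarz_ineq2 by simp
    also have "norm (\<pi> ?l ?u) = norm u"
      by (simp only: isometry_inner(2)[OF pi_isometry[OF lL]] isometry_inner(2)[OF pi_isometry[OF tL]])
    also have "norm u * norm (w - \<pi> ?l w) \<le> norm u * (e / (norm u + 1))"
      using n0[OF l'] by (intro mult_left_mono) (auto simp: norm_minus_commute)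
    also have "\<dots> < e"
      by (rule mult_divide_less[OF e norm_ge_zero])
    finally show ?thesis by simp
  qed
  then show "\<exists>N. \<forall>n\<ge>N. norm (inner (\<pi> (\<theta> (\<lambda>_. n)) (\<pi> l u - u)) w - 0) < e" by blast
qed

text \<open>Weak convergence to zero passes from the differences to their closed span since the
  operators are isometric.\<close>

lemma theta_weakly_null:
  assumes q: "q \<in> W"
  shows "(\<lambda>n. inner (\<pi> (\<theta> (\<lambda>_. n)) q) w) \<longlonglongrightarrow> 0"
proof (rule LIMSEQ_I)
  fix e :: real assume e: "0 < e"
  let ?t = "\<lambda>n. \<pi> (\<theta> (\<lambda>_. n))"
  note t = isometry_inner[OF pi_isometry[OF theta_carrier]]
  let ?Z = "{x. (\<lambda>n. inner (?t n x) w) \<longlonglongrightarrow> 0}"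
  have "subspace ?Z"
  proof (rule subspaceI)
    have "?t n 0 = 0" for n using t(5)[of _ 0 0] by simp
    then show "0 \<in> ?Z" by simp
    show "x + y \<in> ?Z" if "x \<in> ?Z" "y \<in> ?Z" for x y
      using tendsto_add[of "\<lambda>n. inner (?t n x) w" 0 _ "\<lambda>n. inner (?t n y) w" 0] that
      by (simp add: t(3) inner_add_left)
    show "c *\<^sub>R x \<in> ?Z" if "x \<in> ?Z" for c x
      using tendsto_mult_right_zero[of "\<lambda>n. inner (?t n x) w" _ c] that t(4)[of _ "complex_of_real c" x]
      by (simp add: scaleC_of_real)
  qed
  then have sub: "span {\<pi> l u - u | l u. l \<in> K} \<subseteq> ?Z"
    using theta_weakly_null_difference by (intro span_minimal) auto
  have "0 < e / 2 / (norm w + 1)" using e by (simp add: add_nonneg_pos)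
  then obtain q' where q': "q' \<in> span {\<pi> l u - u | l u. l \<in> K}" "dist q' q < e / 2 / (norm w + 1)"
    using q unfolding W_def closure_approachable by blast
  have "(\<lambda>n. inner (?t n q') w) \<longlonglongrightarrow> 0" using sub q'(1) by blast
  then obtain N where N: "\<And>n. n \<ge> N \<Longrightarrow> norm (inner (?t n q') w - 0) < e / 2"
    using e LIMSEQ_D[of "\<lambda>n. inner (?t n q') w" 0 "e / 2"] by auto
  have "norm (inner (?t n q) w - 0) < e" if "N \<le> n" for n
  proof -
    have "inner (?t n q) w = inner (?t n q') w + inner (?t n (q - q')) w"
      by (simp add: t(5) inner_diff_left)
    moreover have "\<bar>inner (?t n (q - q')) w\<bar> < e / 2"
    proof -
      have "\<bar>inner (?t n (q - q')) w\<bar> \<le> norm (q - q') * norm w"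
        using Cauchy_Schwarz_ineq2[of "?t n (q - q')" w] by (simp add: t(2))
      also have "\<dots> \<le> e / 2 / (norm w + 1) * norm w"
        using q'(2) by (intro mult_right_mono) (auto simp: dist_norm norm_minus_commute)
      also have "\<dots> < e / 2"
        using mult_divide_less[of "e / 2" "norm w"] e by (simp add: mult.commute)
      finally show ?thesis .
    qed
    ultimately show ?thesis using N[OF that] by simp
  qed
  then show "\<exists>N. \<forall>n\<ge>N. norm (inner (?t n q) w - 0) < e" by blast
qed

lemma theta_weakly_projection:
  "(\<lambda>n. inner (\<pi> (\<theta> (\<lambda>_. n)) u) w) \<longlonglongrightarrow> inner (P u) w"
proof -
  have "\<pi> (\<theta> m) u = P u + \<pi> (\<theta> m) (u - P u)" for m
  proof -
    have "\<pi> (\<theta> m) (P u) = P u" using P_fixed theta_K by (simp add: fixed_space_iff)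
    then show ?thesis by (simp add: isometry_inner(5)[OF pi_isometry[OF theta_carrier]])
  qed
  then have "inner (\<pi> (\<theta> (\<lambda>_. n)) u) w = inner (P u) w + inner (\<pi> (\<theta> (\<lambda>_. n)) (u - P u)) w" for n
    by (metis inner_add_left)
  then show ?thesis
    using tendsto_add[OF tendsto_const theta_weakly_null[OF P_diff_W[of u]], of "inner (P u) w" w]
    by simp
qed

subsection \<open>The representation of the mantle\<close>

abbreviation "\<rho>' \<equiv> rho_bar Gs Ls S \<Xi> \<rho>"

lemma rho_bar_coset:
  assumes g: "g \<in> carrier G" and v: "v \<in> H0"
  shows "\<rho>' (C g) v = P (\<rho> g v)"
proof -
  have eq: "P (\<rho> h v) = P (\<rho> g v)" if h: "h \<in> C g" for h
  proof -
    obtain a b where ab: "a \<in> K" "b \<in> K" "h = E a \<cdot> g \<cdot> E b"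
      using h by (rule coset_memE)
    have "\<rho> h v = \<pi> a (\<rho> g (\<pi> b v))"
      unfolding ab(3) \<pi>_def using g ab(1,2) by (simp only: rho_mult G.m_closed E_K_closed)
    then show ?thesis
      using v ab by (simp add: fixed_space_iff P_pi)
  qed
  show ?thesis
    unfolding rho_bar_def
  proof (rule the_equality)
    show "\<forall>h\<in>C g. P (\<rho> g v) = P (\<rho> h v)"
      by (intro ballI eq[symmetric])
    show "w = P (\<rho> g v)" if "\<forall>h\<in>C g. w = P (\<rho> h v)" for w
      using that coset_self[OF g] by blast
  qed
qed

text \<open>\<open>P \<rho> (g \<theta>\<^sub>m h)\<close> is constant for large \<open>m\<close> and tends weakly to \<open>P \<rho> (g) P \<rho> (h)\<close>.\<close>

lemma rho_bar_mult:
  assumes g: "g \<in> carrier G" and h: "h \<in> carrier G" and v: "v \<in> H0"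
  shows "\<rho>' (C g \<otimes>\<^bsub>\<Gamma>\<^esub> C h) v = P (\<rho> g (P (\<rho> h v)))"
proof (rule eq_by_inner)
  fix w
  obtain M where M: "\<And>m. large M m \<Longrightarrow> C g \<otimes>\<^bsub>\<Gamma>\<^esub> C h = C (g \<cdot> E (\<theta> m) \<cdot> h)"
    by (rule mantle_mult[OF g h]) blast
  let ?t = "\<lambda>n. \<theta> (\<lambda>_. n)"
  obtain w' where w': "\<rho> g w' = P w" using rho_surj[OF g] by blast
  have move: "inner (P (\<rho> g x)) w = inner x w'" for x
    using isometry_inner(1)[OF rho_isometry[OF g], of x w'] by (simp add: P_self_adjoint w')
  have "inner (\<rho>' (C g \<otimes>\<^bsub>\<Gamma>\<^esub> C h) v) w = inner (\<pi> (?t n) (\<rho> h v)) w'" if "M \<le> n" for n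
  proof -
    have "C g \<otimes>\<^bsub>\<Gamma>\<^esub> C h = C (g \<cdot> E (?t n) \<cdot> h)"
      using that by (intro M) (simp add: large_def)
    moreover have "g \<cdot> E (?t n) \<cdot> h \<in> carrier G"
      using g h by (simp only: G.m_closed E_K_closed theta_K)
    ultimately have "\<rho>' (C g \<otimes>\<^bsub>\<Gamma>\<^esub> C h) v = P (\<rho> (g \<cdot> E (?t n) \<cdot> h) v)"
      using rho_bar_coset[OF _ v] by metis
    also have "\<dots> = P (\<rho> g (\<pi> (?t n) (\<rho> h v)))"
      unfolding \<pi>_def using g h by (simp only: rho_mult G.m_closed E_K_closed theta_K)
    finally show ?thesis by (simp only: move)
  qed
  then have "\<forall>\<^sub>F n in sequentially.
      inner (\<pi> (?t n) (\<rho> h v)) w' = inner (\<rho>' (C g \<otimes>\<^bsub>\<Gamma>\<^esub> C h) v) w"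
    by (intro eventually_sequentiallyI[of M]) simp
  then have "(\<lambda>n. inner (\<pi> (?t n) (\<rho> h v)) w') \<longlonglongrightarrow> inner (\<rho>' (C g \<otimes>\<^bsub>\<Gamma>\<^esub> C h) v) w"
    by (rule tendsto_eventually)
  then have "inner (\<rho>' (C g \<otimes>\<^bsub>\<Gamma>\<^esub> C h) v) w = inner (P (\<rho> h v)) w'"
    using theta_weakly_projection LIMSEQ_unique by blast
  then show "inner (\<rho>' (C g \<otimes>\<^bsub>\<Gamma>\<^esub> C h) v) w = inner (P (\<rho> g (P (\<rho> h v)))) w"
    by (simp only: move)
qed

definition R :: "(nat \<Rightarrow> basis_vec hmat) set \<Rightarrow> 'h \<Rightarrow> 'h" where
  "R \<gamma> v = inv_into UNIV U (\<rho>' \<gamma> (U v))"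

lemma U_R:
  assumes "g \<in> carrier G"
  shows "U (R (C g) v) = P (\<rho> g (U v))"
proof -
  have "P (\<rho> g (U v)) \<in> range U" using P_fixed range_U by blast
  then show ?thesis by (simp add: R_def rho_bar_coset[OF assms U_fixed] f_inv_into_f)
qed

lemma U_eq_iff: "U x = U y \<longleftrightarrow> x = y"
  by (rule isometry_inner(6)[OF U_isometry_onto])

lemma R_bounded:
  assumes g: "g \<in> carrier G"
  shows "complex_linear (R (C g))" "bounded_linear (R (C g))"
proof -
  note rho = isometry_inner[OF rho_isometry[OF g]] and U = isometry_inner[OF U_isometry_onto]
  have add: "R (C g) (x + y) = R (C g) x + R (C g) y" for x y
    by (simp add: U_R[OF g] P_add rho(3) U(3) flip: U_eq_iff)
  have scale: "R (C g) (scaleC a x) = scaleC a (R (C g) x)" for a x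
    by (simp add: U_R[OF g] P_scaleC rho(4) U(4) flip: U_eq_iff)
  show "complex_linear (R (C g))"
    by (simp add: complex_linear_def add scale)
  show "bounded_linear (R (C g))"
  proof (rule bounded_linear_intro[where K = 1])
    show "R (C g) (r *\<^sub>R x) = r *\<^sub>R R (C g) x" for r x
      using scale[of "complex_of_real r" x] by (simp add: scaleC_of_real)
    show "norm (R (C g) x) \<le> norm x * 1" for x
      using P_norm[of "\<rho> g (U x)"] U(2)[of "R (C g) x"] U(2)[of x]
      by (simp add: U_R[OF g] rho(2))
  qed (rule add)
qed

lemma R_hom: "R \<in> hom \<Gamma> bounded_operators"
proof (rule homI)
  fix \<gamma> assume "\<gamma> \<in> carrier \<Gamma>"
  then show "R \<gamma> \<in> carrier bounded_operators"
    by (auto simp: mantle_carrier bounded_operators_def R_bounded)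
next
  fix \<gamma> \<delta> assume "\<gamma> \<in> carrier \<Gamma>" "\<delta> \<in> carrier \<Gamma>"
  then obtain g h where g: "g \<in> carrier G" "\<gamma> = C g" and h: "h \<in> carrier G" "\<delta> = C h"
    by (auto simp: mantle_carrier)
  have "R (C g \<otimes>\<^bsub>\<Gamma>\<^esub> C h) v = R (C g) (R (C h) v)" for v
  proof -
    have "R (C g \<otimes>\<^bsub>\<Gamma>\<^esub> C h) v = inv_into UNIV U (P (\<rho> g (P (\<rho> h (U v)))))"
      by (simp only: R_def rho_bar_mult[OF g(1) h(1) U_fixed])
    also have "\<dots> = inv_into UNIV U (U (R (C g) (R (C h) v)))"
      by (simp only: U_R[OF g(1)] U_R[OF h(1)])
    also have "\<dots> = R (C g) (R (C h) v)"
      by (rule inv_f_f) (simp add: inj_def U_eq_iff)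
    finally show ?thesis .
  qed
  then show "R (\<gamma> \<otimes>\<^bsub>\<Gamma>\<^esub> \<delta>) = R \<gamma> \<otimes>\<^bsub>bounded_operators\<^esub> R \<delta>"
    by (auto simp: g(2) h(2) bounded_operators_def)
qed

lemma R_equivalent: "unitarily_equivalent \<Gamma> R H0 \<rho>'"
  unfolding unitarily_equivalent_def
proof (intro exI[of _ U] conjI ballI allI U_isometry_onto)
  fix \<gamma> v assume "\<gamma> \<in> carrier \<Gamma>"
  then obtain g where "g \<in> carrier G" "\<gamma> = C g" by (auto simp: mantle_carrier)
  then show "U (R \<gamma> v) = \<rho>' \<gamma> (U v)"
    by (simp add: U_R rho_bar_coset[OF _ U_fixed])
qed

lemma R_extends:
  assumes g: "g \<in> carrier G"
  shows "R (\<iota> g) = \<rho> g"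
proof
  fix v
  have "U (R (\<iota> g) v) = P (\<rho> (i\<^sub>\<tau> g) (U v))"
    unfolding mantle_embedding_def by (rule U_R[OF i_tau_closed[OF g]])
  also have "\<dots> = U (\<rho> g v)"
    by (simp only: U_intertwines[OF g] P_id[OF U_fixed])
  finally show "R (\<iota> g) v = \<rho> g v" by (simp only: U_eq_iff)
qed

end

theorem mainTheorem5:
  fixes Gs :: "classical list" and Ls :: "scalars list"
    and S :: "nat \<Rightarrow> nat \<Rightarrow> straight_data"
    and \<Xi> :: "nat \<Rightarrow> nat set" and \<tau> \<omega> :: "nat \<Rightarrow> nat \<Rightarrow> nat"
    and \<rho> :: "(nat \<Rightarrow> basis_vec hmat) \<Rightarrow> 'h::chilbert_space \<Rightarrow> 'h"
  assumes "GL_pair Gs Ls S"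
    and "is_splitting (length Ls) \<Xi> \<tau> \<omega>"
    and "pair_representation Gs Ls S \<rho>"
  shows "mantle_embedding Gs Ls S \<Xi> \<tau> \<in> hom (classical_group Gs) (mantle Gs Ls S \<Xi> \<omega>) \<and>
    inj_on (mantle_embedding Gs Ls S \<Xi> \<tau>) (carrier (classical_group Gs)) \<and>
    (\<exists>R. R \<in> hom (mantle Gs Ls S \<Xi> \<omega>) bounded_operators \<and>
         unitarily_equivalent (mantle Gs Ls S \<Xi> \<omega>) R
           (fixed_space Gs Ls S \<Xi> \<rho>) (rho_bar Gs Ls S \<Xi> \<rho>) \<and>
         (\<forall>g \<in> carrier (classical_group Gs). R (mantle_embedding Gs Ls S \<Xi> \<tau> g) = \<rho> g))"
proof -
  interpret mantle_representation Gs Ls S \<Xi> \<tau> \<omega> \<rho>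
    by unfold_locales (fact assms)+
  show ?thesis
    using mantle_embedding_hom mantle_embedding_inj R_hom R_equivalent R_extends by blast
qed

end
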